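(* The poset of rotations $(\mathcal{R},\lessdot)$ can be constructed in time $O(|E|^2)$ (including oracle calls). That is, there is an algorithm which, given the bipartite graph $G=(V=W\sqcup F,E)$, the linear orders $>_w$ ($w\in W$) and oracles for the choice functions $C_f$ ($f\in F$), constructs the set $\mathcal{R}$ of all rotations and the partial order $\lessdot$ on it, in time $O(|E|^2)$.
   Context: Setting. $G=(V,E)$ is a finite connected bipartite graph without multiple edges, with vertex parts $W$ and $F$; the edge joining $w\in W$ and $f\in F$ is denoted $wf$. $E_v$ is the set of edges incident to $v\in V$, and $X_v:=X\cap E_v$ for $X\subseteq E$. Each $w\in W$ has a strict linear order $>_w$ on $E_w$ ($e>_w e'$ means that $e$ is preferred to $e'$) and quota $q(w)=1$; accordingly $C_w(Z)$, for nonempty $Z\subseteq E_w$, is the one-element set formed by the $>_w$-largest element of $Z$, and $C_w(\emptyset)=\emptyset$. Each $f\in F$ has a choice function $C_f:2^{E_f}\to 2^{E_f}$ with $C_f(Z)\subseteq Z$, satisfying for all $Z,Z'\subseteq E_f$: (A1) if $Z\supseteq Z'\supseteq C_f(Z)$ then $C_f(Z')=C_f(Z)$; (A2) if $Z\supseteq Z'$ then $C_f(Z)\cap Z'\subseteq C_f(Z')$; (A3) if $Z\supseteq Z'$ then $|C_f(Z)|\ge |C_f(Z')|$. Stability. A matching is an arbitrary subset $X\subseteq E$. A set $Z\subseteq E_v$ is acceptable if $C_v(Z)=Z$; $X\subseteq E$ is acceptable if all $X_v$, $v\in V$, are. For acceptable $Z,Z'\subseteq E_v$, $Z\succeq_v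 Z'$ means $C_v(Z\cup Z')=Z$. For distinct acceptable matchings $X,Y$, $X\succ_F Y$ (also written $X\succ Y$, or $Y\prec X$) means $X_f\succeq_f Y_f$ for all $f\in F$. An acceptable $X$ is stable if there is no edge $e=wf\in E\setminus X$ with both $e\in C_w(X_w\cup\{e\})$ and $e\in C_f(X_f\cup\{e\})$. $\mathcal{S}$ is the set of stable matchings. It is known that $\mathcal{S}\neq\emptyset$ and $(\mathcal{S},\prec_F)$ is a distributive lattice; its minimal and maximal elements are denoted $X^{\min}$, $X^{\max}$. Active graph and rotations. Let $X\in\mathcal{S}$. For $w\in W$ with $|X_w|=1$, let $x_w$ be the unique edge of $X_w$. If the set of edges $e=wf\in E_w$ with $x_w>_w e$ and $e\in C_f(X_f\cup\{e\})$ is nonempty, its $>_w$-largest element is called $W$-admissible and denoted $a_w$. If $a_w=wf$ and $C_f(X_f\cup\{a_w\})=(X_f\setminus\{e'\})\cup\{a_w\}$ for some $e'\in X_f$, then $e'$ is called $F$-admissible, is denoted $b^w_f$ and said to be associated with $a_w$, and $(a_w,b^w_f)$ is called a tandem passing $f$ (the only other possibility is $C_f(X_f\cup\{a_w\})=X_f\cup\{a_w\}$, when $a_w$ generates no tandem). Let $D(X)$ be the directed graph on $V$ whose edges are the $W$-admissible edges directed from $W$ to $F$ and the $F$-admissible edges directed from $F$ to $W$. Cleaning procedure: as long as the current graph has a vertex $w\in W$ with a leaving edge $a_w=(w,f)$ but no entering edge, delete $a_w$, and if $a_w$ has an associated edge $b^w_f$ which occurs in no other tandem passing $f$ in the current graph,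 delete $b^w_f$ as well; isolated vertices are removed. The final graph $\Gamma(X)$ is the active graph of $X$. In it every $w\in W$ that remains has exactly one entering and one leaving edge, and for every remaining $f\in F$ the tandems passing $f$ partition the set of edges at $f$. Hence $\Gamma(X)$ decomposes uniquely into pairwise edge-disjoint directed cycles (edge-simple, possibly visiting a vertex of $F$ several times) which at each $w\in W$ go from the entering to the leaving edge, and at each visit to $f\in F$ traverse a tandem ($a_w$, then $b^w_f$). These cycles are the rotations generated by $X$; their set is $\mathcal{L}(X)$. For a rotation $L$, $L^+$ is the set of its edges going from $W$ to $F$ and $L^-$ the set of its edges going from $F$ to $W$ (both regarded as subsets of $E$); a rotation is identified by the pair $(L^+,L^-)$. Applying $L\in\mathcal{L}(X)$ to $X$ gives $(X\setminus L^-)\cup L^+$, which is again a stable matching. Poset of rotations. A route from $X_0$ to $X_N$ is a sequence $X_0,X_1,\ldots,X_N$ with $X_0$ stable and $X_i=(X_{i-1}\setminus L_i^-)\cup L_i^+$ for some $L_i\in\mathcal{L}(X_{i-1})$; its set of rotations is $\{L_1,\ldots,L_N\}$. A full route is one from $X^{\min}$ to $X^{\max}$. All full routes have the same set of rotations, denoted $\mathcal{R}$. For $R,R'\in\mathcal{R}$, $R\lessdot R'$ means that in every full route $R$ is applied earlier than $R'$; this is a partial order. Computational model. Each $C_f$ is given by an oracle that, asked about $Z\subseteq E_f$, returns $C_f(Z)$, each call counted as $O(1)$ time; time is the number of standard operations plus oracle calls. To construct the poset means to output the list of all rotations and a directed graph on it (the Hasse diagram) determining $\lessdot$. *)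

theory Defs
  imports Main
begin

section \<open>Bipartite markets and stable matchings\<close>

text \<open>The two vertex parts are kept apart by their types, and the edge \<open>wf\<close> is the pair
  \<open>(w, f)\<close>. \<open>(e, e') \<in> pref G w\<close> means \<open>e >\<^sub>w e'\<close>; \<open>choice G f\<close> is \<open>C\<^sub>f\<close>.\<close>

record ('w, 'f) market =
  Wpart :: "'w set"
  Fpart :: "'f set"
  edges :: "('w \<times> 'f) set"
  pref :: "'w \<Rightarrow> (('w \<times> 'f) \<times> ('w \<times> 'f)) set"
  choice :: "'f \<Rightarrow> ('w \<times> 'f) set \<Rightarrow> ('w \<times> 'f) set"

definition at_W :: "'w \<Rightarrow> ('w \<times> 'f) set \<Rightarrow> ('w \<times> 'f) set" where
  "at_W w X = {e \<in> X. fst e = w}"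

definition at_F :: "'f \<Rightarrow> ('w \<times> 'f) set \<Rightarrow> ('w \<times> 'f) set" where
  "at_F f X = {e \<in> X. snd e = f}"

definition adjacency :: "('w, 'f) market \<Rightarrow> (('w + 'f) \<times> ('w + 'f)) set" where
  "adjacency G = {(Inl w, Inr f) | w f. (w, f) \<in> edges G}
               \<union> {(Inr f, Inl w) | w f. (w, f) \<in> edges G}"

definition connected_market :: "('w, 'f) market \<Rightarrow> bool" where
  "connected_market G \<longleftrightarrow>
     (\<forall>u \<in> Wpart G <+> Fpart G. \<forall>v \<in> Wpart G <+> Fpart G. (u, v) \<in> (adjacency G)\<^sup>*)"

text \<open>\<open>choice_axioms S C\<close> says that \<open>C\<close>, considered on the subsets of \<open>S\<close> only, is a choice
  function satisfying (A1), (A2), (A3).\<close>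

definition choice_axioms :: "'e set \<Rightarrow> ('e set \<Rightarrow> 'e set) \<Rightarrow> bool" where
  "choice_axioms S C \<longleftrightarrow>
     (\<forall>Z \<subseteq> S. C Z \<subseteq> Z) \<and>
     (\<forall>Z Z'. Z \<subseteq> S \<and> Z' \<subseteq> Z \<and> C Z \<subseteq> Z' \<longrightarrow> C Z' = C Z) \<and>
     (\<forall>Z Z'. Z \<subseteq> S \<and> Z' \<subseteq> Z \<longrightarrow> C Z \<inter> Z' \<subseteq> C Z') \<and>
     (\<forall>Z Z'. Z \<subseteq> S \<and> Z' \<subseteq> Z \<longrightarrow> card (C Z') \<le> card (C Z))"

definition market :: "('w, 'f) market \<Rightarrow> bool" where
  "market G \<longleftrightarrow>
     finite (Wpart G) \<and> finite (Fpart G) \<and> edges G \<subseteq> Wpart G \<times> Fpart G \<and>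
     connected_market G \<and>
     (\<forall>w \<in> Wpart G. pref G w \<subseteq> at_W w (edges G) \<times> at_W w (edges G) \<and>
                     strict_linear_order_on (at_W w (edges G)) (pref G w)) \<and>
     (\<forall>f \<in> Fpart G. choice_axioms (at_F f (edges G)) (choice G f))"

definition W_choice :: "('w, 'f) market \<Rightarrow> 'w \<Rightarrow> ('w \<times> 'f) set \<Rightarrow> ('w \<times> 'f) set" where
  "W_choice G w Z = {e \<in> Z. \<forall>e' \<in> Z. e' \<noteq> e \<longrightarrow> (e, e') \<in> pref G w}"

definition acceptable :: "('w, 'f) market \<Rightarrow> ('w \<times> 'f) set \<Rightarrow> bool" where
  "acceptable G X \<longleftrightarrow> X \<subseteq> edges G \<and>
     (\<forall>w \<in> Wpart G. W_choice G w (at_W w X) = at_W w X) \<and>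
     (\<forall>f \<in> Fpart G. choice G f (at_F f X) = at_F f X)"

definition F_better :: "('w, 'f) market \<Rightarrow> ('w \<times> 'f) set \<Rightarrow> ('w \<times> 'f) set \<Rightarrow> bool" where
  "F_better G X Y \<longleftrightarrow> acceptable G X \<and> acceptable G Y \<and> X \<noteq> Y \<and>
     (\<forall>f \<in> Fpart G. choice G f (at_F f X \<union> at_F f Y) = at_F f X)"

definition stable :: "('w, 'f) market \<Rightarrow> ('w \<times> 'f) set \<Rightarrow> bool" where
  "stable G X \<longleftrightarrow> acceptable G X \<and>
     \<not> (\<exists>w f. (w, f) \<in> edges G - X \<and>
              (w, f) \<in> W_choice G w (at_W w X \<union> {(w, f)}) \<and>
              (w, f) \<in> choice G f (at_F f X \<union> {(w, f)}))"

definition least_stable :: "('w, 'f) market \<Rightarrow> ('w \<times> 'f) set \<Rightarrow> bool" where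
  "least_stable G X \<longleftrightarrow> stable G X \<and> (\<forall>Y. stable G Y \<and> Y \<noteq> X \<longrightarrow> F_better G Y X)"

definition greatest_stable :: "('w, 'f) market \<Rightarrow> ('w \<times> 'f) set \<Rightarrow> bool" where
  "greatest_stable G X \<longleftrightarrow> stable G X \<and> (\<forall>Y. stable G Y \<and> Y \<noteq> X \<longrightarrow> F_better G X Y)"


section \<open>Active graph and rotations\<close>

definition W_candidates ::
    "('w, 'f) market \<Rightarrow> ('w \<times> 'f) set \<Rightarrow> 'w \<Rightarrow> 'w \<times> 'f \<Rightarrow> ('w \<times> 'f) set" where
  "W_candidates G X w x =
     {e \<in> at_W w (edges G). (x, e) \<in> pref G w \<and> e \<in> choice G (snd e) (at_F (snd e) X \<union> {e})}"

definition W_admissible :: "('w, 'f) market \<Rightarrow> ('w \<times> 'f) set \<Rightarrow> 'w \<times> 'f \<Rightarrow> bool" where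
  "W_admissible G X a \<longleftrightarrow>
     (\<exists>w \<in> Wpart G. \<exists>x. at_W w X = {x} \<and> a \<in> W_candidates G X w x \<and>
        (\<forall>e \<in> W_candidates G X w x. e \<noteq> a \<longrightarrow> (a, e) \<in> pref G w))"

definition tandem :: "('w, 'f) market \<Rightarrow> ('w \<times> 'f) set \<Rightarrow> 'w \<times> 'f \<Rightarrow> 'w \<times> 'f \<Rightarrow> bool" where
  "tandem G X a b \<longleftrightarrow> W_admissible G X a \<and> b \<in> at_F (snd a) X \<and>
     choice G (snd a) (at_F (snd a) X \<union> {a}) = (at_F (snd a) X - {b}) \<union> {a}"

text \<open>A directed graph on the vertices is a pair \<open>(A, B)\<close>: the edges of \<open>A\<close> are directed from
  \<open>W\<close> to \<open>F\<close>, those of \<open>B\<close> from \<open>F\<close> to \<open>W\<close>. Isolated vertices are not recorded.\<close>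

definition full_digraph ::
    "('w, 'f) market \<Rightarrow> ('w \<times> 'f) set \<Rightarrow> ('w \<times> 'f) set \<times> ('w \<times> 'f) set" where
  "full_digraph G X = ({a. W_admissible G X a}, {b. \<exists>a. tandem G X a b})"

text \<open>One step of the cleaning procedure. The deleted edge \<open>a\<close> leaves the vertex \<open>fst a\<close>; a
  further tandem that contains \<open>b\<close> passes the same vertex of \<open>F\<close>, namely \<open>snd b\<close>.\<close>

inductive clean_step ::
    "('w, 'f) market \<Rightarrow> ('w \<times> 'f) set \<Rightarrow> ('w \<times> 'f) set \<times> ('w \<times> 'f) set \<Rightarrow>
     ('w \<times> 'f) set \<times> ('w \<times> 'f) set \<Rightarrow> bool"
  for G X where
  "a \<in> A \<Longrightarrow> at_W (fst a) B = {} \<Longrightarrow>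
   clean_step G X (A, B)
     (A - {a}, B - {b. tandem G X a b \<and> \<not> (\<exists>a' \<in> A - {a}. tandem G X a' b)})"

definition active_graph ::
    "('w, 'f) market \<Rightarrow> ('w \<times> 'f) set \<Rightarrow> ('w \<times> 'f) set \<times> ('w \<times> 'f) set \<Rightarrow> bool" where
  "active_graph G X \<Gamma> \<longleftrightarrow>
     (clean_step G X)\<^sup>*\<^sup>* (full_digraph G X) \<Gamma> \<and> \<not> (\<exists>\<Gamma>'. clean_step G X \<Gamma> \<Gamma>')"

text \<open>A directed cycle is given by the sequence \<open>ts\<close> of the tandems \<open>(a, b)\<close> that it traverses;
  the edge \<open>b\<close> of each tandem enters the \<open>W\<close>-vertex which the edge \<open>a\<close> of the cyclically next
  tandem leaves. It is edge-simple but may pass a vertex of \<open>F\<close> repeatedly.\<close>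

definition tandem_cycle ::
    "('w, 'f) market \<Rightarrow> ('w \<times> 'f) set \<Rightarrow> ('w \<times> 'f) set \<times> ('w \<times> 'f) set \<Rightarrow>
     (('w \<times> 'f) \<times> ('w \<times> 'f)) list \<Rightarrow> bool" where
  "tandem_cycle G X \<Gamma> ts \<longleftrightarrow> ts \<noteq> [] \<and>
     (\<forall>(a, b) \<in> set ts. a \<in> fst \<Gamma> \<and> b \<in> snd \<Gamma> \<and> tandem G X a b) \<and>
     distinct (map fst ts) \<and> distinct (map snd ts) \<and>
     (\<forall>i < length ts. fst (snd (ts ! i)) = fst (fst (ts ! (Suc i mod length ts))))"

text \<open>A rotation is the pair \<open>(L\<^sup>+, L\<^sup>-)\<close>.\<close>

type_synonym ('w, 'f) rotation = "('w \<times> 'f) set \<times> ('w \<times> 'f) set"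

definition rotations_at ::
    "('w, 'f) market \<Rightarrow> ('w \<times> 'f) set \<Rightarrow> ('w, 'f) rotation set" where
  "rotations_at G X =
     {(set (map fst ts), set (map snd ts)) | ts \<Gamma>. active_graph G X \<Gamma> \<and> tandem_cycle G X \<Gamma> ts}"

definition apply_rotation ::
    "('w, 'f) rotation \<Rightarrow> ('w \<times> 'f) set \<Rightarrow> ('w \<times> 'f) set" where
  "apply_rotation L X = (X - snd L) \<union> fst L"


section \<open>Poset of rotations\<close>

text \<open>\<open>route G X Ls Y\<close>: applying the rotations of \<open>Ls\<close> one after another leads from \<open>X\<close> to \<open>Y\<close>,
  each of them being generated by the matching to which it is applied.\<close>

fun route ::
    "('w, 'f) market \<Rightarrow> ('w \<times> 'f) set \<Rightarrow> ('w, 'f) rotation list \<Rightarrow> ('w \<times> 'f) set \<Rightarrow> bool" where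
  "route G X [] Y \<longleftrightarrow> X = Y"
| "route G X (L # Ls) Y \<longleftrightarrow> L \<in> rotations_at G X \<and> route G (apply_rotation L X) Ls Y"

definition full_route :: "('w, 'f) market \<Rightarrow> ('w, 'f) rotation list \<Rightarrow> bool" where
  "full_route G Ls \<longleftrightarrow> (\<exists>X Y. least_stable G X \<and> greatest_stable G Y \<and> route G X Ls Y)"

definition rotations :: "('w, 'f) market \<Rightarrow> ('w, 'f) rotation set" where
  "rotations G = {R. \<exists>Ls. full_route G Ls \<and> R \<in> set Ls}"

definition rot_less ::
    "('w, 'f) market \<Rightarrow> ('w, 'f) rotation \<Rightarrow> ('w, 'f) rotation \<Rightarrow> bool" where
  "rot_less G R R' \<longleftrightarrow> R \<in> rotations G \<and> R' \<in> rotations G \<and>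
     (\<forall>Ls. full_route G Ls \<longrightarrow> (\<exists>i j. i < j \<and> j < length Ls \<and> Ls ! i = R \<and> Ls ! j = R'))"

definition rot_covers ::
    "('w, 'f) market \<Rightarrow> ('w, 'f) rotation \<Rightarrow> ('w, 'f) rotation \<Rightarrow> bool" where
  "rot_covers G R R' \<longleftrightarrow> rot_less G R R' \<and> \<not> (\<exists>Q. rot_less G R Q \<and> rot_less G Q R')"


section \<open>Random access machine with choice oracles\<close>

text \<open>Programs over natural-number registers and arrays, with unit cost per instruction and per
  test. An expression contributes no cost of its own, since its size is fixed by the program.
  The only arithmetic is successor, predecessor and comparison; hence every number that occurs
  exceeds the input numbers by at most the order of the running time, so that unit cost is
  realistic (words of logarithmic length). Array cells are accessed in unit time.\<close>

datatype exp =
    Num nat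
  | Reg string
  | Cell string exp
  | Inc exp
  | Dec exp

datatype test =
    Equal exp exp
  | Less exp exp
  | Neg test
  | Conj test test

datatype com =
    Nop
  | Assign string exp
  | Store string exp exp
  | Ask exp string string
  | Seq com com
  | Cond test com com
  | Loop test com

record store =
  reg :: "string \<Rightarrow> nat"
  arr :: "string \<Rightarrow> nat \<Rightarrow> nat"

fun exp_val :: "exp \<Rightarrow> store \<Rightarrow> nat" where
  "exp_val (Num n) s = n"
| "exp_val (Reg x) s = reg s x"
| "exp_val (Cell x a) s = arr s x (exp_val a s)"
| "exp_val (Inc a) s = exp_val a s + 1"
| "exp_val (Dec a) s = exp_val a s - 1"

fun test_val :: "test \<Rightarrow> store \<Rightarrow> bool" where
  "test_val (Equal a b) s \<longleftrightarrow> exp_val a s = exp_val b s"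
| "test_val (Less a b) s \<longleftrightarrow> exp_val a s < exp_val b s"
| "test_val (Neg c) s \<longleftrightarrow> \<not> test_val c s"
| "test_val (Conj c d) s \<longleftrightarrow> test_val c s \<and> test_val d s"

definition set_reg :: "string \<Rightarrow> nat \<Rightarrow> store \<Rightarrow> store" where
  "set_reg x n s = s\<lparr>reg := (reg s)(x := n)\<rparr>"

definition set_arr :: "string \<Rightarrow> (nat \<Rightarrow> nat) \<Rightarrow> store \<Rightarrow> store" where
  "set_arr x h s = s\<lparr>arr := (arr s)(x := h)\<rparr>"

text \<open>\<open>D f\<close> is the set of (numbers of) edges at the vertex \<open>f\<close>, and \<open>Q f\<close> its choice function. The query
  is the set of those members of \<open>D f\<close> whose cells in the array \<open>x\<close> are nonzero; the
  answer is written to the array \<open>y\<close> as 0/1 flags in the cells of \<open>D f\<close>.\<close>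

definition ask ::
    "(nat \<Rightarrow> nat set) \<Rightarrow> (nat \<Rightarrow> nat set \<Rightarrow> nat set) \<Rightarrow> nat \<Rightarrow> string \<Rightarrow> string \<Rightarrow> store \<Rightarrow> store" where
  "ask D Q f x y s =
     set_arr y (\<lambda>k. if k \<in> D f
                      then (if k \<in> Q f {i \<in> D f. arr s x i \<noteq> 0} then 1 else 0)
                      else arr s y k) s"

text \<open>\<open>exec D Q c s t s'\<close>: started in \<open>s\<close>, the program \<open>c\<close> terminates in \<open>s'\<close> after exactly \<open>t\<close>
  instructions and tests; a call of the choice function is one instruction.\<close>

inductive exec ::
    "(nat \<Rightarrow> nat set) \<Rightarrow> (nat \<Rightarrow> nat set \<Rightarrow> nat set) \<Rightarrow> com \<Rightarrow> store \<Rightarrow> nat \<Rightarrow> store \<Rightarrow> bool"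
  for D Q where
  Nop: "exec D Q Nop s 1 s"
| Assign: "exec D Q (Assign x a) s 1 (set_reg x (exp_val a s) s)"
| Store: "exec D Q (Store x a b) s 1
            (set_arr x ((arr s x)(exp_val a s := exp_val b s)) s)"
| Ask: "exec D Q (Ask a x y) s 1 (ask D Q (exp_val a s) x y s)"
| Seq: "exec D Q c s t s' \<Longrightarrow> exec D Q d s' u s'' \<Longrightarrow> exec D Q (Seq c d) s (t + u) s''"
| CondTrue: "test_val b s \<Longrightarrow> exec D Q c s t s' \<Longrightarrow> exec D Q (Cond b c d) s (t + 1) s'"
| CondFalse: "\<not> test_val b s \<Longrightarrow> exec D Q d s t s' \<Longrightarrow> exec D Q (Cond b c d) s (t + 1) s'"
| LoopFalse: "\<not> test_val b s \<Longrightarrow> exec D Q (Loop b c) s 1 s"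
| LoopTrue: "test_val b s \<Longrightarrow> exec D Q c s t s' \<Longrightarrow> exec D Q (Loop b c) s' u s'' \<Longrightarrow>
             exec D Q (Loop b c) s (t + u + 1) s''"

lemma exec_deterministic:
  assumes "exec D Q c s t s'" and "exec D Q c s u s''"
  shows "t = u \<and> s' = s''"
  using assms
proof (induction arbitrary: u s'' rule: exec.induct)
  case (Seq c s t s' d v s0)
  from Seq.prems show ?case by cases (use Seq.IH in blast)
next
  case (LoopTrue b s c t s' v s0)
  from LoopTrue.prems show ?case by cases (use LoopTrue.hyps LoopTrue.IH in blast)+
qed (erule exec.cases; auto)+


section \<open>Encoding of the input and the output\<close>

text \<open>The vertices of either part are numbered consecutively from 0, and the edges are
  numbered by their positions in a list \<open>es\<close>.\<close>

definition numbering :: "(nat, nat) market \<Rightarrow> (nat \<times> nat) list \<Rightarrow> bool" where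
  "numbering G es \<longleftrightarrow> (\<exists>n. Wpart G = {..<n}) \<and> (\<exists>n. Fpart G = {..<n}) \<and>
     distinct es \<and> set es = edges G"

definition edge_numbers :: "(nat \<times> nat) list \<Rightarrow> nat \<Rightarrow> nat set" where
  "edge_numbers es f = {i. i < length es \<and> snd (es ! i) = f}"

definition choice_oracle ::
    "(nat, nat) market \<Rightarrow> (nat \<times> nat) list \<Rightarrow> nat \<Rightarrow> nat set \<Rightarrow> nat set" where
  "choice_oracle G es f I = {i. i < length es \<and> es ! i \<in> choice G f ((\<lambda>k. es ! k) ` I)}"

text \<open>The linear order \<open>>\<^sub>w\<close> is given by ranks: the array \<open>rank\<close> holds at the number of an edge
  \<open>e\<close> at \<open>w\<close> the number of edges at \<open>w\<close> preferred to \<open>e\<close>. All other memory is 0.\<close>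

definition input_store :: "(nat, nat) market \<Rightarrow> (nat \<times> nat) list \<Rightarrow> store" where
  "input_store G es =
     \<lparr>reg = (\<lambda>x. 0)(''nW'' := card (Wpart G), ''nF'' := card (Fpart G), ''nE'' := length es),
      arr = (\<lambda>x i. 0)
        (''endW'' := (\<lambda>i. if i < length es then fst (es ! i) else 0),
         ''endF'' := (\<lambda>i. if i < length es then snd (es ! i) else 0),
         ''rank'' := (\<lambda>i. if i < length es
                            then card {e \<in> edges G. (e, es ! i) \<in> pref G (fst (es ! i))} else 0))\<rparr>"

text \<open>The output is a list of \<open>nR\<close> rotations and a list of \<open>nH\<close> pairs of list positions. The set
  \<open>L\<^sup>+\<close> of the \<open>j\<close>-th rotation is listed in the array \<open>plus\<close> from position \<open>plusStart[j]\<close> to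
  position \<open>plusStart[j+1] - 1\<close>; likewise for \<open>L\<^sup>-\<close>.\<close>

definition block :: "store \<Rightarrow> string \<Rightarrow> string \<Rightarrow> nat \<Rightarrow> nat set" where
  "block s x start j = arr s x ` {arr s start j ..< arr s start (Suc j)}"

definition output_rotation ::
    "(nat \<times> nat) list \<Rightarrow> store \<Rightarrow> nat \<Rightarrow> (nat, nat) rotation" where
  "output_rotation es s j =
     ((\<lambda>i. es ! i) ` block s ''plus'' ''plusStart'' j,
      (\<lambda>i. es ! i) ` block s ''minus'' ''minusStart'' j)"

definition output_arcs :: "store \<Rightarrow> (nat \<times> nat) set" where
  "output_arcs s = {(arr s ''tail'' k, arr s ''head'' k) | k. k < reg s ''nH''}"

text \<open>The output is correct if it lists every rotation exactly once, and its digraph is the Hasse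
  diagram and determines the partial order as its transitive closure.\<close>

definition outputs_rotation_poset ::
    "(nat, nat) market \<Rightarrow> (nat \<times> nat) list \<Rightarrow> store \<Rightarrow> bool" where
  "outputs_rotation_poset G es s \<longleftrightarrow>
     (\<forall>j < reg s ''nR''. block s ''plus'' ''plusStart'' j \<subseteq> {..<length es} \<and>
                          block s ''minus'' ''minusStart'' j \<subseteq> {..<length es}) \<and>
     bij_betw (output_rotation es s) {..<reg s ''nR''} (rotations G) \<and>
     output_arcs s \<subseteq> {..<reg s ''nR''} \<times> {..<reg s ''nR''} \<and>
     (\<forall>i < reg s ''nR''. \<forall>j < reg s ''nR''.
        ((i, j) \<in> output_arcs s \<longleftrightarrow>
           rot_covers G (output_rotation es s i) (output_rotation es s j)) \<and>
        ((i, j) \<in> (output_arcs s)\<^sup>+ \<longleftrightarrow>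
           rot_less G (output_rotation es s i) (output_rotation es s j)))"

end

theory Submission
  imports Defs
begin

text \<open>The mathematics first. Compare stable matchings by \<open>leF X Y\<close>: every firm, offered its edges in \<open>X\<close>
and in \<open>Y\<close>, keeps those in \<open>Y\<close>. Let \<open>leF X Y\<close>. An edge \<open>x \<in> X - Y\<close> always starts a tandem of \<open>X\<close>, and the
edge which this tandem displaces is again outside \<open>Y\<close> (\<open>advance\<close>); this is where cardinal
monotonicity enters. A tandem of \<open>X\<close> remains a tandem of \<open>Y\<close> if \<open>Y\<close> contains the edge of its worker
and the edge that it displaces (\<open>tandem_persists\<close>). Mapping every edge of \<open>X\<close> to the edge that its tandem
displaces is therefore a partial function on \<open>X\<close>; the cleaning procedure keeps exactly its cycles, which
are the rotations (\<open>rotations_at_iff\<close>). With respect to \<open>Y\<close>, a rotation of \<open>X\<close> is either used up, and then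
applying it leads to a stable matching that is still below \<open>Y\<close>, or it is a rotation of \<open>Y\<close>
(\<open>rotation_dichotomy\<close>).

Everything about the poset follows from the dichotomy. Different rotations of one matching commute, the
set \<open>passed Y\<close> of rotations on a route from the least stable matching to \<open>Y\<close> does not depend on the route,
and it determines the position of \<open>Y\<close> in the order. If a rotation is available at two stable matchings, it is
available at a common lower bound (\<open>rotation_common_lower\<close>); so there is a least stable matching where it is
available, and the rotations passed there are exactly its predecessors. Consequently a rotation is
available at \<open>Y\<close> if and only if it has not been passed, but all its predecessors have
(\<open>rotation_available_iff\<close>).

The algorithm finds the least stable matching by proposals of the workers. To find the rotations along
a full route it follows tandems, keeping the path in a stack. When the path closes a cycle, the cycle is
emitted and applied; the rest of the path stays valid by persistence of tandems (\<open>search_cycle\<close>), so that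
the search goes on from there. A potential (\<open>progress\<close>) bounds the number of steps by \<open>O(|E|)\<close>, and each
step takes time \<open>O(|E|)\<close>.

For the Hasse diagram, each rotation \<open>R\<close> is treated as follows: go through the list of rotations once more,
leaving out \<open>R\<close> and applying whatever is available. What remains are \<open>R\<close> and its successors
(\<open>skip_step\<close>); after applying \<open>R\<close>, exactly the covers of \<open>R\<close> are available (\<open>available_iff_covers\<close>). Whether
a listed rotation is available can be decided by looking, for each of its workers, at the edges
between the old and the new one (\<open>available_iff_passes\<close>). These segments of the preference lists are disjoint
for different rotations, so that one pass takes time \<open>O(|E|)\<close> (\<open>total_gap\<close>), and there are at most \<open>|E|\<close> rotations.\<close>

section \<open>Choice functions\<close>

(* Edges are pairs, but they are always treated as atoms here. *)
declare split_paired_All [simp del] split_paired_Ex [simp del]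

locale stable_market =
  fixes G :: "('w, 'f) market"
  assumes market: "market G"
begin

abbreviation "E \<equiv> edges G"
abbreviation "C \<equiv> choice G"

definition better :: "'w \<times> 'f \<Rightarrow> 'w \<times> 'f \<Rightarrow> bool" (infix "\<succ>" 50) where
  "e \<succ> e' \<longleftrightarrow> e \<in> E \<and> e' \<in> E \<and> fst e = fst e' \<and> (e, e') \<in> pref G (fst e)"

text \<open>The firm of \<open>e\<close> wants \<open>e\<close> at the matching \<open>X\<close> if \<open>e \<in> grow X e\<close>.\<close>

abbreviation grow :: "('w \<times> 'f) set \<Rightarrow> 'w \<times> 'f \<Rightarrow> ('w \<times> 'f) set" where
  "grow X e \<equiv> C (snd e) (insert e (at_F (snd e) X))"

text \<open>On stable matchings, the reflexive form of \<^const>\<open>F_better\<close>, with the better matching on the right.\<close>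

definition leF :: "('w \<times> 'f) set \<Rightarrow> ('w \<times> 'f) set \<Rightarrow> bool" where
  "leF X Y \<longleftrightarrow> (\<forall>f \<in> Fpart G. C f (at_F f X \<union> at_F f Y) = at_F f Y)"

lemma finite_E: "finite E"
  using market unfolding market_def by (meson finite_SigmaI finite_subset)

lemma fst_in_W: "e \<in> E \<Longrightarrow> fst e \<in> Wpart G" and snd_in_F: "e \<in> E \<Longrightarrow> snd e \<in> Fpart G"
  using market unfolding market_def by auto

lemma pref_strict: "w \<in> Wpart G \<Longrightarrow> strict_linear_order_on (at_W w E) (pref G w)"
  using market unfolding market_def by auto

lemma better_trans: "a \<succ> b \<Longrightarrow> b \<succ> c \<Longrightarrow> a \<succ> c"
  unfolding better_def using pref_strict[OF fst_in_W]
  by (metis strict_linear_order_on_def transE)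

lemma better_irrefl: "\<not> a \<succ> a"
  unfolding better_def using pref_strict[OF fst_in_W]
  by (metis strict_linear_order_on_def irrefl_def)

lemma better_asym: "a \<succ> b \<Longrightarrow> \<not> b \<succ> a"
  using better_trans better_irrefl by blast

lemma better_total:
  assumes "a \<in> E" "b \<in> E" "fst a = fst b" "a \<noteq> b"
  shows "a \<succ> b \<or> b \<succ> a"
proof -
  have "total_on (at_W (fst a) E) (pref G (fst a))"
    using pref_strict[OF fst_in_W[OF assms(1)]] by (simp add: strict_linear_order_on_def)
  moreover have "a \<in> at_W (fst a) E" "b \<in> at_W (fst a) E" using assms by (auto simp: at_W_def)
  ultimately show ?thesis using assms unfolding better_def total_on_def by metis
qed

lemma choice_axioms_at: "f \<in> Fpart G \<Longrightarrow> choice_axioms (at_F f E) (C f)"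
  using market unfolding market_def by auto

lemma at_F_mono: "X \<subseteq> Y \<Longrightarrow> at_F f X \<subseteq> at_F f Y"
  by (auto simp: at_F_def)

lemma at_F_insert: "at_F f (insert e X) = (if snd e = f then insert e (at_F f X) else at_F f X)"
  by (auto simp: at_F_def)

lemma in_at_F [simp]: "e \<in> at_F f X \<longleftrightarrow> e \<in> X \<and> snd e = f"
  by (auto simp: at_F_def)

lemma finite_at_F: "X \<subseteq> E \<Longrightarrow> finite (at_F f X)"
  using finite_E by (metis at_F_def finite_Collect_conjI finite_subset Collect_mem_eq)

lemma insert_at_F_sub: "X \<subseteq> E \<Longrightarrow> e \<in> E \<Longrightarrow> insert e (at_F (snd e) X) \<subseteq> at_F (snd e) E"
  by auto

lemma choice_sub: "f \<in> Fpart G \<Longrightarrow> Z \<subseteq> at_F f E \<Longrightarrow> C f Z \<subseteq> Z"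
  using choice_axioms_at[of f] unfolding choice_axioms_def by simp

lemma choice_consistent:
  "f \<in> Fpart G \<Longrightarrow> Z \<subseteq> at_F f E \<Longrightarrow> Z' \<subseteq> Z \<Longrightarrow> C f Z \<subseteq> Z' \<Longrightarrow> C f Z' = C f Z"
  using choice_axioms_at[of f] unfolding choice_axioms_def by simp

lemma choice_substitutable:
  assumes "f \<in> Fpart G" "Z \<subseteq> at_F f E" "Z' \<subseteq> Z" "e \<in> C f Z" "e \<in> Z'"
  shows "e \<in> C f Z'"
proof -
  have "C f Z \<inter> Z' \<subseteq> C f Z'"
    using choice_axioms_at[OF assms(1)] assms(2,3) unfolding choice_axioms_def by simp
  then show ?thesis using assms(4,5) by blast
qed

lemma choice_card_mono:
  assumes "f \<in> Fpart G" "Z \<subseteq> at_F f E" "Z' \<subseteq> Z"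
  shows "card (C f Z') \<le> card (C f Z)"
  using choice_axioms_at[OF assms(1)] assms(2,3) unfolding choice_axioms_def by simp

text \<open>Path independence is the form in which consistency and substitutability are mostly used: by
substitutability nothing outside \<open>C f Z \<union> Z'\<close> is chosen, hence consistency applies.\<close>

lemma choice_path_independent:
  assumes "f \<in> Fpart G" "Z \<subseteq> at_F f E" "Z' \<subseteq> at_F f E"
  shows "C f (Z \<union> Z') = C f (C f Z \<union> Z')"
proof -
  have U: "Z \<union> Z' \<subseteq> at_F f E" using assms by auto
  have "C f (Z \<union> Z') \<subseteq> C f Z \<union> Z'"
    using choice_sub[OF assms(1) U] choice_substitutable[OF assms(1) U, of Z] by blast
  moreover have "C f Z \<union> Z' \<subseteq> Z \<union> Z'" using choice_sub assms by blast
  ultimately show ?thesis using choice_consistent[OF assms(1) U] by metis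
qed

lemma choice_idem: "f \<in> Fpart G \<Longrightarrow> Z \<subseteq> at_F f E \<Longrightarrow> C f (C f Z) = C f Z"
  using choice_consistent[of f Z "C f Z"] choice_sub[of f Z] by simp

text \<open>By substitutability, a firm which refuses each of several edges also refuses all of them together.\<close>

lemma choice_refuse_all:
  assumes "f \<in> Fpart G" "Z \<subseteq> at_F f E" "A \<subseteq> at_F f E" "C f Z = Z"
    and "\<And>a. a \<in> A \<Longrightarrow> a \<notin> Z \<Longrightarrow> a \<notin> C f (insert a Z)"
  shows "C f (Z \<union> A) = Z"
proof -
  have U: "Z \<union> A \<subseteq> at_F f E" using assms by auto
  have "C f (Z \<union> A) \<subseteq> Z"
  proof
    fix e assume e: "e \<in> C f (Z \<union> A)"
    then have "e \<in> Z \<union> A" using choice_sub[OF assms(1) U] by auto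
    moreover have "e \<in> C f (insert e Z)" if "e \<in> A"
      using choice_substitutable[OF assms(1) U, of "insert e Z" e] e that by auto
    ultimately show "e \<in> Z" using assms(5) by (metis UnE)
  qed
  then show ?thesis using choice_consistent[OF assms(1) U, of Z] assms(4) by auto
qed


section \<open>Stable matchings\<close>

text \<open>The choice of a worker selects its best edge, so it fixes exactly the sets with at most one edge. From
here on the choice functions of the workers are no longer visible.\<close>

lemma acceptable_iff:
  "acceptable G X \<longleftrightarrow> X \<subseteq> E \<and> inj_on fst X \<and> (\<forall>f \<in> Fpart G. C f (at_F f X) = at_F f X)"
proof (cases "X \<subseteq> E")
  case True
  have "(\<forall>w \<in> Wpart G. W_choice G w (at_W w X) = at_W w X) \<longleftrightarrow> inj_on fst X"
  proof
    assume L: "\<forall>w \<in> Wpart G. W_choice G w (at_W w X) = at_W w X"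
    show "inj_on fst X"
    proof (rule inj_onI, rule ccontr)
      fix x y assume xy: "x \<in> X" "y \<in> X" "fst x = fst y" "x \<noteq> y"
      then have "fst x \<in> Wpart G" using True fst_in_W by (metis subsetD)
      then have "W_choice G (fst x) (at_W (fst x) X) = at_W (fst x) X" using L by auto
      moreover have "x \<in> at_W (fst x) X" "y \<in> at_W (fst x) X" using xy by (auto simp: at_W_def)
      ultimately have "(x, y) \<in> pref G (fst x)" "(y, x) \<in> pref G (fst x)"
        using xy(4) unfolding W_choice_def by auto
      then have "x \<succ> y" "y \<succ> x" using xy True unfolding better_def by auto
      then show False using better_asym by blast
    qed
  next
    assume "inj_on fst X"
    then have "\<And>w e e'. e \<in> at_W w X \<Longrightarrow> e' \<in> at_W w X \<Longrightarrow> e = e'"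
      by (auto simp: at_W_def dest: inj_onD)
    then show "\<forall>w \<in> Wpart G. W_choice G w (at_W w X) = at_W w X"
      unfolding W_choice_def by blast
  qed
  then show ?thesis unfolding acceptable_def by auto
qed (auto simp: acceptable_def)

lemma stable_iff:
  "stable G X \<longleftrightarrow> X \<subseteq> E \<and> inj_on fst X \<and> (\<forall>f \<in> Fpart G. C f (at_F f X) = at_F f X) \<and>
     (\<forall>e \<in> E. e \<notin> X \<longrightarrow> e \<in> grow X e \<longrightarrow> (\<exists>x \<in> X. x \<succ> e))"
proof (cases "acceptable G X")
  case True
  then have X: "X \<subseteq> E" "inj_on fst X" by (auto simp: acceptable_iff)
  have "e \<in> W_choice G (fst e) (at_W (fst e) X \<union> {e}) \<longleftrightarrow> \<not> (\<exists>x \<in> X. x \<succ> e)"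
    if e: "e \<in> E" "e \<notin> X" for e
  proof -
    have "e \<in> W_choice G (fst e) (at_W (fst e) X \<union> {e}) \<longleftrightarrow>
          (\<forall>x \<in> X. fst x = fst e \<longrightarrow> e \<succ> x)"
      using e X unfolding W_choice_def at_W_def better_def by auto
    also have "\<dots> \<longleftrightarrow> \<not> (\<exists>x \<in> X. x \<succ> e)"
      using better_total better_asym e X by (metis better_def subsetD)
    finally show ?thesis .
  qed
  then have "(\<exists>w f. (w, f) \<in> edges G - X \<and>
              (w, f) \<in> W_choice G w (at_W w X \<union> {(w, f)}) \<and>
              (w, f) \<in> choice G f (at_F f X \<union> {(w, f)})) \<longleftrightarrow>
             (\<exists>e \<in> E. e \<notin> X \<and> e \<in> grow X e \<and> \<not> (\<exists>x \<in> X. x \<succ> e))"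
    by (auto simp del: in_at_F) force
  then show ?thesis using True unfolding stable_def acceptable_iff by blast
qed (auto simp: acceptable_iff stable_def)

lemma stableD:
  assumes "stable G X"
  shows "X \<subseteq> E" "inj_on fst X" "f \<in> Fpart G \<Longrightarrow> C f (at_F f X) = at_F f X"
    "e \<in> E \<Longrightarrow> e \<notin> X \<Longrightarrow> e \<in> grow X e \<Longrightarrow> \<exists>x \<in> X. x \<succ> e"
    "finite X"
  using assms finite_E finite_subset unfolding stable_iff by auto

lemma stable_unique: "stable G X \<Longrightarrow> x \<in> X \<Longrightarrow> y \<in> X \<Longrightarrow> fst x = fst y \<Longrightarrow> x = y"
  using stableD(2) inj_onD by metis


section \<open>The order of the firms\<close>

lemma leF_refl: "stable G X \<Longrightarrow> leF X X"
  by (simp add: leF_def stableD)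

lemma leF_trans:
  assumes "X \<subseteq> E" "Y \<subseteq> E" "Z \<subseteq> E" "leF X Y" "leF Y Z"
  shows "leF X Z"
  unfolding leF_def
proof
  fix f assume f: "f \<in> Fpart G"
  note at = at_F_mono[OF assms(1), of f] at_F_mono[OF assms(2), of f] at_F_mono[OF assms(3), of f]
  have XY: "C f (at_F f X \<union> at_F f Y) = at_F f Y" and YZ: "C f (at_F f Y \<union> at_F f Z) = at_F f Z"
    using assms f by (auto simp: leF_def)
  have "C f (at_F f X \<union> at_F f Z) = C f (C f (at_F f Y \<union> at_F f Z) \<union> at_F f X)"
    using YZ by (simp add: Un_commute)
  also have "\<dots> = C f ((at_F f X \<union> at_F f Y) \<union> at_F f Z)"
    using choice_path_independent[OF f, of "at_F f Y \<union> at_F f Z" "at_F f X"] at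
    by (simp add: Un_ac)
  also have "\<dots> = C f (C f (at_F f X \<union> at_F f Y) \<union> at_F f Z)"
    using choice_path_independent[OF f, of "at_F f X \<union> at_F f Y" "at_F f Z"] at by simp
  also have "\<dots> = at_F f Z" using XY YZ by simp
  finally show "C f (at_F f X \<union> at_F f Z) = at_F f Z" .
qed

lemma leF_antisym:
  assumes "X \<subseteq> E" "Y \<subseteq> E" "leF X Y" "leF Y X"
  shows "X = Y"
proof -
  have "at_F f X = at_F f Y" if "f \<in> Fpart G" for f
    using assms that unfolding leF_def by (metis Un_commute)
  then have "e \<in> X \<longleftrightarrow> e \<in> Y" if "e \<in> E" for e
    using snd_in_F[OF that] in_at_F by metis
  then show ?thesis using assms by blast
qed

lemma F_better_iff:
  assumes "stable G X" "stable G Y"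
  shows "F_better G Y X \<longleftrightarrow> X \<noteq> Y \<and> leF X Y"
  using assms unfolding F_better_def leF_def stable_def by (auto simp: Un_commute)

text \<open>The better off a firm is, the fewer additional edges it wants.\<close>

lemma grow_antimono:
  assumes "X \<subseteq> E" "Y \<subseteq> E" "leF X Y" "e \<in> E" "e \<in> grow Y e"
  shows "e \<in> grow X e"
proof -
  let ?f = "snd e"
  have f: "?f \<in> Fpart G" using snd_in_F assms by auto
  note at = at_F_mono[OF assms(1), of ?f] at_F_mono[OF assms(2), of ?f]
  have "C ?f ((at_F ?f X \<union> at_F ?f Y) \<union> {e}) = C ?f (C ?f (at_F ?f X \<union> at_F ?f Y) \<union> {e})"
    by (rule choice_path_independent[OF f]) (use at assms in auto)
  also have "\<dots> = grow Y e" using assms(3) f by (simp add: leF_def)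
  finally have "e \<in> C ?f ((at_F ?f X \<union> at_F ?f Y) \<union> {e})" using assms(5) by simp
  then show ?thesis
    by (rule choice_substitutable[OF f, rotated 2]) (use at assms in auto)
qed

text \<open>The two sides have opposite interests: an edge \<open>y\<close> which a firm takes from \<open>Y\<close> is wanted by this firm
at \<open>X\<close>, so that the stability of \<open>X\<close> must be due to the worker of \<open>y\<close>.\<close>

lemma leF_opposite:
  assumes "stable G X" "stable G Y" "leF X Y" "y \<in> Y" "y \<notin> X"
  shows "\<exists>x \<in> X. x \<succ> y"
proof -
  let ?f = "snd y"
  have y: "y \<in> E" "?f \<in> Fpart G" using stableD(1) assms snd_in_F by blast+
  have "y \<in> C ?f (at_F ?f X \<union> at_F ?f Y)" using assms y by (simp add: leF_def)
  then have "y \<in> grow X y"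
    by (rule choice_substitutable[OF y(2), rotated 2])
      (use assms y stableD(1)[OF assms(1)] stableD(1)[OF assms(2)] in auto)
  then show ?thesis using stableD(4)[OF assms(1)] y assms by auto
qed

lemma sum_card_at_F: "X \<subseteq> E \<Longrightarrow> (\<Sum>f \<in> Fpart G. card (at_F f X)) = card X"
proof -
  assume X: "X \<subseteq> E"
  have fin: "finite (Fpart G)" using market by (simp add: market_def)
  have "X = (\<Union>f \<in> Fpart G. at_F f X)" using X snd_in_F by auto
  then have "card X = card (\<Union>f \<in> Fpart G. at_F f X)" by simp
  also have "\<dots> = (\<Sum>f \<in> Fpart G. card (at_F f X))"
    by (rule card_UN_disjoint) (use fin finite_at_F[OF X] in auto)
  finally show ?thesis by simp
qed

text \<open>By opposite interests every worker matched by \<open>Y\<close> is matched by \<open>X\<close>, hence \<open>card Y \<le> card X\<close>. Cardinal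
monotonicity gives the reverse inequality firm by firm, so that equality holds everywhere.\<close>

lemma leF_rural:
  assumes "stable G X" "stable G Y" "leF X Y"
  shows "fst ` X = fst ` Y" and "f \<in> Fpart G \<Longrightarrow> card (at_F f X) = card (at_F f Y)"
proof -
  have fin: "finite (Fpart G)" using market by (simp add: market_def)
  have sub: "fst ` Y \<subseteq> fst ` X"
  proof
    fix w assume "w \<in> fst ` Y"
    then obtain y where y: "y \<in> Y" "w = fst y" by auto
    have "y \<in> X \<or> (\<exists>x \<in> X. x \<succ> y)" using leF_opposite[OF assms y(1)] by blast
    then show "w \<in> fst ` X" using y(2) unfolding better_def by (metis image_eqI)
  qed
  have X: "X \<subseteq> E" and Y: "Y \<subseteq> E" and finX: "finite X" using stableD assms by auto
  have le: "card (at_F f X) \<le> card (at_F f Y)" if f: "f \<in> Fpart G" for f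
  proof -
    have "card (C f (at_F f X)) \<le> card (C f (at_F f X \<union> at_F f Y))"
      by (rule choice_card_mono[OF f]) (use X Y in auto)
    then show ?thesis using assms f stableD(3)[OF assms(1) f] by (simp add: leF_def)
  qed
  have img: "card X = card (fst ` X)" "card Y = card (fst ` Y)"
    using stableD(2) assms by (simp_all add: card_image)
  then have "card Y \<le> card X" using card_mono[OF _ sub] finX by simp
  moreover have "card X \<le> card Y"
    using sum_mono[of "Fpart G" "\<lambda>f. card (at_F f X)" "\<lambda>f. card (at_F f Y)", OF le] sum_card_at_F X Y by simp
  ultimately have eq: "card X = card Y" by simp
  then have "fst ` Y = fst ` X"
    using card_subset_eq[OF finite_imageI[OF finX] sub] img(1) img(2) eq by metis
  then show "fst ` X = fst ` Y" by simp
  show "card (at_F f X) = card (at_F f Y)" if "f \<in> Fpart G"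
    using sum_mono_inv[of "\<lambda>f. card (at_F f X)" "Fpart G" "\<lambda>f. card (at_F f Y)", OF _ le that fin]
      sum_card_at_F X Y eq by simp
qed


section \<open>Tandems\<close>

lemma W_admissible_iff:
  assumes "stable G X"
  shows "W_admissible G X a \<longleftrightarrow>
    (\<exists>x \<in> X. x \<succ> a \<and> a \<in> grow X a \<and> (\<forall>e. x \<succ> e \<longrightarrow> e \<in> grow X e \<longrightarrow> e \<noteq> a \<longrightarrow> a \<succ> e))"
proof -
  have cand: "e \<in> W_candidates G X w x \<longleftrightarrow> x \<succ> e \<and> e \<in> grow X e"
    if "at_W w X = {x}" for w x e
  proof -
    have "x \<in> X" "fst x = w" using that by (auto simp: at_W_def set_eq_iff)
    then show ?thesis using stableD(1)[OF assms]
      unfolding W_candidates_def better_def by (auto simp: at_W_def)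
  qed
  have atW: "at_W (fst x) X = {x}" if "x \<in> X" for x
  proof (rule set_eqI)
    fix y show "y \<in> at_W (fst x) X \<longleftrightarrow> y \<in> {x}"
      using that stable_unique[OF assms, of x y] by (auto simp: at_W_def simp del: split_paired_All)
  qed
  have atW': "x \<in> X \<and> fst x = w" if "at_W w X = {x}" for w x
    using that unfolding at_W_def by blast
  show ?thesis (is "?L \<longleftrightarrow> ?R")
  proof
    assume ?L
    then obtain w x where wx: "at_W w X = {x}" "a \<in> W_candidates G X w x"
      "\<forall>e \<in> W_candidates G X w x. e \<noteq> a \<longrightarrow> (a, e) \<in> pref G w" unfolding W_admissible_def by auto
    have "a \<succ> e" if "x \<succ> e" "e \<in> grow X e" "e \<noteq> a" for e
    proof -
      have "(a, e) \<in> pref G w" using wx(3) that cand[OF wx(1)] by auto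
      moreover have "x \<succ> a" using wx(2) cand[OF wx(1)] by auto
      ultimately show ?thesis using that atW'[OF wx(1)] unfolding better_def by auto
    qed
    then show ?R using wx(2) cand[OF wx(1)] atW'[OF wx(1)] by blast
  next
    assume ?R
    then obtain x where x: "x \<in> X" "x \<succ> a" "a \<in> grow X a"
      "\<forall>e. x \<succ> e \<longrightarrow> e \<in> grow X e \<longrightarrow> e \<noteq> a \<longrightarrow> a \<succ> e" by auto
    show ?L unfolding W_admissible_def
    proof (intro bexI exI conjI ballI impI)
      show "fst x \<in> Wpart G" using x stableD(1)[OF assms] fst_in_W by (metis subsetD)
      show "at_W (fst x) X = {x}" using atW x by auto
      show "a \<in> W_candidates G X (fst x) x" using x cand[OF atW[OF x(1)]] by auto
      fix e assume "e \<in> W_candidates G X (fst x) x" "e \<noteq> a"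
      then show "(a, e) \<in> pref G (fst x)"
        using x cand[OF atW[OF x(1)]] unfolding better_def by metis
    qed
  qed
qed

lemma tandemD:
  assumes "stable G X" "tandem G X a b"
  shows "W_admissible G X a" "a \<in> E" "a \<notin> X" "b \<in> X" "snd b = snd a" "b \<noteq> a"
    "grow X a = insert a (at_F (snd a) X - {b})" "\<exists>x \<in> X. x \<succ> a"
proof -
  show W: "W_admissible G X a" and b: "b \<in> X" "snd b = snd a"
    and g: "grow X a = insert a (at_F (snd a) X - {b})"
    using assms(2) by (auto simp: tandem_def)
  then show x: "\<exists>x \<in> X. x \<succ> a" and a: "a \<in> E"
    using W_admissible_iff[OF assms(1)] by (auto simp: better_def)
  then show "a \<notin> X" using stable_unique[OF assms(1)] better_irrefl by (metis better_def)
  then show "b \<noteq> a" using b by auto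
qed

lemma W_admissible_unique:
  assumes "stable G X" "W_admissible G X a" "W_admissible G X a'" "fst a = fst a'"
  shows "a = a'"
proof (rule ccontr)
  assume ne: "a \<noteq> a'"
  obtain x where x: "x \<in> X" "x \<succ> a" "a \<in> grow X a"
      "\<forall>e. x \<succ> e \<longrightarrow> e \<in> grow X e \<longrightarrow> e \<noteq> a \<longrightarrow> a \<succ> e"
    using assms(2) W_admissible_iff[OF assms(1)] by blast
  obtain x' where x': "x' \<in> X" "x' \<succ> a'" "a' \<in> grow X a'"
      "\<forall>e. x' \<succ> e \<longrightarrow> e \<in> grow X e \<longrightarrow> e \<noteq> a' \<longrightarrow> a' \<succ> e"
    using assms(3) W_admissible_iff[OF assms(1)] by blast
  have "x = x'" using stable_unique[OF assms(1) x(1) x'(1)] x(2) x'(2) assms(4)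
    unfolding better_def by simp
  then show False using x x' ne better_asym by metis
qed

lemma tandem_unique:
  assumes "stable G X" "tandem G X a b" "tandem G X a' b'" "fst a = fst a'"
  shows "a = a' \<and> b = b'"
proof -
  have "a = a'" using W_admissible_unique assms tandemD(1) by metis
  moreover have "b = b'" if "a = a'"
  proof -
    let ?S = "at_F (snd a) X"
    have "tandem G X a b'" using assms(3) unfolding that .
    then have "insert a (?S - {b}) = insert a (?S - {b'})"
      using tandemD(7)[OF assms(1,2)] tandemD(7)[OF assms(1)] by blast
    moreover have "b' \<in> ?S" "b' \<noteq> a"
      using tandemD(4-6)[OF assms(1,3)] that by simp_all
    ultimately show ?thesis by (metis Diff_iff insert_iff empty_iff)
  qed
  ultimately show ?thesis by blast
qed

text \<open>By cardinal monotonicity the choice does not get smaller when \<open>a\<close> is offered in addition; hence at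
most one edge can make room for \<open>a\<close>.\<close>

lemma grow_displaces:
  assumes "stable G X" "a \<in> E" "a \<notin> X" "a \<in> grow X a" "b \<in> X" "snd b = snd a" "b \<notin> grow X a"
  shows "grow X a = insert a (at_F (snd a) X - {b})"
proof -
  let ?f = "snd a"
  have f: "?f \<in> Fpart G" using assms snd_in_F by auto
  have X: "X \<subseteq> E" using assms stableD by auto
  have sub: "insert a (at_F ?f X) \<subseteq> at_F ?f E" using X assms by auto
  have fin: "finite (at_F ?f X)" using X finite_at_F by auto
  have "card (C ?f (at_F ?f X)) \<le> card (grow X a)"
    by (rule choice_card_mono[OF f sub]) auto
  then have c: "card (at_F ?f X) \<le> card (grow X a)" using stableD(3)[OF assms(1) f] by simp
  have s: "grow X a \<subseteq> insert a (at_F ?f X - {b})" using choice_sub[OF f sub] assms(7) by auto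
  have "card (insert a (at_F ?f X - {b})) = Suc (card (at_F ?f X - {b}))"
    using fin assms(3) by auto
  also have "\<dots> = card (at_F ?f X)" using fin assms(5,6) by (metis card_Suc_Diff1 in_at_F)
  finally show ?thesis using c s fin by (metis card_seteq finite_Diff finite_insert)
qed

lemma tandemI:
  assumes "stable G X" "W_admissible G X a" "b \<in> X" "snd b = snd a" "b \<notin> grow X a"
  shows "tandem G X a b"
proof -
  obtain x where x: "x \<in> X" "x \<succ> a" "a \<in> grow X a" using assms W_admissible_iff by meson
  have "a \<notin> X" using stable_unique[OF assms(1)] better_irrefl x by (metis better_def)
  then have "grow X a = insert a (at_F (snd a) X - {b})"
    using grow_displaces assms x by (auto simp: better_def)
  then show ?thesis using assms by (simp add: tandem_def)
qed

lemma W_admissible_exists: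
  assumes "stable G X" "x \<in> X" "x \<succ> e" "e \<in> grow X e"
  shows "\<exists>a. W_admissible G X a \<and> fst a = fst x \<and> (a = e \<or> a \<succ> e)"
proof -
  let ?S = "{e. x \<succ> e \<and> e \<in> grow X e}"
  have fin: "finite ?S" using finite_E by (rule rev_finite_subset) (auto simp: better_def)
  have ex: "\<exists>a \<in> S. \<forall>e \<in> S. e \<noteq> a \<longrightarrow> a \<succ> e" if "finite S" "S \<noteq> {}" "S \<subseteq> {e. x \<succ> e}" for S
    using that
  proof (induction S rule: finite_ne_induct)
    case (insert s S)
    then obtain a where a: "a \<in> S" "\<forall>e \<in> S. e \<noteq> a \<longrightarrow> a \<succ> e" by auto
    have "x \<succ> a" "x \<succ> s" using insert.prems a(1) by blast+
    moreover have "a \<noteq> s" using insert.hyps a(1) by blast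
    ultimately have "a \<succ> s \<or> s \<succ> a" using better_total[of a s] unfolding better_def by metis
    then show ?case using a better_trans by (metis insert_iff)
  qed auto
  have e: "e \<in> ?S" using assms(3,4) by simp
  then have "?S \<noteq> {}" by (metis empty_iff)
  moreover have "?S \<subseteq> {e. x \<succ> e}" by (rule Collect_mono) simp
  ultimately obtain a where a: "a \<in> ?S" "\<forall>e \<in> ?S. e \<noteq> a \<longrightarrow> a \<succ> e"
    using ex[OF fin] by meson
  then have "W_admissible G X a"
    unfolding W_admissible_iff[OF assms(1)] using assms(2) by (intro bexI[of _ x]) simp_all
  moreover have "fst a = fst x" using a(1) by (simp add: better_def)
  moreover have "a = e \<or> a \<succ> e" using bspec[OF a(2) e] by blast
  ultimately show ?thesis by blast
qed

section \<open>Rotations as cyclic sequences of tandems\<close>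

text \<open>The same as \<^const>\<open>tandem_cycle\<close>, but for the graph of all tandems instead of a cleaned graph.\<close>

definition tandem_circuit :: "('w \<times> 'f) set \<Rightarrow> (('w \<times> 'f) \<times> ('w \<times> 'f)) list \<Rightarrow> bool" where
  "tandem_circuit X ts \<longleftrightarrow> ts \<noteq> [] \<and> (\<forall>t \<in> set ts. tandem G X (fst t) (snd t)) \<and>
     distinct (map fst ts) \<and> distinct (map snd ts) \<and>
     (\<forall>i < length ts. fst (snd (ts ! i)) = fst (fst (ts ! (Suc i mod length ts))))"

lemma tandem_circuit_succ: "tandem_circuit X ts \<Longrightarrow> t \<in> set ts \<Longrightarrow> \<exists>t' \<in> set ts. fst (snd t) = fst (fst t')"
  unfolding tandem_circuit_def by (metis in_set_conv_nth length_pos_if_in_set mod_less_divisor nth_mem)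

lemma tandem_circuit_induct:
  assumes "tandem_circuit X ts" "t0 \<in> set ts" "P t0"
    and "\<And>t t'. t \<in> set ts \<Longrightarrow> t' \<in> set ts \<Longrightarrow> fst (snd t) = fst (fst t') \<Longrightarrow> P t \<Longrightarrow> P t'"
    and "t \<in> set ts"
  shows "P t"
proof -
  let ?n = "length ts"
  obtain i where i: "i < ?n" "ts ! i = t0" using assms(2) by (metis in_set_conv_nth)
  obtain j where j: "j < ?n" "ts ! j = t" using assms(5) by (metis in_set_conv_nth)
  have n: "0 < ?n" using i(1) by (rule le_less_trans[OF le0])
  have "P (ts ! ((i + k) mod ?n))" for k
  proof (induction k)
    case 0 then show ?case using i assms(3) by simp
  next
    case (Suc k)
    have l: "(i + k) mod ?n < ?n" using n by simp
    have s: "Suc ((i + k) mod ?n) mod ?n = (i + Suc k) mod ?n" by (simp add: mod_Suc_eq)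
    have "fst (snd (ts ! ((i + k) mod ?n))) = fst (fst (ts ! ((i + Suc k) mod ?n)))"
      using assms(1) l s unfolding tandem_circuit_def by metis
    then show ?case using assms(4)[OF nth_mem[OF l] nth_mem] Suc n by simp
  qed
  from this[of "?n - i + j"] show ?thesis using i j by simp
qed

lemma tandem_circuit_pred:
  assumes "tandem_circuit X ts" "t \<in> set ts"
  shows "\<exists>t' \<in> set ts. fst (snd t') = fst (fst t)"
proof -
  let ?n = "length ts"
  obtain j where j: "j < ?n" "ts ! j = t" using assms(2) by (metis in_set_conv_nth)
  let ?i = "if j = 0 then ?n - 1 else j - 1"
  have "?i < ?n" "Suc ?i mod ?n = j" using j by auto
  then show ?thesis using assms(1) j unfolding tandem_circuit_def by (metis nth_mem)
qed

lemma W_admissible_in_E: "W_admissible G X a \<Longrightarrow> a \<in> E"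
  unfolding W_admissible_def W_candidates_def at_W_def by blast

text \<open>A cycle enters every worker that it leaves, so the cleaning procedure never has a reason to delete
one of its edges.\<close>

lemma clean_keeps_cycle:
  assumes "tandem_circuit X ts" "clean_step G X \<Gamma> \<Gamma>'" "\<forall>t \<in> set ts. fst t \<in> fst \<Gamma> \<and> snd t \<in> snd \<Gamma>"
  shows "\<forall>t \<in> set ts. fst t \<in> fst \<Gamma>' \<and> snd t \<in> snd \<Gamma>'"
  using assms(2)
proof cases
  case (1 a A B)
  show ?thesis
  proof
    fix t assume t: "t \<in> set ts"
    obtain t' where t': "t' \<in> set ts" "fst (snd t') = fst (fst t)" using tandem_circuit_pred[OF assms(1) t] by blast
    have tB: "fst t \<in> A" "snd t \<in> B" "snd t' \<in> B" using assms(3) t t' 1 by simp_all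
    then have "snd t' \<in> at_W (fst (fst t)) B" using t'(2) by (simp add: at_W_def)
    then have "fst t \<noteq> a" using 1 by blast
    then have "fst t \<in> A - {a}" using tB by blast
    moreover have "tandem G X (fst t) (snd t)" using assms(1) t unfolding tandem_circuit_def by blast
    ultimately show "fst t \<in> fst \<Gamma>' \<and> snd t \<in> snd \<Gamma>'" using 1(2) tB by fastforce
  qed
qed

lemma cleaning_ends:
  assumes "finite (fst \<Gamma>)"
  shows "\<exists>\<Gamma>'. (clean_step G X)\<^sup>*\<^sup>* \<Gamma> \<Gamma>' \<and> \<not> (\<exists>\<Delta>. clean_step G X \<Gamma>' \<Delta>)"
  using assms
proof (induction "card (fst \<Gamma>)" arbitrary: \<Gamma> rule: less_induct)
  case less
  show ?case
  proof (cases "\<exists>\<Delta>. clean_step G X \<Gamma> \<Delta>")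
    case True
    then obtain \<Delta> where D: "clean_step G X \<Gamma> \<Delta>" by blast
    then obtain a where "fst \<Delta> = fst \<Gamma> - {a}" "a \<in> fst \<Gamma>" by cases auto
    then have "card (fst \<Delta>) < card (fst \<Gamma>)" "finite (fst \<Delta>)"
      using less.prems card_Diff1_less[of "fst \<Gamma>" a] by (simp_all del: card_Diff_insert card_Diff_singleton)
    from less.hyps[OF this] show ?thesis using D by (meson converse_rtranclp_into_rtranclp)
  qed blast
qed

text \<open>Cleaning ends, and every cycle of tandems survives it. Hence the active graph disappears from the
description of rotations.\<close>

lemma rotations_at_iff:
  "L \<in> rotations_at G X \<longleftrightarrow> (\<exists>ts. tandem_circuit X ts \<and> L = (set (map fst ts), set (map snd ts)))"
proof
  assume "L \<in> rotations_at G X"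
  then show "\<exists>ts. tandem_circuit X ts \<and> L = (set (map fst ts), set (map snd ts))"
    unfolding rotations_at_def tandem_cycle_def tandem_circuit_def by (simp add: case_prod_beta) blast
next
  assume "\<exists>ts. tandem_circuit X ts \<and> L = (set (map fst ts), set (map snd ts))"
  then obtain ts where ts: "tandem_circuit X ts" "L = (set (map fst ts), set (map snd ts))" by blast
  have "finite {a. W_admissible G X a}"
    using finite_E by (rule rev_finite_subset) (use W_admissible_in_E in blast)
  then obtain \<Gamma> where \<Gamma>: "(clean_step G X)\<^sup>*\<^sup>* (full_digraph G X) \<Gamma>" "\<not> (\<exists>\<Delta>. clean_step G X \<Gamma> \<Delta>)"
    using cleaning_ends[of "full_digraph G X" X] unfolding full_digraph_def fst_conv by blast
  have "\<forall>t \<in> set ts. fst t \<in> fst \<Gamma> \<and> snd t \<in> snd \<Gamma>" using \<Gamma>(1)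
  proof (induction rule: rtranclp_induct)
    case base
    have "tandem G X (fst t) (snd t)" if "t \<in> set ts" for t
      using ts(1) that unfolding tandem_circuit_def by blast
    moreover have "W_admissible G X a" if "tandem G X a b" for a b
      using that unfolding tandem_def by blast
    ultimately show ?case unfolding full_digraph_def fst_conv snd_conv by blast
  next
    case (step \<Gamma> \<Gamma>')
    then show ?case using clean_keeps_cycle[OF ts(1)] by blast
  qed
  then have "tandem_cycle G X \<Gamma> ts"
    using ts(1) unfolding tandem_cycle_def tandem_circuit_def by (simp add: case_prod_beta)
  then show "L \<in> rotations_at G X"
    using \<Gamma> ts(2) unfolding rotations_at_def active_graph_def by blast
qed

lemma tandem_circuit_image_fst:
  assumes "tandem_circuit X ts"
  shows "fst ` set (map fst ts) = fst ` set (map snd ts)"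
proof -
  have "fst (fst t) \<in> fst ` snd ` set ts" if "t \<in> set ts" for t
    using tandem_circuit_pred[OF assms that] by (metis image_eqI)
  moreover have "fst (snd t) \<in> fst ` fst ` set ts" if "t \<in> set ts" for t
    using tandem_circuit_succ[OF assms that] by (metis image_eqI)
  ultimately show ?thesis by (simp add: set_eq_subset image_subset_iff)
qed

text \<open>A worker is left by at most one tandem, so two cycles which meet in a worker cannot part again.\<close>

lemma tandem_circuit_subset:
  assumes "stable G X" "tandem_circuit X ts" "tandem_circuit X us" "t \<in> set ts" "u \<in> set us" "fst (fst t) = fst (fst u)"
  shows "set ts \<subseteq> set us"
proof
  have tan: "tandem G X (fst t) (snd t)" if "t \<in> set ts \<or> t \<in> set us" for t
    using that assms(2,3) unfolding tandem_circuit_def by blast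
  have eq: "t = u" if "t \<in> set ts" "u \<in> set us" "fst (fst t) = fst (fst u)" for t u
    using tandem_unique[OF assms(1) tan tan that(3)] that(1,2) by (meson prod_eqI)
  fix v assume "v \<in> set ts"
  show "v \<in> set us"
  proof (rule tandem_circuit_induct[OF assms(2,4) _ _ \<open>v \<in> set ts\<close>, where P = "\<lambda>v. v \<in> set us"])
    show "t \<in> set us" using eq[OF assms(4-6)] assms(5) by simp
    fix v v' assume v: "v \<in> set ts" "v' \<in> set ts" "fst (snd v) = fst (fst v')" "v \<in> set us"
    obtain u' where "u' \<in> set us" "fst (snd v) = fst (fst u')" using tandem_circuit_succ[OF assms(3) v(4)] by blast
    then show "v' \<in> set us" using eq[OF v(2)] v(3) by metis
  qed
qed

lemma rotations_meet:
  assumes "stable G X" "L \<in> rotations_at G X" "K \<in> rotations_at G X"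
    and "l \<in> snd L" "k \<in> snd K" "fst l = fst k"
  shows "L = K"
proof -
  obtain ts where ts: "tandem_circuit X ts" "L = (set (map fst ts), set (map snd ts))"
    using assms(2) rotations_at_iff by blast
  obtain us where us: "tandem_circuit X us" "K = (set (map fst us), set (map snd us))"
    using assms(3) rotations_at_iff by blast
  obtain t where "t \<in> set ts" "l = snd t" using assms(4) ts(2) by auto
  then obtain t' where t': "t' \<in> set ts" "fst l = fst (fst t')" using tandem_circuit_succ[OF ts(1)] by blast
  obtain u where "u \<in> set us" "k = snd u" using assms(5) us(2) by auto
  then obtain u' where u': "u' \<in> set us" "fst k = fst (fst u')" using tandem_circuit_succ[OF us(1)] by blast
  have "fst (fst t') = fst (fst u')" using t' u' assms(6) by simp
  then have "set ts = set us"
    using tandem_circuit_subset[OF assms(1) ts(1) us(1) t'(1) u'(1)] tandem_circuit_subset[OF assms(1) us(1) ts(1) u'(1) t'(1)]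
    by simp
  then show ?thesis using ts(2) us(2) by simp
qed

text \<open>Following tandems inside the finite set \<open>S\<close> must eventually repeat an edge \<open>y\<close>. The tandems of the first
period of \<open>y\<close> form a cycle without repetitions.\<close>

lemma closed_set_contains_rotation:
  assumes "stable G X" "S \<subseteq> X" "S \<noteq> {}"
    and "\<And>x. x \<in> S \<Longrightarrow> \<exists>a b. fst a = fst x \<and> tandem G X a b \<and> b \<in> S"
  shows "\<exists>L \<in> rotations_at G X. snd L \<subseteq> S"
proof -
  have "\<exists>p. fst (fst p) = fst x \<and> tandem G X (fst p) (snd p) \<and> snd p \<in> S" if "x \<in> S" for x
    using assms(4)[OF that] by (metis fst_conv snd_conv)
  then obtain h where h: "\<And>x. x \<in> S \<Longrightarrow> fst (fst (h x)) = fst x"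
      "\<And>x. x \<in> S \<Longrightarrow> tandem G X (fst (h x)) (snd (h x))" "\<And>x. x \<in> S \<Longrightarrow> snd (h x) \<in> S"
    by metis
  define \<beta> where "\<beta> = (\<lambda>x. snd (h x))"
  obtain x0 where x0: "x0 \<in> S" using assms(3) by (metis all_not_in_conv)
  have finS: "finite S" using stableD(5)[OF assms(1)] assms(2) finite_subset by metis
  have orb: "(\<beta> ^^ k) x \<in> S" if "x \<in> S" for x k
    using that h(3) by (induction k) (simp_all add: \<beta>_def)
  have "\<not> inj (\<lambda>k. (\<beta> ^^ k) x0)"
    using finS orb[OF x0] finite_subset[of "range (\<lambda>k. (\<beta> ^^ k) x0)" S] finite_imageD[of _ UNIV]
    by (metis image_subsetI infinite_UNIV_nat)
  then obtain i j where ij: "i < j" "(\<beta> ^^ i) x0 = (\<beta> ^^ j) x0"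
    unfolding inj_def by (metis linorder_neqE_nat)
  define y where "y = (\<beta> ^^ i) x0"
  have y: "y \<in> S" using orb x0 by (simp add: y_def)
  \<comment> \<open>the least period, so that the edges met before are pairwise different\<close>
  define p where "p = (LEAST p. 0 < p \<and> (\<beta> ^^ p) y = y)"
  have "(\<beta> ^^ (j - i)) y = y"
    using ij unfolding y_def by (metis comp_apply funpow_add le_add_diff_inverse2 less_imp_le)
  then have "0 < j - i \<and> (\<beta> ^^ (j - i)) y = y" using ij by simp
  then have p: "0 < p" "(\<beta> ^^ p) y = y" unfolding p_def by (metis (mono_tags, lifting) LeastI)+
  have pmin: "(\<beta> ^^ q) y \<noteq> y" if "0 < q" "q < p" for q
    using that not_less_Least[of q "\<lambda>p. 0 < p \<and> (\<beta> ^^ p) y = y"] unfolding p_def by blast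
  have inj: "k = l" if kl: "k < p" "l < p" "(\<beta> ^^ k) y = (\<beta> ^^ l) y" for k l
  proof -
    have *: False if kl: "k < l" "l < p" "(\<beta> ^^ k) y = (\<beta> ^^ l) y" for k l
    proof -
      have "(\<beta> ^^ (p - l + k)) y = (\<beta> ^^ (p - l)) ((\<beta> ^^ l) y)" using kl(3) by (simp add: funpow_add)
      also have "\<dots> = (\<beta> ^^ p) y" using kl(2) by (metis comp_apply funpow_add le_add_diff_inverse2 less_imp_le)
      finally show False using pmin[of "p - l + k"] p kl by (simp del: Nat.diff_add_assoc2, linarith)
    qed
    show ?thesis using * kl by (metis linorder_neqE_nat)
  qed
  have inj': "k = l" if kl: "k < p" "l < p" "(\<beta> ^^ Suc k) y = (\<beta> ^^ Suc l) y" for k l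
  proof -
    have "(\<beta> ^^ k) y = (\<beta> ^^ (p - 1)) ((\<beta> ^^ Suc k) y)" if "k < p" for k
    proof -
      have "(\<beta> ^^ (p - 1)) ((\<beta> ^^ Suc k) y) = (\<beta> ^^ k) ((\<beta> ^^ p) y)"
        using p(1) that by (metis comp_apply funpow_add add.commute Suc_pred' add_Suc_shift plus_1_eq_Suc)
      then show ?thesis using p(2) by simp
    qed
    then show ?thesis using inj kl by metis
  qed
  have modp: "(\<beta> ^^ (k mod p)) y = (\<beta> ^^ k) y" for k using funpow_mod_eq[OF p(2)] .
  define ts where "ts = map (\<lambda>k. h ((\<beta> ^^ k) y)) [0..<p]"
  have fsth: "fst (h x) = fst (h x') \<Longrightarrow> x = x'" if "x \<in> S" "x' \<in> S" for x x'
    using h(1)[OF that(1)] h(1)[OF that(2)] stable_unique[OF assms(1), of x x'] that assms(2)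
    by (metis subsetD)
  have "tandem_circuit X ts" unfolding tandem_circuit_def
  proof (intro conjI allI impI)
    show "ts \<noteq> []" using p(1) by (simp add: ts_def)
    show "\<forall>t \<in> set ts. tandem G X (fst t) (snd t)"
      using h(2) orb[OF y] by (simp add: ts_def)
    show "distinct (map fst ts)"
      unfolding ts_def distinct_conv_nth using inj fsth[OF orb[OF y] orb[OF y]] by (simp, metis)
    have "snd (h ((\<beta> ^^ k) y)) = (\<beta> ^^ Suc k) y" for k by (simp add: \<beta>_def)
    then show "distinct (map snd ts)"
      unfolding ts_def distinct_conv_nth using inj' by (simp del: funpow.simps, metis)
    fix k assume "k < length ts"
    then have k: "k < p" by (simp add: ts_def)
    have m: "Suc k mod p < p" using p(1) by simp
    have "fst (fst (h ((\<beta> ^^ (Suc k mod p)) y))) = fst ((\<beta> ^^ Suc k) y)"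
      using h(1)[OF orb[OF y]] modp by metis
    then show "fst (snd (ts ! k)) = fst (fst (ts ! (Suc k mod length ts)))"
      using k m by (simp add: ts_def \<beta>_def)
  qed
  moreover have "set (map snd ts) \<subseteq> S" 
    using h(3)[OF orb[OF y]] by (simp add: ts_def image_subset_iff)
  ultimately show ?thesis using rotations_at_iff by (metis snd_conv)
qed

section \<open>Advancing towards a better stable matching\<close>

text \<open>A firm which is content with its edges in \<open>Y\<close> keeps them when it is offered the edges of a worse
matching and, moreover, edges which it refuses at \<open>Y\<close>.\<close>

lemma leF_refuse_new:
  assumes "stable G X" "stable G Y" "leF X Y" "f \<in> Fpart G" "A \<subseteq> at_F f E"
    and "\<And>a. a \<in> A \<Longrightarrow> a \<in> Y \<or> a \<notin> grow Y a"
  shows "C f (at_F f X \<union> at_F f Y \<union> A) = at_F f Y"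
proof -
  have X: "X \<subseteq> E" and Y: "Y \<subseteq> E" using stableD(1) assms by blast+
  note at = at_F_mono[OF X, of f] at_F_mono[OF Y, of f]
  have "C f (at_F f X \<union> at_F f Y \<union> A) = C f (C f (at_F f X \<union> at_F f Y) \<union> A)"
    using choice_path_independent[OF assms(4)] at assms(5) by simp
  also have "\<dots> = C f (at_F f Y \<union> A)" using assms(3,4) by (simp add: leF_def)
  also have "\<dots> = at_F f Y"
  proof (rule choice_refuse_all[OF assms(4) at(2) assms(5) stableD(3)[OF assms(2,4)]])
    fix a assume a: "a \<in> A" "a \<notin> at_F f Y"
    then have "snd a = f" using assms(5) by (meson in_at_F subsetD)
    then show "a \<notin> C f (insert a (at_F f Y))" using assms(6)[OF a(1)] a(2) by simp
  qed
  finally show ?thesis .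
qed

lemma grow_self: "stable G Y \<Longrightarrow> y \<in> Y \<Longrightarrow> y \<in> grow Y y"
  using stableD(3)[of Y "snd y"] stableD(1)[of Y] snd_in_F[of y]
  by (metis in_at_F insert_absorb subsetD)

text \<open>The edge \<open>y\<close> of the worker in \<open>Y\<close> is worse than \<open>x\<close> and wanted at \<open>X\<close>, so the best such edge \<open>a\<close> is at least as good
as \<open>y\<close>. If it is better, then \<open>Y\<close> is stable only because the firm refuses \<open>a\<close>.\<close>

lemma W_admissible_refused:
  assumes "stable G X" "stable G Y" "leF X Y" "x \<in> X" "x \<notin> Y"
    and "W_admissible G X a" "fst a = fst x"
  shows "a \<in> Y \<or> a \<notin> grow Y a"
proof (cases "a \<in> Y")
  case False
  have "fst x \<in> fst ` Y" using leF_rural(1)[OF assms(1-3)] assms(4) by (metis image_eqI)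
  then obtain y where y: "y \<in> Y" "fst y = fst x" by (metis imageE)
  have yX: "y \<notin> X" using stable_unique[OF assms(1) _ assms(4)] y assms(5) by metis
  obtain x' where "x' \<in> X" "x' \<succ> y" using leF_opposite[OF assms(1-3) y(1) yX] by blast
  then have xy: "x \<succ> y" using stable_unique[OF assms(1) _ assms(4)] y unfolding better_def by metis
  have "y \<in> grow X y"
    using grow_antimono[OF _ _ assms(3), of y] stableD(1) assms(1,2) y(1) grow_self[OF assms(2) y(1)]
    by (metis subsetD)
  then obtain a' where a': "W_admissible G X a'" "fst a' = fst x" "a' = y \<or> a' \<succ> y"
    using W_admissible_exists[OF assms(1,4) xy] by blast
  then have "a' = a" using W_admissible_unique[OF assms(1)] assms(6,7) by metis
  then have ay: "a \<succ> y" using a' False y by metis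
  have "a \<notin> grow Y a"
  proof
    assume "a \<in> grow Y a"
    then obtain z where z: "z \<in> Y" "z \<succ> a"
      using stableD(4)[OF assms(2) _ False] ay unfolding better_def by metis
    then have "z = y" using stable_unique[OF assms(2) _ y(1)] ay unfolding better_def by metis
    then show False using z ay better_asym by metis
  qed
  then show ?thesis ..
qed blast

text \<open>Offered its edges in \<open>X\<close> and in \<open>Y\<close> together with \<open>a\<close>, the firm chooses those in \<open>Y\<close>, and these are as many
as those in \<open>X\<close>. By cardinal monotonicity it cannot accept \<open>a\<close> at \<open>X\<close> without giving up an edge \<open>b\<close>, and by
substitutability \<open>b\<close> is not an edge of \<open>Y\<close>, since those are chosen even from the larger offer.\<close>

lemma advance:
  assumes "stable G X" "stable G Y" "leF X Y" "x \<in> X" "x \<notin> Y"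
  shows "\<exists>a b. fst a = fst x \<and> tandem G X a b \<and> b \<in> X \<and> b \<notin> Y"
proof -
  have X: "X \<subseteq> E" and Y: "Y \<subseteq> E" using stableD(1) assms by blast+
  have "fst x \<in> fst ` Y" using leF_rural(1)[OF assms(1-3)] assms(4) by (metis image_eqI)
  then obtain y where y: "y \<in> Y" "fst y = fst x" by (metis imageE)
  have yX: "y \<notin> X" using stable_unique[OF assms(1) _ assms(4)] y assms(5) by metis
  obtain x' where "x' \<in> X" "x' \<succ> y" using leF_opposite[OF assms(1-3) y(1) yX] by blast
  then have xy: "x \<succ> y" using stable_unique[OF assms(1) _ assms(4)] y unfolding better_def by metis
  have "y \<in> grow X y"
    using grow_antimono[OF X Y assms(3), of y] Y y(1) grow_self[OF assms(2) y(1)] by (metis subsetD)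
  then obtain a where a: "W_admissible G X a" "fst a = fst x"
    using W_admissible_exists[OF assms(1,4) xy] by blast
  let ?f = "snd a"
  have aE: "a \<in> E" and f: "?f \<in> Fpart G" using W_admissible_in_E[OF a(1)] snd_in_F by blast+
  have ref: "a \<in> Y \<or> a \<notin> grow Y a" by (rule W_admissible_refused[OF assms a])
  have U: "C ?f (at_F ?f X \<union> at_F ?f Y \<union> {a}) = at_F ?f Y"
    by (rule leF_refuse_new[OF assms(1-3) f]) (use aE ref in \<open>simp_all\<close>)
  have subE: "at_F ?f X \<union> at_F ?f Y \<union> {a} \<subseteq> at_F ?f E"
    using at_F_mono[OF X, of ?f] at_F_mono[OF Y, of ?f] aE by simp
  have subU: "insert a (at_F ?f X) \<subseteq> at_F ?f X \<union> at_F ?f Y \<union> {a}" by blast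
  obtain x0 where x0: "x0 \<in> X" "x0 \<succ> a" "a \<in> grow X a"
    using a(1) W_admissible_iff[OF assms(1)] by blast
  have aX: "a \<notin> X" using stable_unique[OF assms(1)] better_irrefl x0 by (metis better_def)
  have "card (grow X a) \<le> card (at_F ?f Y)" using choice_card_mono[OF f subE subU] U by simp
  then have "card (grow X a) \<le> card (at_F ?f X)" using leF_rural(2)[OF assms(1-3) f] by simp
  moreover have "card (insert a (at_F ?f X)) = Suc (card (at_F ?f X))"
    using finite_at_F[OF X] aX by simp
  ultimately have "grow X a \<noteq> insert a (at_F ?f X)" by (metis not_less_eq_eq order_refl)
  moreover have "grow X a \<subseteq> insert a (at_F ?f X)" using choice_sub[OF f] subU subE by (meson order_trans)
  ultimately obtain b where b: "b \<in> at_F ?f X" "b \<notin> grow X a" using x0(3) by blast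
  have "b \<notin> Y"
  proof
    assume "b \<in> Y"
    then have "b \<in> C ?f (at_F ?f X \<union> at_F ?f Y \<union> {a})" using U b(1) by simp
    then show False using choice_substitutable[OF f subE subU] b by blast
  qed
  moreover have "tandem G X a b" using tandemI[OF assms(1) a(1)] b by simp
  ultimately show ?thesis using a(2) b(1) by auto
qed

text \<open>The edge \<open>b\<close>, displaced by \<open>a\<close> at \<open>X\<close>, is not chosen from the larger offer at \<open>Y\<close> either. So the firm does
not choose all of its edges in \<open>Y\<close> when \<open>a\<close> is offered, which means that it accepts \<open>a\<close>. For the worker, \<open>a\<close> is
still the best wanted edge, because at \<open>Y\<close> the firms want less than at \<open>X\<close>.\<close>

lemma tandem_persists:
  assumes "stable G X" "stable G Y" "leF X Y" "tandem G X a b" "b \<in> Y"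
    and "x \<in> X" "x \<in> Y" "fst x = fst a"
  shows "tandem G Y a b"
proof -
  have X: "X \<subseteq> E" and Y: "Y \<subseteq> E" using stableD(1) assms by blast+
  let ?f = "snd a"
  note t = tandemD[OF assms(1,4)]
  have aE: "a \<in> E" and f: "?f \<in> Fpart G" using t snd_in_F by blast+
  obtain x0 where x0: "x0 \<in> X" "x0 \<succ> a" "a \<in> grow X a"
      "\<forall>e. x0 \<succ> e \<longrightarrow> e \<in> grow X e \<longrightarrow> e \<noteq> a \<longrightarrow> a \<succ> e"
    using t(1) W_admissible_iff[OF assms(1)] by blast
  have "x0 = x" using stable_unique[OF assms(1) x0(1) assms(6)] x0(2) assms(8) unfolding better_def by metis
  note x = x0[unfolded this]
  have aY: "a \<notin> Y" using stable_unique[OF assms(2) _ assms(7)] x(2) better_irrefl unfolding better_def by metis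
  have subE: "at_F ?f X \<union> at_F ?f Y \<union> {a} \<subseteq> at_F ?f E"
    using at_F_mono[OF X, of ?f] at_F_mono[OF Y, of ?f] aE by simp
  have subU: "insert a (at_F ?f X) \<subseteq> at_F ?f X \<union> at_F ?f Y \<union> {a}" by blast
  have "C ?f (at_F ?f X \<union> at_F ?f Y \<union> {a}) = C ?f (C ?f (at_F ?f X \<union> at_F ?f Y) \<union> {a})"
    by (rule choice_path_independent[OF f]) (use subE in blast)+
  also have "\<dots> = grow Y a" using assms(3) f by (simp add: leF_def)
  finally have U: "C ?f (at_F ?f X \<union> at_F ?f Y \<union> {a}) = grow Y a" .
  have "b \<notin> grow X a" using t by auto
  then have bY: "b \<notin> grow Y a"
    using choice_substitutable[OF f subE subU, of b] t(4,5) unfolding U by auto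
  have "a \<in> grow Y a"
  proof (rule ccontr)
    assume "a \<notin> grow Y a"
    then have "C ?f (at_F ?f Y \<union> {a}) = at_F ?f Y"
      using choice_refuse_all[OF f at_F_mono[OF Y], of "{a}"] aE stableD(3)[OF assms(2) f] by auto
    then show False using bY assms(5) t(5) by simp
  qed
  moreover have "a \<succ> e" if "x \<succ> e" "e \<in> grow Y e" "e \<noteq> a" for e
    using x(4) that grow_antimono[OF X Y assms(3), of e] unfolding better_def by metis
  ultimately have "W_admissible G Y a"
    unfolding W_admissible_iff[OF assms(2)] using assms(7) x(2) by blast
  then show ?thesis using tandemI[OF assms(2) _ assms(5) t(5) bY] by blast
qed


section \<open>Applying a rotation\<close>

lemma rotationD:
  assumes "stable G X" "L \<in> rotations_at G X"
  shows "snd L \<subseteq> X" "snd L \<noteq> {}" "fst L \<noteq> {}" "fst L \<inter> X = {}" "fst L \<subseteq> E" "fst ` fst L = fst ` snd L"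
    "inj_on fst (fst L)"
    "\<And>a. a \<in> fst L \<Longrightarrow> \<exists>b \<in> snd L. tandem G X a b"
    "\<And>b. b \<in> snd L \<Longrightarrow> \<exists>a \<in> fst L. tandem G X a b"
    "\<And>b. b \<in> snd L \<Longrightarrow> \<exists>a \<in> fst L. fst a = fst b"
    "\<And>a. a \<in> fst L \<Longrightarrow> \<exists>b \<in> snd L. fst a = fst b"
    "\<And>a b. a \<in> fst L \<Longrightarrow> b \<in> snd L \<Longrightarrow> fst a = fst b \<Longrightarrow> b \<succ> a"
    "\<And>f. card (at_F f (fst L)) = card (at_F f (snd L))"
proof -
  obtain ts where ts: "tandem_circuit X ts" "L = (set (map fst ts), set (map snd ts))"
    using assms(2) rotations_at_iff by blast
  have tan: "tandem G X (fst t) (snd t)" if "t \<in> set ts" for t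
    using ts(1) that unfolding tandem_circuit_def by blast
  have L: "fst L = fst ` set ts" "snd L = snd ` set ts" using ts(2) by simp_all
  show t1: "\<exists>b \<in> snd L. tandem G X a b" if "a \<in> fst L" for a
    using that tan unfolding L by blast
  show t2: "\<exists>a \<in> fst L. tandem G X a b" if "b \<in> snd L" for b
    using that tan unfolding L by blast
  show sub: "snd L \<subseteq> X" using t2 tandemD(4)[OF assms(1)] by blast
  show "snd L \<noteq> {}" "fst L \<noteq> {}" using ts(1) unfolding tandem_circuit_def L by simp_all
  show "fst L \<inter> X = {}" using t1 tandemD(3)[OF assms(1)] by blast
  show "fst L \<subseteq> E" using t1 tandemD(2)[OF assms(1)] by blast
  show im: "fst ` fst L = fst ` snd L" using tandem_circuit_image_fst[OF ts(1)] ts(2) by simp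
  show "inj_on fst (fst L)"
    using t1 tandemD(1)[OF assms(1)] W_admissible_unique[OF assms(1)] by (metis inj_onI)
  show "\<exists>a \<in> fst L. fst a = fst b" if "b \<in> snd L" for b
    using that im by (metis imageE image_eqI)
  show "\<exists>b \<in> snd L. fst a = fst b" if "a \<in> fst L" for a
    using that im by (metis imageE image_eqI)
  show "b \<succ> a" if ab: "a \<in> fst L" "b \<in> snd L" "fst a = fst b" for a b
  proof -
    obtain x where "x \<in> X" "x \<succ> a" using t1[OF ab(1)] tandemD(8)[OF assms(1)] by blast
    moreover have "x = b" using calculation ab sub stable_unique[OF assms(1), of x b]
      unfolding better_def by (metis subsetD)
    ultimately show ?thesis by simp
  qed
  fix f
  let ?T = "{t \<in> set ts. snd (fst t) = f}"
  have inj: "inj_on fst (set ts)" "inj_on snd (set ts)"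
    using ts(1) unfolding tandem_circuit_def by (simp_all add: distinct_map)
  have "at_F f (fst L) = fst ` ?T" unfolding L at_F_def by blast
  moreover have "at_F f (snd L) = snd ` ?T"
  proof -
    have "snd (snd t) = snd (fst t)" if "t \<in> set ts" for t
      using tandemD(5)[OF assms(1) tan[OF that]] .
    then have "at_F f (snd L) \<subseteq> snd ` ?T" "snd ` ?T \<subseteq> at_F f (snd L)"
      unfolding L at_F_def by (force simp del: split_paired_All, simp add: image_subset_iff)
    then show ?thesis by (rule subset_antisym)
  qed
  moreover have "card (fst ` ?T) = card ?T" "card (snd ` ?T) = card ?T"
    using inj by (simp_all add: card_image inj_on_subset)
  ultimately show "card (at_F f (fst L)) = card (at_F f (snd L))" by simp
qed

text \<open>Each new edge displaces its own old edge, even if all of them are offered together. The remaining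
edges are as many as before, so by cardinal monotonicity nothing else is given up.\<close>

lemma apply_rotation_choice:
  assumes "stable G X" "L \<in> rotations_at G X" "f \<in> Fpart G"
  shows "C f (at_F f X \<union> at_F f (fst L)) = at_F f (apply_rotation L X)"
proof -
  note r = rotationD[OF assms(1,2)]
  have X: "X \<subseteq> E" using stableD(1) assms by blast
  let ?A = "at_F f (fst L)" and ?B = "at_F f (snd L)" and ?X = "at_F f X"
  have U: "?X \<union> ?A \<subseteq> at_F f E" using at_F_mono[OF X, of f] at_F_mono[OF r(5), of f] by simp
  have eq: "at_F f (apply_rotation L X) = (?X - ?B) \<union> ?A"
    unfolding apply_rotation_def at_F_def by blast
  have fin: "finite ?X" "finite ?A" "finite ?B"
    using finite_at_F X r(1,5) by (meson order_trans)+
  have "C f (?X \<union> ?A) \<subseteq> (?X - ?B) \<union> ?A"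
  proof
    fix e assume e: "e \<in> C f (?X \<union> ?A)"
    have "e \<in> ?X \<union> ?A" using e choice_sub[OF assms(3) U] by blast
    moreover have "e \<notin> ?B"
    proof
      assume eB: "e \<in> ?B"
      then have "e \<in> snd L" by simp
      then obtain a where a: "a \<in> fst L" "tandem G X a e" using r(9) by blast
      note t = tandemD[OF assms(1) a(2)]
      have sa: "snd a = f" using t(5) eB by simp
      have "insert a ?X \<subseteq> ?X \<union> ?A" using a(1) sa by simp
      then have "e \<in> grow X a"
        using choice_substitutable[OF assms(3) U _ e, of "insert a ?X"] eB r(1) sa by auto
      then show False using t(6,7) by simp
    qed
    ultimately show "e \<in> (?X - ?B) \<union> ?A" by blast
  qed
  moreover have "card ((?X - ?B) \<union> ?A) \<le> card (C f (?X \<union> ?A))"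
  proof -
    have BX: "?B \<subseteq> ?X" by (rule at_F_mono[OF r(1)])
    have "(?X - ?B) \<inter> ?A = {}" using r(4) unfolding at_F_def by blast
    then have "card ((?X - ?B) \<union> ?A) = card (?X - ?B) + card ?A"
      using fin by (simp add: card_Un_disjoint)
    also have "\<dots> = card ?X" using card_Diff_subset[OF fin(3) BX] card_mono[OF fin(1) BX] r(13) by simp
    also have "\<dots> = card (C f ?X)" using stableD(3)[OF assms(1,3)] by simp
    also have "\<dots> \<le> card (C f (?X \<union> ?A))" by (rule choice_card_mono[OF assms(3) U]) simp
    finally show ?thesis .
  qed
  ultimately show ?thesis unfolding eq using fin by (metis card_seteq finite_Diff finite_UnI)
qed

lemma leF_apply_rotation:
  assumes "stable G X" "L \<in> rotations_at G X"
  shows "leF X (apply_rotation L X)"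
  unfolding leF_def
proof
  fix f assume f: "f \<in> Fpart G"
  have "at_F f X \<union> at_F f (apply_rotation L X) = at_F f X \<union> at_F f (fst L)"
    unfolding apply_rotation_def at_F_def by blast
  then show "C f (at_F f X \<union> at_F f (apply_rotation L X)) = at_F f (apply_rotation L X)"
    using apply_rotation_choice[OF assms f] by simp
qed

lemma apply_rotation_cases:
  assumes "x \<in> apply_rotation L X"
  obtains "x \<in> X" "x \<notin> snd L" | "x \<in> fst L"
  using assms unfolding apply_rotation_def by blast

text \<open>An edge \<open>e\<close> wanted after the rotation was wanted before. If \<open>e\<close> was given up in the rotation, the firm
refuses it by consistency. Otherwise the worker of \<open>e\<close> had a better edge; if the rotation moves this
worker, then to its best wanted edge, which is not worse than \<open>e\<close>.\<close>

lemma stable_apply_rotation: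
  assumes "stable G X" "L \<in> rotations_at G X"
  shows "stable G (apply_rotation L X)"
  unfolding stable_iff
proof (intro conjI ballI impI)
  let ?X' = "apply_rotation L X"
  note r = rotationD[OF assms]
  have X: "X \<subseteq> E" using stableD(1) assms by blast
  show X': "?X' \<subseteq> E" using X r(5) unfolding apply_rotation_def by blast
  have new_old: "fst x \<noteq> fst a" if "x \<in> X" "x \<notin> snd L" "a \<in> fst L" for x a
    using that r(1) r(11)[OF that(3)] stable_unique[OF assms(1)] by (metis subsetD)
  show inj: "inj_on fst ?X'"
  proof (rule inj_onI)
    fix x y assume xy: "x \<in> ?X'" "y \<in> ?X'" "fst x = fst y"
    show "x = y" using xy(1)
    proof (cases rule: apply_rotation_cases)
      case 1 note x = this
      show ?thesis using xy(2)
      proof (cases rule: apply_rotation_cases)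
        case 1 then show ?thesis using x xy(3) stable_unique[OF assms(1)] by blast
      next
        case 2 then show ?thesis using new_old[OF x] xy(3) by blast
      qed
    next
      case 2 note x = this
      show ?thesis using xy(2)
      proof (cases rule: apply_rotation_cases)
        case 1 then show ?thesis using new_old[OF 1 x] xy(3) by metis
      next
        case 2 then show ?thesis using x xy(3) r(7) by (meson inj_onD)
      qed
    qed
  qed
  show "C f (at_F f ?X') = at_F f ?X'" if "f \<in> Fpart G" for f
    using choice_idem[OF that, of "at_F f X \<union> at_F f (fst L)"] apply_rotation_choice[OF assms that]
      at_F_mono[OF X] at_F_mono[OF r(5)] by (metis Un_least)
  fix e assume e: "e \<in> E" "e \<notin> ?X'" "e \<in> grow ?X' e"
  let ?f = "snd e"
  have f: "?f \<in> Fpart G" using e snd_in_F by blast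
  have gX: "e \<in> grow X e" using grow_antimono[OF X X' leF_apply_rotation[OF assms] e(1,3)] .
  show "\<exists>x \<in> ?X'. x \<succ> e"
  proof (cases "e \<in> X")
    case True
    have U: "at_F ?f X \<union> at_F ?f (fst L) \<subseteq> at_F ?f E"
      using at_F_mono[OF X, of ?f] at_F_mono[OF r(5), of ?f] by simp
    have "insert e (at_F ?f ?X') \<subseteq> at_F ?f X \<union> at_F ?f (fst L)"
      using True unfolding apply_rotation_def at_F_def by blast
    then have "grow ?X' e = at_F ?f ?X'"
      using choice_consistent[OF f U, of "insert e (at_F ?f ?X')"] apply_rotation_choice[OF assms f]
      by (metis subset_insertI)
    then show ?thesis using e(2,3) by simp
  next
    case False
    then obtain x where x: "x \<in> X" "x \<succ> e" using stableD(4)[OF assms(1) e(1) _ gX] by blast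
    show ?thesis
    proof (cases "x \<in> snd L")
      case False
      then have "x \<in> ?X'" using x unfolding apply_rotation_def by blast
      then show ?thesis using x by blast
    next
      case True
      then obtain a where a: "a \<in> fst L" "fst a = fst x" using r(10) by blast
      then have aX': "a \<in> ?X'" unfolding apply_rotation_def by blast
      have "W_admissible G X a" using r(8)[OF a(1)] tandemD(1)[OF assms(1)] by blast
      moreover obtain a' where "W_admissible G X a'" "fst a' = fst x" "a' = e \<or> a' \<succ> e"
        using W_admissible_exists[OF assms(1) x gX] by blast
      ultimately have "a = e \<or> a \<succ> e" using W_admissible_unique[OF assms(1)] a(2) by metis
      then show ?thesis using aX' e(2) by blast
    qed
  qed
qed

lemma leF_apply_rotation_le:
  assumes "stable G X" "stable G Y" "leF X Y" "L \<in> rotations_at G X" "snd L \<inter> Y = {}"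
  shows "leF (apply_rotation L X) Y"
  unfolding leF_def
proof
  fix f assume f: "f \<in> Fpart G"
  note r = rotationD[OF assms(1,4)]
  let ?X' = "apply_rotation L X"
  have X: "X \<subseteq> E" and Y: "Y \<subseteq> E" using stableD(1) assms by blast+
  have "C f (at_F f X \<union> at_F f Y \<union> at_F f (fst L)) = at_F f Y"
  proof (rule leF_refuse_new[OF assms(1-3) f at_F_mono[OF r(5)]])
    fix a assume "a \<in> at_F f (fst L)"
    then have a: "a \<in> fst L" by simp
    then obtain b where b: "b \<in> snd L" "fst a = fst b" using r(11) by blast
    have "W_admissible G X a" using r(8)[OF a] tandemD(1)[OF assms(1)] by blast
    then show "a \<in> Y \<or> a \<notin> grow Y a"
      using W_admissible_refused[OF assms(1-3), of b a] b r(1) assms(5) by blast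
  qed
  moreover have "at_F f X \<union> at_F f Y \<union> at_F f (fst L) \<subseteq> at_F f E"
    using at_F_mono[OF X, of f] at_F_mono[OF Y, of f] at_F_mono[OF r(5), of f] by simp
  moreover have "at_F f ?X' \<union> at_F f Y \<subseteq> at_F f X \<union> at_F f Y \<union> at_F f (fst L)"
    unfolding apply_rotation_def at_F_def by blast
  ultimately show "C f (at_F f ?X' \<union> at_F f Y) = at_F f Y"
    using choice_consistent[OF f] by (metis Un_upper2)
qed

text \<open>If one of the displaced edges is missing in \<open>Y\<close>, then by \<open>advance\<close> so is the next one, and thus all of
them. If none is missing, then all tandems persist.\<close>

lemma rotation_dichotomy:
  assumes "stable G X" "stable G Y" "leF X Y" "L \<in> rotations_at G X"
  shows "snd L \<inter> Y = {} \<and> leF (apply_rotation L X) Y \<or> snd L \<subseteq> Y \<and> L \<in> rotations_at G Y"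
proof -
  obtain ts where ts: "tandem_circuit X ts" "L = (set (map fst ts), set (map snd ts))"
    using assms(4) rotations_at_iff by blast
  note r = rotationD[OF assms(1,4)]
  have tan: "tandem G X (fst t) (snd t)" if "t \<in> set ts" for t
    using ts(1) that unfolding tandem_circuit_def by blast
  have L: "fst L = fst ` set ts" "snd L = snd ` set ts" using ts(2) by simp_all
  show ?thesis
  proof (cases "snd L \<subseteq> Y")
    case True
    have "tandem G Y (fst t) (snd t)" if t: "t \<in> set ts" for t
    proof -
      obtain t' where t': "t' \<in> set ts" "fst (snd t') = fst (fst t)" using tandem_circuit_pred[OF ts(1) t] by blast
      have "snd t' \<in> snd L" "snd t \<in> snd L" using t t' L by simp_all
      then show ?thesis
        using tandem_persists[OF assms(1-3) tan[OF t], of "snd t'"] t'(2) True r(1) by blast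
    qed
    then have "tandem_circuit Y ts" using ts(1) unfolding tandem_circuit_def by blast
    then show ?thesis using True ts(2) rotations_at_iff by blast
  next
    case False
    then obtain t0 where t0: "t0 \<in> set ts" "snd t0 \<notin> Y"
      unfolding L by (metis image_subsetI)
    have "snd t \<notin> Y" if "t \<in> set ts" for t
    proof (rule tandem_circuit_induct[OF ts(1) t0(1) _ _ that, where P = "\<lambda>t. snd t \<notin> Y"])
      show "snd t0 \<notin> Y" by (rule t0(2))
      fix t t' assume t: "t \<in> set ts" "t' \<in> set ts" "fst (snd t) = fst (fst t')" "snd t \<notin> Y"
      have "snd t \<in> X" using tandemD(4)[OF assms(1) tan[OF t(1)]] .
      then obtain a b where ab: "fst a = fst (snd t)" "tandem G X a b" "b \<notin> Y"
        using advance[OF assms(1-3) _ t(4)] by blast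
      then have "b = snd t'" using tandem_unique[OF assms(1) ab(2) tan[OF t(2)]] t(3) by simp
      then show "snd t' \<notin> Y" using ab by simp
    qed
    then have "\<forall>y \<in> snd ` set ts. y \<notin> Y" by simp
    then have "snd L \<inter> Y = {}" unfolding L by blast
    then show ?thesis using leF_apply_rotation_le[OF assms] by blast
  qed
qed

section \<open>Ranks and depth\<close>

definition rk :: "'w \<times> 'f \<Rightarrow> nat" where
  "rk e = card {e'. e' \<succ> e}"

text \<open>A worker whose edge has rank \<open>r\<close> has moved through \<open>r + 1\<close> edges of its list. Different workers have
different edges, so the depth never exceeds the number of edges.\<close>

definition depth :: "('w \<times> 'f) set \<Rightarrow> nat" where
  "depth X = (\<Sum>x \<in> X. Suc (rk x))"

lemma finite_better: "finite {e'. e' \<succ> e}"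
  using finite_E by (rule rev_finite_subset) (auto simp: better_def)

lemma rk_less: "a \<succ> b \<Longrightarrow> rk a < rk b"
  unfolding rk_def
  by (rule psubset_card_mono[OF finite_better]) (use better_trans better_irrefl in blast)

lemma rk_less_iff: "a \<in> E \<Longrightarrow> b \<in> E \<Longrightarrow> fst a = fst b \<Longrightarrow> rk a < rk b \<longleftrightarrow> a \<succ> b"
  using rk_less better_total by (metis less_asym less_irrefl)

lemma depth_le:
  assumes "X \<subseteq> E" "inj_on fst X"
  shows "depth X \<le> card E"
proof -
  let ?S = "\<lambda>x. insert x {e'. e' \<succ> x}"
  have "card (?S x) = Suc (rk x)" for x
    using finite_better better_irrefl unfolding rk_def by simp
  then have "depth X = (\<Sum>x \<in> X. card (?S x))" unfolding depth_def by simp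
  also have "\<dots> = card (\<Union>x \<in> X. ?S x)"
  proof (rule card_UN_disjoint[symmetric])
    show "finite X" using assms finite_E finite_subset by blast
    show "\<forall>x \<in> X. finite (?S x)" using finite_better by simp
    show "\<forall>x \<in> X. \<forall>y \<in> X. x \<noteq> y \<longrightarrow> ?S x \<inter> ?S y = {}"
    proof (intro ballI impI)
      fix x y assume xy: "x \<in> X" "y \<in> X" "x \<noteq> y"
      have "fst e = fst x" if "e \<in> ?S x" for e x using that unfolding better_def by blast
      moreover have "fst x \<noteq> fst y" using xy assms(2) by (meson inj_onD)
      ultimately show "?S x \<inter> ?S y = {}" by (metis disjoint_iff)
    qed
  qed
  also have "\<dots> \<le> card E"
    by (rule card_mono[OF finite_E]) (use assms(1) in \<open>auto simp: better_def\<close>)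
  finally show ?thesis .
qed

lemma rotation_bij:
  assumes "stable G X" "L \<in> rotations_at G X"
  shows "\<exists>h. bij_betw h (fst L) (snd L) \<and> (\<forall>a \<in> fst L. h a \<succ> a)"
proof -
  note r = rotationD[OF assms]
  obtain h where h: "\<And>a. a \<in> fst L \<Longrightarrow> h a \<in> snd L \<and> fst a = fst (h a)"
    using r(11) by metis
  have "inj_on h (fst L)" using h r(7) unfolding inj_on_def by metis
  moreover have "h ` fst L = snd L"
  proof (intro subset_antisym subsetI)
    fix b assume "b \<in> h ` fst L" then show "b \<in> snd L" using h by (metis imageE)
  next
    fix b assume b: "b \<in> snd L"
    then obtain a where a: "a \<in> fst L" "fst a = fst b" using r(10) by blast
    then have "h a = b" using h[OF a(1)] b r(1) stable_unique[OF assms(1)] by (metis subsetD)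
    then show "b \<in> h ` fst L" using a by blast
  qed
  ultimately show ?thesis using h r(12) unfolding bij_betw_def by metis
qed

lemma depth_apply_rotation:
  assumes "stable G X" "L \<in> rotations_at G X"
  shows "depth (apply_rotation L X) + (\<Sum>b \<in> snd L. Suc (rk b)) = depth X + (\<Sum>a \<in> fst L. Suc (rk a))"
    and "(\<Sum>b \<in> snd L. Suc (rk b)) + card (snd L) \<le> (\<Sum>a \<in> fst L. Suc (rk a))"
    and "depth X + card (snd L) \<le> depth (apply_rotation L X)"
    and "depth X < depth (apply_rotation L X)"
proof -
  note r = rotationD[OF assms]
  have finX: "finite X" using stableD(5) assms by blast
  have fin: "finite (fst L)" "finite (snd L)" using r(1,5) finX finite_E finite_subset by blast+
  have "depth (apply_rotation L X) = (\<Sum>x \<in> X - snd L. Suc (rk x)) + (\<Sum>a \<in> fst L. Suc (rk a))"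
    unfolding depth_def apply_rotation_def
  proof (rule sum.union_disjoint)
    show "finite (X - snd L)" "finite (fst L)" using finX fin by simp_all
    show "(X - snd L) \<inter> fst L = {}" using r(4) by (metis Diff_disjoint Int_Diff Int_commute empty_Diff)
  qed
  moreover have "depth X = (\<Sum>x \<in> X - snd L. Suc (rk x)) + (\<Sum>b \<in> snd L. Suc (rk b))"
    unfolding depth_def by (rule sum.subset_diff[OF r(1) finX])
  ultimately show 1: "depth (apply_rotation L X) + (\<Sum>b \<in> snd L. Suc (rk b))
      = depth X + (\<Sum>a \<in> fst L. Suc (rk a))" by simp
  obtain h where h: "bij_betw h (fst L) (snd L)" "\<forall>a \<in> fst L. h a \<succ> a"
    using rotation_bij[OF assms] by blast
  have "(\<Sum>b \<in> snd L. Suc (rk b)) + card (snd L) = (\<Sum>b \<in> snd L. Suc (Suc (rk b)))"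
    by (simp only: card_eq_sum sum.distrib[symmetric] add_Suc_right add_0_right One_nat_def)
  also have "\<dots> = (\<Sum>a \<in> fst L. Suc (Suc (rk (h a))))"
    by (rule sum.reindex_bij_betw[OF h(1), symmetric])
  also have "\<dots> \<le> (\<Sum>a \<in> fst L. Suc (rk a))"
    by (rule sum_mono) (use h(2) rk_less in \<open>simp add: Suc_leI\<close>)
  finally show 2: "(\<Sum>b \<in> snd L. Suc (rk b)) + card (snd L) \<le> (\<Sum>a \<in> fst L. Suc (rk a))" .
  show 3: "depth X + card (snd L) \<le> depth (apply_rotation L X)" using 1 2 by linarith
  have "0 < card (snd L)" using r(2) fin(2) card_gt_0_iff by blast
  then show "depth X < depth (apply_rotation L X)" using 3 by linarith
qed


section \<open>Routes\<close>

lemma route_append: "route G X (Ls @ Ks) Y \<longleftrightarrow> (\<exists>Z. route G X Ls Z \<and> route G Z Ks Y)"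
  by (induction Ls arbitrary: X) auto

lemma leF_trans_stable: "stable G X \<Longrightarrow> stable G Y \<Longrightarrow> stable G Z \<Longrightarrow> leF X Y \<Longrightarrow> leF Y Z \<Longrightarrow> leF X Z"
  using leF_trans stableD(1) by metis

lemma leF_antisym_stable: "stable G X \<Longrightarrow> stable G Y \<Longrightarrow> leF X Y \<Longrightarrow> leF Y X \<Longrightarrow> X = Y"
  using leF_antisym stableD(1) by metis

lemma route_stable: "stable G X \<Longrightarrow> route G X Ls Y \<Longrightarrow> stable G Y \<and> leF X Y \<and> depth X + length Ls \<le> depth Y"
proof (induction Ls arbitrary: X)
  case Nil then show ?case using leF_refl by simp
next
  case (Cons L Ls)
  then have L: "L \<in> rotations_at G X" and Ls: "route G (apply_rotation L X) Ls Y" by simp_all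
  note s = stable_apply_rotation[OF Cons.prems(1) L]
  show ?case using Cons.IH[OF s Ls] leF_trans_stable[OF Cons.prems(1) s] leF_apply_rotation[OF Cons.prems(1) L]
      depth_apply_rotation(4)[OF Cons.prems(1) L] by force
qed

text \<open>By \<open>advance\<close> the edges of \<open>X - Y\<close> are closed under displacement, so they contain a rotation, which can
be applied without leaving the matchings below \<open>Y\<close>.\<close>

lemma route_exists:
  assumes "stable G X" "stable G Y" "leF X Y"
  shows "\<exists>Ls. route G X Ls Y"
  using assms
proof (induction "card E - depth X" arbitrary: X rule: less_induct)
  case less
  show ?case
  proof (cases "X - Y = {}")
    case True
    have "Y \<subseteq> X"
    proof
      fix y assume y: "y \<in> Y"
      then have "fst y \<in> fst ` X" using leF_rural(1)[OF less.prems] by (metis image_eqI)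
      then obtain x where "x \<in> X" "fst x = fst y" by (metis imageE)
      then show "y \<in> X" using True y stable_unique[OF less.prems(2)] by (metis Diff_eq_empty_iff subsetD)
    qed
    then have "X = Y" using True by blast
    then have "route G X [] Y" by simp
    then show ?thesis ..
  next
    case False
    have "\<exists>L \<in> rotations_at G X. snd L \<subseteq> X - Y"
      by (rule closed_set_contains_rotation[OF less.prems(1) _ False])
        (use advance[OF less.prems] in blast)+
    then obtain L where L: "L \<in> rotations_at G X" "snd L \<subseteq> X - Y" by blast
    let ?X' = "apply_rotation L X"
    have s: "stable G ?X'" by (rule stable_apply_rotation[OF less.prems(1) L(1)])
    have le: "leF ?X' Y" using leF_apply_rotation_le[OF less.prems L(1)] L(2) by blast
    have "depth X < depth ?X'" by (rule depth_apply_rotation(4)[OF less.prems(1) L(1)])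
    moreover have "depth ?X' \<le> card E" using depth_le stableD(1,2)[OF s] by blast
    ultimately have "card E - depth ?X' < card E - depth X" by linarith
    then obtain Ls where "route G ?X' Ls Y" using less.hyps[OF _ s less.prems(2) le] by blast
    then have "route G X (L # Ls) Y" using L(1) by simp
    then show ?thesis ..
  qed
qed

lemma leF_depth_less: "stable G X \<Longrightarrow> stable G Y \<Longrightarrow> leF X Y \<Longrightarrow> X \<noteq> Y \<Longrightarrow> depth X < depth Y"
  using route_exists route_stable
  by (metis add_gr_0 le_eq_less_or_eq length_greater_0_conv less_add_same_cancel1 order_less_le_trans route.simps(1))

text \<open>The rotations on the routes to \<open>Y\<close>. The definition does not mention a particular route; the connection
is \<open>passed_route\<close> below.\<close>

definition passed :: "('w \<times> 'f) set \<Rightarrow> ('w, 'f) rotation set" where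
  "passed Y = {L. \<exists>X. stable G X \<and> L \<in> rotations_at G X \<and> leF (apply_rotation L X) Y}"

text \<open>After the rotation, the worker of a displaced edge has a worse edge, and from then on it can only
get worse ones.\<close>

lemma passed_disjoint:
  assumes "stable G Y" "L \<in> passed Y"
  shows "snd L \<inter> Y = {}"
proof (rule ccontr)
  obtain X where X: "stable G X" "L \<in> rotations_at G X" "leF (apply_rotation L X) Y"
    using assms(2) unfolding passed_def by blast
  let ?X' = "apply_rotation L X"
  note r = rotationD[OF X(1,2)]
  have s: "stable G ?X'" by (rule stable_apply_rotation[OF X(1,2)])
  assume "snd L \<inter> Y \<noteq> {}"
  then obtain b where b: "b \<in> snd L" "b \<in> Y" by blast
  then obtain a where a: "a \<in> fst L" "fst a = fst b" using r(10) by blast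
  have aX: "a \<in> ?X'" using a unfolding apply_rotation_def by blast
  have ba: "b \<succ> a" using r(12)[OF a(1) b(1) a(2)] .
  have "b \<notin> ?X'" using b r(1,4) unfolding apply_rotation_def by blast
  then obtain x where "x \<in> ?X'" "x \<succ> b" using leF_opposite[OF s assms(1) X(3) b(2)] by blast
  moreover then have "x = a" using stable_unique[OF s _ aX] a(2) unfolding better_def by metis
  ultimately show False using ba better_asym by blast
qed

lemma rotation_not_passed: "stable G Y \<Longrightarrow> L \<in> rotations_at G Y \<Longrightarrow> L \<notin> passed Y"
  using passed_disjoint rotationD(1,2) by (metis inf.absorb1)

lemma passed_mono: "stable G Y \<Longrightarrow> stable G Z \<Longrightarrow> leF Y Z \<Longrightarrow> passed Y \<subseteq> passed Z"
  unfolding passed_def using leF_trans_stable stable_apply_rotation by blast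

text \<open>Different rotations of \<open>X\<close> have no worker in common. So \<open>K\<close> leaves the displaced edges of \<open>L\<close> in place,
and the dichotomy yields that \<open>L\<close> is still available.\<close>

lemma rotation_diamond:
  assumes "stable G X" "L \<in> rotations_at G X" "K \<in> rotations_at G X" "L \<noteq> K"
  shows "L \<in> rotations_at G (apply_rotation K X)"
proof -
  have s: "stable G (apply_rotation K X)" by (rule stable_apply_rotation[OF assms(1,3)])
  obtain b where b: "b \<in> snd L" using rotationD(2)[OF assms(1,2)] by blast
  have "b \<notin> snd K" using rotations_meet[OF assms(1-3) b] assms(4) by blast
  then have "b \<in> apply_rotation K X"
    using b rotationD(1)[OF assms(1,2)] unfolding apply_rotation_def by blast
  then show ?thesis
    using rotation_dichotomy[OF assms(1) s leF_apply_rotation[OF assms(1,3)] assms(2)] b by blast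
qed

lemma route_subset_passed:
  assumes "stable G X" "route G X Ls Y"
  shows "set Ls \<subseteq> passed Y"
  using assms
proof (induction Ls arbitrary: X)
  case (Cons L Ls)
  then have L: "L \<in> rotations_at G X" and Ls: "route G (apply_rotation L X) Ls Y" by simp_all
  note s = stable_apply_rotation[OF Cons.prems(1) L]
  have Y: "stable G Y" "leF (apply_rotation L X) Y" using route_stable[OF s Ls] by simp_all
  have "L \<in> passed Y" using Cons.prems(1) L Y(2) unfolding passed_def by blast
  then show ?case using Cons.IH[OF s Ls] by simp
qed simp

text \<open>Walk along the route from \<open>Z\<close> and apply its rotations to \<open>X\<close>, too, whenever they are available there; by
the dichotomy the position on the route stays below this moving \<open>X\<close>. As long as \<open>L\<close> has not occurred,
it stays available at the moving \<open>X\<close>. Since the displaced edges of \<open>L\<close> are missing at the end, \<open>L\<close> occurs.\<close>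

lemma route_contains:
  assumes "stable G Z" "route G Z Ls Y" "stable G X" "L \<in> rotations_at G X" "leF Z X" "leF X Y"
    and "snd L \<inter> Y = {}"
  shows "L \<in> set Ls"
  using assms
proof (induction Ls arbitrary: X Z)
  case Nil
  then have "X = Z" using leF_antisym_stable by auto
  then show ?case using Nil rotationD(1,2)[OF Nil(3,4)] by auto
next
  case (Cons K Ks)
  let ?Z' = "apply_rotation K Z"
  have K: "K \<in> rotations_at G Z" and r: "route G ?Z' Ks Y" using Cons.prems(2) by simp_all
  have s: "stable G ?Z'" by (rule stable_apply_rotation[OF Cons.prems(1) K])
  have Y: "stable G Y" "leF ?Z' Y" using route_stable[OF s r] by simp_all
  have KY: "snd K \<inter> Y = {}"
    by (rule passed_disjoint[OF Y(1)]) (use Cons.prems(1) K Y(2) in \<open>unfold passed_def, blast\<close>)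
  from rotation_dichotomy[OF Cons.prems(1,3,5) K] show ?case
  proof
    assume "snd K \<inter> X = {} \<and> leF ?Z' X"
    then show ?thesis using Cons.IH[OF s r Cons.prems(3,4) _ Cons.prems(6,7)] by simp
  next
    assume "snd K \<subseteq> X \<and> K \<in> rotations_at G X"
    then have KX: "K \<in> rotations_at G X" ..
    show ?thesis
    proof (cases "K = L")
      case False
      let ?X' = "apply_rotation K X"
      have s': "stable G ?X'" by (rule stable_apply_rotation[OF Cons.prems(3) KX])
      have L': "L \<in> rotations_at G ?X'"
        using rotation_diamond[OF Cons.prems(3,4) KX] False by blast
      have XX': "leF X ?X'" by (rule leF_apply_rotation[OF Cons.prems(3) KX])
      have ZX': "leF Z ?X'" by (rule leF_trans_stable[OF Cons.prems(1,3) s' Cons.prems(5) XX'])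
      have KX': "snd K \<inter> ?X' = {}"
        using rotationD(1,4)[OF Cons.prems(3) KX] unfolding apply_rotation_def by blast
      have "leF ?Z' ?X'" by (rule leF_apply_rotation_le[OF Cons.prems(1) s' ZX' K KX'])
      moreover have "leF ?X' Y" by (rule leF_apply_rotation_le[OF Cons.prems(3) Y(1) Cons.prems(6) KX KY])
      ultimately show ?thesis using Cons.IH[OF s r s' L' _ _ Cons.prems(7)] by simp
    qed simp
  qed
qed

lemma route_distinct:
  assumes "stable G X" "route G X Ls Y"
  shows "distinct Ls"
  using assms
proof (induction Ls arbitrary: X)
  case (Cons L Ls)
  then have L: "L \<in> rotations_at G X" and Ls: "route G (apply_rotation L X) Ls Y" by simp_all
  note s = stable_apply_rotation[OF Cons.prems(1) L]
  have "L \<notin> set Ls"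
  proof
    assume "L \<in> set Ls"
    then obtain As Bs where "Ls = As @ L # Bs" by (meson split_list)
    then obtain Z where Z: "route G (apply_rotation L X) As Z" "L \<in> rotations_at G Z"
      using Ls by (auto simp: route_append)
    have sZ: "stable G Z" "leF (apply_rotation L X) Z" using route_stable[OF s Z(1)] by simp_all
    then have "L \<in> passed Z" using Cons.prems(1) L unfolding passed_def by blast
    then show False using rotation_not_passed[OF sZ(1) Z(2)] by blast
  qed
  then show ?case using Cons.IH[OF s Ls] by simp
qed simp


section \<open>The rotations that lead to a stable matching\<close>

lemma least_leF: "least_stable G X0 \<Longrightarrow> stable G Y \<Longrightarrow> leF X0 Y"
  unfolding least_stable_def using F_better_iff leF_refl by metis

lemma passed_route:
  assumes "least_stable G X0" "route G X0 Ls Y"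
  shows "set Ls = passed Y"
proof
  have s: "stable G X0" using assms(1) by (simp add: least_stable_def)
  have Y: "stable G Y" using route_stable[OF s assms(2)] by simp
  show "set Ls \<subseteq> passed Y" by (rule route_subset_passed[OF s assms(2)])
  show "passed Y \<subseteq> set Ls"
  proof
    fix L assume L: "L \<in> passed Y"
    then obtain X where X: "stable G X" "L \<in> rotations_at G X" "leF (apply_rotation L X) Y"
      unfolding passed_def by blast
    have "leF X Y"
      using leF_trans_stable[OF X(1) stable_apply_rotation[OF X(1,2)] Y leF_apply_rotation[OF X(1,2)] X(3)] .
    then show "L \<in> set Ls"
      using route_contains[OF s assms(2) X(1,2) least_leF[OF assms(1) X(1)]] passed_disjoint[OF Y L] by blast
  qed
qed

lemma passed_apply:
  assumes "least_stable G X0" "stable G X" "L \<in> rotations_at G X"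
  shows "passed (apply_rotation L X) = insert L (passed X)"
proof -
  have s: "stable G X0" using assms(1) by (simp add: least_stable_def)
  obtain Ls where Ls: "route G X0 Ls X" using route_exists[OF s assms(2) least_leF[OF assms(1,2)]] by blast
  then have "route G X0 (Ls @ [L]) (apply_rotation L X)" using assms(3) by (auto simp: route_append)
  from passed_route[OF assms(1) this] passed_route[OF assms(1) Ls] show ?thesis by simp
qed

lemma passed_least: "least_stable G X0 \<Longrightarrow> passed X0 = {}"
  using passed_route[of X0 "[]" X0] by simp

lemma route_leF:
  assumes "stable G X" "route G X Ls Y" "stable G Z" "leF X Z"
    and "\<And>X' L. stable G X' \<Longrightarrow> L \<in> rotations_at G X' \<Longrightarrow> L \<in> set Ls \<Longrightarrow> leF X' Z \<Longrightarrow> snd L \<inter> Z = {}"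
  shows "leF Y Z"
  using assms
proof (induction Ls arbitrary: X)
  case (Cons L Ls)
  then have L: "L \<in> rotations_at G X" and Ls: "route G (apply_rotation L X) Ls Y" by simp_all
  note s = stable_apply_rotation[OF Cons.prems(1) L]
  have "snd L \<inter> Z = {}" using Cons.prems(5)[OF Cons.prems(1) L _ Cons.prems(4)] by simp
  then have "leF (apply_rotation L X) Z"
    using leF_apply_rotation_le[OF Cons.prems(1,3,4) L] by blast
  then show ?case using Cons.IH[OF s Ls Cons.prems(3)] Cons.prems(5) by simp
qed simp

text \<open>All rotations on a route to \<open>Y\<close> are used up with respect to \<open>Z\<close>, so the route never leaves the matchings below \<open>Z\<close>.\<close>

lemma passed_leF:
  assumes "least_stable G X0" "stable G Y" "stable G Z" "passed Y \<subseteq> passed Z"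
  shows "leF Y Z"
proof -
  have s: "stable G X0" using assms(1) by (simp add: least_stable_def)
  obtain Ls where Ls: "route G X0 Ls Y" using route_exists[OF s assms(2) least_leF[OF assms(1,2)]] by blast
  show ?thesis
    by (rule route_leF[OF s Ls assms(3) least_leF[OF assms(1,3)]])
      (use passed_disjoint[OF assms(3)] assms(4) passed_route[OF assms(1) Ls] in blast)
qed

text \<open>No rotation on a route can be available at \<open>T\<close>, so each of them is used up with respect to \<open>T\<close>, and the
route stays below \<open>T\<close>.\<close>

lemma terminal_greatest:
  assumes "least_stable G X0" "stable G T" "rotations_at G T = {}"
  shows "greatest_stable G T"
proof -
  have s: "stable G X0" using assms(1) by (simp add: least_stable_def)
  have "leF Y T" if Y: "stable G Y" for Y
  proof -
    obtain Ls where Ls: "route G X0 Ls Y" using route_exists[OF s Y least_leF[OF assms(1) Y]] by blast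
    show ?thesis
      by (rule route_leF[OF s Ls assms(2) least_leF[OF assms(1,2)]])
        (use rotation_dichotomy[OF _ assms(2)] assms(3) in blast)
  qed
  then show ?thesis unfolding greatest_stable_def using F_better_iff assms(2) by metis
qed

lemma greatest_exists:
  assumes "least_stable G X0"
  shows "\<exists>T. greatest_stable G T"
proof -
  have s: "stable G X0" using assms(1) by (simp add: least_stable_def)
  have bound: "depth X \<le> card E" if "stable G X" for X using that depth_le stableD by blast
  obtain T where T: "stable G T" "\<And>X. stable G X \<Longrightarrow> depth X \<le> depth T"
    using Greatest_le_nat[of "\<lambda>d. \<exists>X. stable G X \<and> depth X = d" _ "card E"]
      GreatestI_nat[of "\<lambda>d. \<exists>X. stable G X \<and> depth X = d" "depth X0" "card E"] s bound
    by (metis (no_types, lifting))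
  have "rotations_at G T = {}"
  proof (rule ccontr)
    assume "rotations_at G T \<noteq> {}"
    then obtain L where L: "L \<in> rotations_at G T" by blast
    show False using depth_apply_rotation(4)[OF T(1) L] T(2)[OF stable_apply_rotation[OF T(1) L]] by simp
  qed
  then show ?thesis using terminal_greatest[OF assms T(1)] by blast
qed

lemma greatest_leF: "greatest_stable G T \<Longrightarrow> stable G Y \<Longrightarrow> leF Y T"
  unfolding greatest_stable_def using F_better_iff leF_refl by metis

lemma full_route_iff:
  assumes "least_stable G X0" "greatest_stable G T"
  shows "full_route G Ls \<longleftrightarrow> route G X0 Ls T"
proof -
  have "X = X0" if "least_stable G X" for X
    using that assms(1) least_leF leF_antisym_stable unfolding least_stable_def by metis
  moreover have "Y = T" if "greatest_stable G Y" for Y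
    using that assms(2) greatest_leF leF_antisym_stable unfolding greatest_stable_def by metis
  ultimately show ?thesis unfolding full_route_def using assms by metis
qed

lemma full_route_exists:
  assumes "least_stable G X0" "route G X0 Ls Y"
  shows "\<exists>Ks. full_route G (Ls @ Ks)"
proof -
  obtain T where T: "greatest_stable G T" using greatest_exists[OF assms(1)] by blast
  have s: "stable G X0" using assms(1) by (simp add: least_stable_def)
  have Y: "stable G Y" using route_stable[OF s assms(2)] by simp
  have sT: "stable G T" using T by (simp add: greatest_stable_def)
  obtain Ks where "route G Y Ks T" using route_exists[OF Y sT greatest_leF[OF T Y]] by blast
  then show ?thesis using full_route_iff[OF assms(1) T] assms(2) route_append by metis
qed

lemma rotations_eq_passed:
  assumes "least_stable G X0" "greatest_stable G T"
  shows "rotations G = passed T"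
proof -
  have s: "stable G X0" using assms(1) by (simp add: least_stable_def)
  have sT: "stable G T" using assms(2) by (simp add: greatest_stable_def)
  obtain Ls where Ls: "route G X0 Ls T" using route_exists[OF s sT least_leF[OF assms(1) sT]] by blast
  then show ?thesis unfolding rotations_def full_route_iff[OF assms] using passed_route[OF assms(1)] by blast
qed

lemma rotations_iff:
  assumes "least_stable G X0"
  shows "L \<in> rotations G \<longleftrightarrow> (\<exists>X. stable G X \<and> L \<in> rotations_at G X)"
proof -
  obtain T where T: "greatest_stable G T" using greatest_exists[OF assms(1)] by blast
  show ?thesis unfolding rotations_eq_passed[OF assms T] passed_def
    using greatest_leF[OF T] stable_apply_rotation by blast
qed

lemma full_route_split:
  assumes "least_stable G X0" "full_route G Ls"
  shows "set Ls = rotations G" "distinct Ls"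
    "Ls = As @ R # Bs \<Longrightarrow> \<exists>Y. route G X0 As Y \<and> stable G Y \<and> R \<in> rotations_at G Y"
proof -
  obtain T where T: "greatest_stable G T" using greatest_exists[OF assms(1)] by blast
  have s: "stable G X0" using assms(1) by (simp add: least_stable_def)
  have r: "route G X0 Ls T" using assms full_route_iff[OF assms(1) T] by simp
  show "set Ls = rotations G" using rotations_eq_passed[OF assms(1) T] passed_route[OF assms(1) r] by simp
  show "distinct Ls" by (rule route_distinct[OF s r])
  show "\<exists>Y. route G X0 As Y \<and> stable G Y \<and> R \<in> rotations_at G Y" if "Ls = As @ R # Bs"
    using r that route_stable[OF s, of As] by (auto simp: route_append)
qed

text \<open>A full route can be arranged to pass through any stable matching, and each rotation occurs once on it.
So \<open>Q\<close> precedes \<open>R\<close> on all full routes if \<open>Q\<close> is passed wherever \<open>R\<close> is available.\<close>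

lemma rot_less_iff:
  assumes "least_stable G X0"
  shows "rot_less G Q R \<longleftrightarrow> Q \<in> rotations G \<and> R \<in> rotations G \<and>
           (\<forall>Y. stable G Y \<longrightarrow> R \<in> rotations_at G Y \<longrightarrow> Q \<in> passed Y)"
proof
  have s: "stable G X0" using assms(1) by (simp add: least_stable_def)
  assume less: "rot_less G Q R"
  have "Q \<in> passed Y" if Y: "stable G Y" "R \<in> rotations_at G Y" for Y
  proof -
    obtain Ls where Ls: "route G X0 Ls Y" using route_exists[OF s Y(1) least_leF[OF assms Y(1)]] by blast
    then have "route G X0 (Ls @ [R]) (apply_rotation R Y)" using Y(2) by (auto simp: route_append)
    then obtain Ks where full: "full_route G ((Ls @ [R]) @ Ks)" using full_route_exists[OF assms] by blast
    let ?L = "(Ls @ [R]) @ Ks"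
    obtain i j where ij: "i < j" "j < length ?L" "?L ! i = Q" "?L ! j = R"
      using less full unfolding rot_less_def by blast
    have "distinct ?L" by (rule full_route_split(2)[OF assms full])
    then have "j = length Ls"
      using ij(2,4) nth_eq_iff_index_eq[of ?L j "length Ls"] by (simp add: nth_append)
    then have "i < length Ls" "Ls ! i = Q" using ij by (simp_all add: nth_append)
    then have "Q \<in> set Ls" by (metis nth_mem)
    then show ?thesis using passed_route[OF assms Ls] by simp
  qed
  then show "Q \<in> rotations G \<and> R \<in> rotations G \<and>
           (\<forall>Y. stable G Y \<longrightarrow> R \<in> rotations_at G Y \<longrightarrow> Q \<in> passed Y)"
    using less unfolding rot_less_def by blast
next
  assume R: "Q \<in> rotations G \<and> R \<in> rotations G \<and>
           (\<forall>Y. stable G Y \<longrightarrow> R \<in> rotations_at G Y \<longrightarrow> Q \<in> passed Y)"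
  have "\<exists>i j. i < j \<and> j < length Ls \<and> Ls ! i = Q \<and> Ls ! j = R" if full: "full_route G Ls" for Ls
  proof -
    have "R \<in> set Ls" using R full_route_split(1)[OF assms full] by simp
    then obtain As Bs where AB: "Ls = As @ R # Bs" by (meson split_list)
    then obtain Y where Y: "route G X0 As Y" "stable G Y" "R \<in> rotations_at G Y"
      using full_route_split(3)[OF assms full] by blast
    have "Q \<in> set As" using R Y passed_route[OF assms Y(1)] by blast
    then obtain i where "i < length As" "As ! i = Q" by (metis in_set_conv_nth)
    then show ?thesis using AB by (intro exI[of _ i] exI[of _ "length As"]) (simp add: nth_append)
  qed
  then show "rot_less G Q R" using R unfolding rot_less_def by blast
qed

section \<open>The partial order\<close>

text \<open>Take a deepest common lower bound \<open>M\<close>. The edges of \<open>M\<close> which are missing both in \<open>Z\<close> and in \<open>Z'\<close> are closed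
under displacement, hence there are none: otherwise a rotation could be applied to \<open>M\<close>. So every
displacement from a worker of \<open>R\<close> at \<open>M\<close> persists at \<open>Z\<close> or at \<open>Z'\<close>, and stays within the displaced edges of \<open>R\<close>.
These contain a rotation of \<open>M\<close>, which persists at \<open>Z\<close>, where it cannot differ from \<open>R\<close>.\<close>

lemma rotation_common_lower:
  assumes "least_stable G X0" "stable G Z" "stable G Z'"
    and "R \<in> rotations_at G Z" "R \<in> rotations_at G Z'"
  shows "\<exists>M. stable G M \<and> leF M Z \<and> leF M Z' \<and> R \<in> rotations_at G M"
proof -
  have s0: "stable G X0" using assms(1) by (simp add: least_stable_def)
  let ?P = "\<lambda>M. stable G M \<and> leF M Z \<and> leF M Z'"
  have P0: "?P X0" using s0 least_leF[OF assms(1)] assms(2,3) by blast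
  have bound: "depth X \<le> card E" if "stable G X" for X using that depth_le stableD by blast
  obtain M where M: "?P M" "\<And>X. ?P X \<Longrightarrow> depth X \<le> depth M"
    using Greatest_le_nat[of "\<lambda>d. \<exists>X. ?P X \<and> depth X = d" _ "card E"]
      GreatestI_nat[of "\<lambda>d. \<exists>X. ?P X \<and> depth X = d" "depth X0" "card E"] P0 bound
    by (metis (no_types, lifting))
  have sM: "stable G M" and MZ: "leF M Z" and MZ': "leF M Z'" using M(1) by blast+
  have cover: "x \<in> Z \<or> x \<in> Z'" if "x \<in> M" for x
  proof (rule ccontr)
    let ?U = "{x \<in> M. x \<notin> Z \<and> x \<notin> Z'}"
    assume "\<not> (x \<in> Z \<or> x \<in> Z')"
    then have ne: "?U \<noteq> {}" using that by blast
    have "\<exists>L \<in> rotations_at G M. snd L \<subseteq> ?U"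
    proof (rule closed_set_contains_rotation[OF sM _ ne])
      fix u assume u: "u \<in> ?U"
      then obtain a b where ab: "fst a = fst u" "tandem G M a b" "b \<in> M" "b \<notin> Z"
        using advance[OF sM assms(2) MZ] by blast
      obtain a' b' where ab': "fst a' = fst u" "tandem G M a' b'" "b' \<notin> Z'"
        using advance[OF sM assms(3) MZ'] u by blast
      have "b' = b" using tandem_unique[OF sM ab'(2) ab(2)] ab ab' by simp
      then show "\<exists>a b. fst a = fst u \<and> tandem G M a b \<and> b \<in> ?U" using ab ab' by blast
    qed blast
    then obtain L where L: "L \<in> rotations_at G M" "snd L \<subseteq> ?U" by blast
    let ?M' = "apply_rotation L M"
    have "leF ?M' Z" using leF_apply_rotation_le[OF sM assms(2) MZ L(1)] L(2) by blast
    moreover have "leF ?M' Z'" using leF_apply_rotation_le[OF sM assms(3) MZ' L(1)] L(2) by blast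
    ultimately show False
      using M(2) stable_apply_rotation[OF sM L(1)] depth_apply_rotation(4)[OF sM L(1)] by (meson not_less)
  qed
  note r = rotationD[OF assms(2,4)] and r' = rotationD[OF assms(3,5)]
  have inM: "x \<in> M" if x: "x \<in> snd R" for x
  proof -
    have "x \<in> Z" "x \<in> Z'" using x r(1) r'(1) by blast+
    then have "fst x \<in> fst ` M" using leF_rural(1)[OF sM assms(2) MZ] by (metis image_eqI)
    then obtain m where m: "m \<in> M" "fst m = fst x" by (metis imageE)
    have "m = x"
      using cover[OF m(1)] m(2) stable_unique[OF assms(2) _ \<open>x \<in> Z\<close>] stable_unique[OF assms(3) _ \<open>x \<in> Z'\<close>]
      by metis
    then show ?thesis using m by simp
  qed
  have next_in: "b \<in> snd R"
    if ab: "stable G Y" "R \<in> rotations_at G Y" "leF M Y" "x \<in> snd R" "fst a = fst x" "tandem G M a b" "b \<in> Y"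
    for Y x a b
  proof -
    note rY = rotationD[OF ab(1,2)]
    have xY: "x \<in> Y" using rY(1) ab(4) by blast
    have t: "tandem G Y a b"
      using tandem_persists[OF sM ab(1,3,6,7) inM[OF ab(4)] xY] ab(5) by simp
    obtain a2 where a2: "a2 \<in> fst R" "fst a2 = fst x" using rY(10)[OF ab(4)] by blast
    then obtain b2 where "b2 \<in> snd R" "tandem G Y a2 b2" using rY(8) by blast
    then show ?thesis using tandem_unique[OF ab(1) t] ab(5) a2(2) by metis
  qed
  have "\<exists>L \<in> rotations_at G M. snd L \<subseteq> snd R"
  proof (rule closed_set_contains_rotation[OF sM _ r(2)])
    show "snd R \<subseteq> M" using inM by blast
    fix x assume x: "x \<in> snd R"
    let ?Z1 = "apply_rotation R Z"
    have s1: "stable G ?Z1" by (rule stable_apply_rotation[OF assms(2,4)])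
    have M1: "leF M ?Z1" using leF_trans_stable[OF sM assms(2) s1 MZ leF_apply_rotation[OF assms(2,4)]] .
    have "x \<notin> ?Z1" using x r(1,4) unfolding apply_rotation_def by blast
    then obtain a b where ab: "fst a = fst x" "tandem G M a b" "b \<in> M"
      using advance[OF sM s1 M1 inM[OF x]] by blast
    have "b \<in> snd R"
      using cover[OF ab(3)] next_in[OF assms(2,4) MZ x ab(1,2)] next_in[OF assms(3,5) MZ' x ab(1,2)] by blast
    then show "\<exists>a b. fst a = fst x \<and> tandem G M a b \<and> b \<in> snd R" using ab by blast
  qed
  then obtain L where L: "L \<in> rotations_at G M" "snd L \<subseteq> snd R" by blast
  obtain l where l: "l \<in> snd L" using rotationD(2)[OF sM L(1)] by blast
  have "L \<in> rotations_at G Z"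
    using rotation_dichotomy[OF sM assms(2) MZ L(1)] l L(2) r(1) by blast
  then have "L = R" using rotations_meet[OF assms(2) _ assms(4) l, of l] l L(2) by blast
  then show ?thesis using L(1) M(1) by blast
qed

text \<open>A rotation is only a pair of sets of edges. Which edge is displaced by which new edge could a priori
depend on the matching; it does not, because both tandems come from a common lower bound.\<close>

lemma rotation_pairing:
  assumes "least_stable G X0" "stable G Z" "stable G Z'"
    and "R \<in> rotations_at G Z" "R \<in> rotations_at G Z'" "tandem G Z a b" "a \<in> fst R"
  shows "tandem G Z' a b"
proof -
  obtain M where M: "stable G M" "leF M Z" "leF M Z'" "R \<in> rotations_at G M"
    using rotation_common_lower[OF assms(1-5)] by blast
  note r = rotationD[OF M(1,4)]
  obtain b' where b': "b' \<in> snd R" "tandem G M a b'" using r(8)[OF assms(7)] by blast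
  obtain x where x: "x \<in> snd R" "fst x = fst a" using r(11)[OF assms(7)] by metis
  have RZ: "snd R \<subseteq> Z" "snd R \<subseteq> Z'" using rotationD(1) assms(2-5) by blast+
  have "tandem G Z a b'"
    using tandem_persists[OF M(1) assms(2) M(2) b'(2)] b'(1) x r(1) RZ by blast
  then have "b' = b" using tandem_unique[OF assms(2) _ assms(6)] by blast
  then show ?thesis
    using tandem_persists[OF M(1) assms(3) M(3) b'(2)] b'(1) x r(1) RZ by blast
qed

text \<open>A matching of least depth among those where \<open>R\<close> is available coincides with its lower bounds of this
kind, so it is below all the others.\<close>

lemma least_state:
  assumes "least_stable G X0" "R \<in> rotations G"
  shows "\<exists>Z. stable G Z \<and> R \<in> rotations_at G Z \<and> passed Z = {Q. rot_less G Q R} \<and>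
           (\<forall>Y. stable G Y \<longrightarrow> R \<in> rotations_at G Y \<longrightarrow> leF Z Y)"
proof -
  let ?P = "\<lambda>Z. stable G Z \<and> R \<in> rotations_at G Z"
  obtain Z0 where "?P Z0" using assms rotations_iff by blast
  then obtain Z where Z: "?P Z" "\<And>Y. ?P Y \<Longrightarrow> depth Z \<le> depth Y"
    using ex_has_least_nat[of ?P Z0 depth] by blast
  have low: "leF Z Y" if Y: "stable G Y" "R \<in> rotations_at G Y" for Y
  proof -
    obtain M where M: "stable G M" "leF M Z" "leF M Y" "R \<in> rotations_at G M"
      using rotation_common_lower[OF assms(1) _ Y(1) _ Y(2)] Z(1) by blast
    have "depth Z \<le> depth M" using Z(2) M by blast
    then have "M = Z" using leF_depth_less[OF M(1) _ M(2)] Z(1) by (meson not_less)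
    then show ?thesis using M by simp
  qed
  have "passed Z = {Q. rot_less G Q R}"
  proof (intro subset_antisym subsetI)
    fix Q assume Q: "Q \<in> passed Z"
    then have "Q \<in> rotations G" unfolding passed_def rotations_iff[OF assms(1)] by blast
    moreover have "Q \<in> passed Y" if "stable G Y" "R \<in> rotations_at G Y" for Y
      using passed_mono[OF _ that(1) low[OF that]] Z(1) Q by blast
    ultimately show "Q \<in> {Q. rot_less G Q R}" using rot_less_iff[OF assms(1)] assms(2) by blast
  next
    fix Q assume "Q \<in> {Q. rot_less G Q R}"
    then show "Q \<in> passed Z" using rot_less_iff[OF assms(1)] Z(1) by blast
  qed
  then show ?thesis using Z(1) low by blast
qed

text \<open>If all predecessors of \<open>R\<close> have been passed, then \<open>Y\<close> lies above the least stable matching where \<open>R\<close>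
is available, and the dichotomy applies.\<close>

lemma rotation_available_iff:
  assumes "least_stable G X0" "stable G Y" "R \<in> rotations G"
  shows "R \<in> rotations_at G Y \<longleftrightarrow> R \<notin> passed Y \<and> (\<forall>Q. rot_less G Q R \<longrightarrow> Q \<in> passed Y)"
proof
  assume "R \<in> rotations_at G Y"
  then show "R \<notin> passed Y \<and> (\<forall>Q. rot_less G Q R \<longrightarrow> Q \<in> passed Y)"
    using rotation_not_passed[OF assms(2)] rot_less_iff[OF assms(1)] assms(2) by blast
next
  assume R: "R \<notin> passed Y \<and> (\<forall>Q. rot_less G Q R \<longrightarrow> Q \<in> passed Y)"
  obtain Z where Z: "stable G Z" "R \<in> rotations_at G Z" "passed Z = {Q. rot_less G Q R}"
    using least_state[OF assms(1,3)] by blast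
  have "passed Z \<subseteq> passed Y" using Z(3) R by blast
  then have "leF Z Y" using passed_leF[OF assms(1) Z(1) assms(2)] by blast
  then show "R \<in> rotations_at G Y"
    using rotation_dichotomy[OF Z(1) assms(2) _ Z(2)] R Z(1,2) unfolding passed_def by blast
qed

lemma rot_less_irrefl: "least_stable G X0 \<Longrightarrow> \<not> rot_less G R R"
  using rot_less_iff rotations_iff rotation_not_passed by metis

lemma rot_less_trans:
  assumes "least_stable G X0" "rot_less G P Q" "rot_less G Q R"
  shows "rot_less G P R"
proof -
  have Q: "Q \<in> rotations G" using assms(2) unfolding rot_less_def by blast
  obtain Z where Z: "stable G Z" "Q \<in> rotations_at G Z" "passed Z = {P. rot_less G P Q}"
    "\<And>Y. stable G Y \<Longrightarrow> Q \<in> rotations_at G Y \<Longrightarrow> leF Z Y" using least_state[OF assms(1) Q] by blast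
  have "P \<in> passed Y" if Y: "stable G Y" "R \<in> rotations_at G Y" for Y
  proof -
    have "Q \<in> passed Y" using assms(3) Y rot_less_iff[OF assms(1)] by blast
    then obtain X where X: "stable G X" "Q \<in> rotations_at G X" "leF (apply_rotation Q X) Y"
      unfolding passed_def by blast
    have "leF X Y"
      using leF_trans_stable[OF X(1) stable_apply_rotation[OF X(1,2)] Y(1) leF_apply_rotation[OF X(1,2)] X(3)] .
    then have "leF Z Y" using leF_trans_stable[OF Z(1) X(1) Y(1) Z(4)[OF X(1,2)]] by blast
    then show ?thesis using passed_mono[OF Z(1) Y(1)] Z(3) assms(2) by blast
  qed
  then show ?thesis using rot_less_iff[OF assms(1)] assms(2,3) by blast
qed

lemma finite_rotations: "least_stable G X0 \<Longrightarrow> finite (rotations G)"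
  using full_route_exists[of X0 "[]" X0] full_route_split(1) by (metis List.finite_set route.simps(1))

text \<open>A rotation which is not passed is a successor of \<open>R\<close>, and its predecessors are all passed if and only if none
of them is a successor of \<open>R\<close>, too.\<close>

lemma available_iff_covers:
  assumes "least_stable G X0" "stable G Y" "R \<in> rotations G" "R' \<in> rotations G"
    and "passed Y = {Q \<in> rotations G. \<not> rot_less G R Q}"
  shows "R' \<in> rotations_at G Y \<longleftrightarrow> rot_covers G R R'"
proof -
  have mem: "P \<in> rotations G" if "rot_less G P Q" for P Q using that unfolding rot_less_def by blast
  have "R' \<in> rotations_at G Y \<longleftrightarrow> rot_less G R R' \<and> (\<forall>Q. rot_less G Q R' \<longrightarrow> \<not> rot_less G R Q)"
    unfolding rotation_available_iff[OF assms(1,2,4)] assms(5) using assms(4) mem by blast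
  then show ?thesis unfolding rot_covers_def by blast
qed

text \<open>By induction on the number of rotations between \<open>R\<close> and \<open>R'\<close>.\<close>

lemma rot_less_iff_covers_trancl:
  assumes "least_stable G X0"
  shows "rot_less G R R' \<longleftrightarrow> (R, R') \<in> {(P, Q). rot_covers G P Q}\<^sup>+"
proof
  let ?H = "{(P, Q). rot_covers G P Q}"
  assume "rot_less G R R'"
  then show "(R, R') \<in> ?H\<^sup>+"
  proof (induction "card {Q. rot_less G R Q \<and> rot_less G Q R'}" arbitrary: R R' rule: less_induct)
    case less
    show ?case
    proof (cases "rot_covers G R R'")
      case True then show ?thesis by (simp add: r_into_trancl)
    next
      case False
      then obtain Q where Q: "rot_less G R Q" "rot_less G Q R'"
        using less.prems unfolding rot_covers_def by blast
      let ?I = "{Q. rot_less G R Q \<and> rot_less G Q R'}"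
      have fin: "finite ?I"
        by (rule finite_subset[OF _ finite_rotations[OF assms]]) (simp add: rot_less_def Collect_mono subset_eq)
      have "{P. rot_less G R P \<and> rot_less G P Q} \<subset> ?I"
        using Q rot_less_trans[OF assms] rot_less_irrefl[OF assms] by blast
      then have 1: "(R, Q) \<in> ?H\<^sup>+" using less.hyps[OF psubset_card_mono[OF fin] Q(1)] by blast
      have "{P. rot_less G Q P \<and> rot_less G P R'} \<subset> ?I"
        using Q rot_less_trans[OF assms] rot_less_irrefl[OF assms] by blast
      then have "(Q, R') \<in> ?H\<^sup>+" using less.hyps[OF psubset_card_mono[OF fin] Q(2)] by blast
      with 1 show ?thesis by (rule trancl_trans)
    qed
  qed
next
  assume "(R, R') \<in> {(P, Q). rot_covers G P Q}\<^sup>+"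
  then show "rot_less G R R'"
  proof (induction rule: trancl_induct)
    case (base y) then show ?case by (simp add: rot_covers_def)
  next
    case (step y z)
    then have "rot_less G y z" by (simp add: rot_covers_def)
    then show ?case using rot_less_trans[OF assms] step.IH by blast
  qed
qed


section \<open>Proposals of the workers\<close>

text \<open>\<open>P\<close> is the set of edges proposed so far and \<open>X\<close> the set of those which the firms keep. Every worker
proposes its edges in the order of its preferences, the next one only after the previous one has been
rejected; rejected edges belong to no stable matching.\<close>

definition proposal_state :: "('w \<times> 'f) set \<Rightarrow> ('w \<times> 'f) set \<Rightarrow> bool" where
  "proposal_state P X \<longleftrightarrow> X \<subseteq> P \<and> P \<subseteq> E \<and> (\<forall>f \<in> Fpart G. C f (at_F f P) = at_F f X) \<and>
     (\<forall>p \<in> P. \<forall>e. e \<succ> p \<longrightarrow> e \<in> P \<and> e \<notin> X) \<and> (\<forall>Y. stable G Y \<longrightarrow> (P - X) \<inter> Y = {})"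

text \<open>If no edge of the stable matching \<open>Y\<close> is better than a proposed one, then outside \<open>Y\<close> no proposed edge
can be wanted at \<open>Y\<close>, since it would block.\<close>

lemma proposal_no_demand:
  assumes "stable G Y" "P \<subseteq> E" "f \<in> Fpart G" "\<And>p e. p \<in> P \<Longrightarrow> e \<succ> p \<Longrightarrow> e \<notin> Y"
  shows "C f (at_F f Y \<union> at_F f P) = at_F f Y"
proof (rule choice_refuse_all[OF assms(3) _ _ stableD(3)[OF assms(1,3)]])
  show "at_F f Y \<subseteq> at_F f E" "at_F f P \<subseteq> at_F f E"
    using at_F_mono[OF stableD(1)[OF assms(1)]] at_F_mono[OF assms(2)] by simp_all
  fix a assume a: "a \<in> at_F f P" "a \<notin> at_F f Y"
  then have aP: "a \<in> P" "snd a = f" "a \<notin> Y" by simp_all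
  show "a \<notin> C f (insert a (at_F f Y))"
  proof
    assume "a \<in> C f (insert a (at_F f Y))"
    then obtain y where "y \<in> Y" "y \<succ> a" using stableD(4)[OF assms(1) _ aP(3)] aP assms(2) by blast
    then show False using assms(4)[OF aP(1)] by blast
  qed
qed

text \<open>Suppose that an edge \<open>b\<close> of a stable matching \<open>Y\<close> is rejected now. Offered \<open>Y\<close> and all proposals, its firm
chooses its edges in \<open>Y\<close>, including \<open>b\<close>; by substitutability it then chooses \<open>b\<close> from the proposals alone.\<close>

lemma proposal_step:
  assumes "proposal_state P X" "e \<in> E" "e \<notin> P" "\<And>e'. e' \<succ> e \<Longrightarrow> e' \<in> P \<and> e' \<notin> X"
    and "X' = (X - at_F (snd e) X) \<union> grow X e"
  shows "proposal_state (insert e P) X'"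
proof -
  let ?f = "snd e" and ?P = "insert e P"
  note p = assms(1)[unfolded proposal_state_def]
  have X: "X \<subseteq> P" "P \<subseteq> E" and f: "?f \<in> Fpart G" using p snd_in_F[OF assms(2)] by blast+
  have XE: "X \<subseteq> E" using X by blast
  have P: "?P \<subseteq> E" using X assms(2) by blast
  have ch: "C ?f (at_F ?f ?P) = grow X e"
  proof -
    have "at_F ?f ?P = at_F ?f P \<union> {e}" by (auto simp: at_F_def)
    moreover have "C ?f (at_F ?f P \<union> {e}) = C ?f (C ?f (at_F ?f P) \<union> {e})"
      using choice_path_independent[OF f at_F_mono[OF X(2)], of "{e}"] assms(2) by simp
    ultimately show ?thesis using p f by simp
  qed
  have sub: "grow X e \<subseteq> insert e (at_F ?f X)"
    using choice_sub[OF f insert_at_F_sub[OF XE assms(2)]] .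
  have X'sub: "X' \<subseteq> insert e X" using sub assms(5) by auto
  have atX': "at_F f X' = (if f = ?f then grow X e else at_F f X)" for f
    using sub unfolding assms(5) at_F_def by auto
  have eX: "e \<notin> X" using assms(3) X by blast
  have up: "e' \<in> P \<and> e' \<notin> X" if "q \<in> ?P" "e' \<succ> q" for q e'
    using that p assms(4) by (metis insertE)
  have C': "C f (at_F f ?P) = at_F f X'" if "f \<in> Fpart G" for f
  proof (cases "f = ?f")
    case True then show ?thesis using ch atX' by simp
  next
    case False
    then have "at_F f ?P = at_F f P" by (auto simp: at_F_def)
    then show ?thesis using False p that atX' by simp
  qed
  have up': "e' \<in> ?P \<and> e' \<notin> X'" if "q \<in> ?P" "e' \<succ> q" for q e'
    using up[OF that] X'sub assms(3) by blast
  have opt: "(?P - X') \<inter> Y = {}" if Y: "stable G Y" for Y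
  proof (rule ccontr)
    assume "(?P - X') \<inter> Y \<noteq> {}"
    then obtain b where b: "b \<in> ?P" "b \<notin> X'" "b \<in> Y" by blast
    have fb: "snd b \<in> Fpart G" using b(1) P snd_in_F by blast
    have dis: "(P - X) \<inter> Y = {}" using p Y by blast
    have nd: "C (snd b) (at_F (snd b) Y \<union> at_F (snd b) ?P) = at_F (snd b) Y"
      by (rule proposal_no_demand[OF Y P fb]) (use up dis in blast)
    have "b \<in> C (snd b) (at_F (snd b) ?P)"
    proof (rule choice_substitutable[OF fb, of "at_F (snd b) Y \<union> at_F (snd b) ?P"])
      show "at_F (snd b) Y \<union> at_F (snd b) ?P \<subseteq> at_F (snd b) E"
        using at_F_mono[OF P] at_F_mono[OF stableD(1)[OF Y]] by (metis Un_least)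
    qed (use nd b in auto)
    then show False using C'[OF fb] b(2) by simp
  qed
  show ?thesis unfolding proposal_state_def using X'sub X(1) P C' up' opt by blast
qed

lemma proposal_end:
  assumes "proposal_state P X" "\<And>e. e \<in> E \<Longrightarrow> e \<notin> P \<Longrightarrow> \<exists>x \<in> X. x \<succ> e"
  shows "least_stable G X"
proof -
  note p = assms(1)[unfolded proposal_state_def]
  have X: "X \<subseteq> P" "P \<subseteq> E" using p by blast+
  have XE: "X \<subseteq> E" using X by blast
  have inj: "inj_on fst X"
  proof (rule inj_onI, rule ccontr)
    fix x y assume xy: "x \<in> X" "y \<in> X" "fst x = fst y" "x \<noteq> y"
    then have "x \<succ> y \<or> y \<succ> x" using better_total XE by blast
    then show False using p xy X(1) by blast
  qed
  have s: "stable G X" unfolding stable_iff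
  proof (intro conjI ballI impI)
    show "X \<subseteq> E" "inj_on fst X" by (rule XE, rule inj)
    show ac: "C f (at_F f X) = at_F f X" if "f \<in> Fpart G" for f
      using choice_idem[OF that at_F_mono[OF X(2)]] p that by metis
    fix e assume e: "e \<in> E" "e \<notin> X" "e \<in> grow X e"
    show "\<exists>x \<in> X. x \<succ> e"
    proof (cases "e \<in> P")
      case True
      have f: "snd e \<in> Fpart G" using snd_in_F e by blast
      have "insert e (at_F (snd e) X) \<subseteq> at_F (snd e) P" using True X by auto
      then have "grow X e = at_F (snd e) X"
        using choice_consistent[OF f at_F_mono[OF X(2)], of "insert e (at_F (snd e) X)"] p f
        by (metis subset_insertI)
      then show ?thesis using e by simp
    qed (use assms(2) e in blast)
  qed
  have "leF X Y" if Y: "stable G Y" for Y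
    unfolding leF_def
  proof
    fix f assume f: "f \<in> Fpart G"
    have dis: "(P - X) \<inter> Y = {}" using p Y by blast
    have nd: "C f (at_F f Y \<union> at_F f P) = at_F f Y"
      by (rule proposal_no_demand[OF Y X(2) f]) (use p dis in blast)
    have "at_F f Y \<union> at_F f P \<subseteq> at_F f E"
      using at_F_mono[OF X(2)] at_F_mono[OF stableD(1)[OF Y]] by (metis Un_least)
    moreover have "at_F f X \<union> at_F f Y \<subseteq> at_F f Y \<union> at_F f P" using at_F_mono[OF X(1)] by blast
    ultimately show "C f (at_F f X \<union> at_F f Y) = at_F f Y"
      using choice_consistent[OF f] nd by (metis Un_upper2)
  qed
  then show ?thesis unfolding least_stable_def using s F_better_iff by metis
qed

text \<open>As for stable matchings, a new proposal displaces at most one edge, possibly itself.\<close>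

lemma proposal_displaces:
  assumes "proposal_state P X" "e \<in> E" "e \<notin> X" "r \<in> insert e (at_F (snd e) X)" "r \<notin> grow X e"
  shows "grow X e = insert e (at_F (snd e) X) - {r}"
proof -
  let ?f = "snd e"
  note p = assms(1)[unfolded proposal_state_def]
  have f: "?f \<in> Fpart G" using assms snd_in_F by blast
  have P: "P \<subseteq> E" and X: "X \<subseteq> E" using p by blast+
  note sub = insert_at_F_sub[OF X assms(2)]
  have fin: "finite (at_F ?f X)" using X finite_at_F by blast
  have idem: "C ?f (at_F ?f X) = at_F ?f X" using choice_idem[OF f at_F_mono[OF P]] p f by metis
  have "card (C ?f (at_F ?f X)) \<le> card (grow X e)"
    by (rule choice_card_mono[OF f sub]) blast
  then have c: "card (at_F ?f X) \<le> card (grow X e)" using idem by simp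
  have s: "grow X e \<subseteq> insert e (at_F ?f X) - {r}" using choice_sub[OF f sub] assms(5) by blast
  have "card (insert e (at_F ?f X)) = Suc (card (at_F ?f X))" using fin assms(3) by simp
  then have "card (insert e (at_F ?f X) - {r}) = card (at_F ?f X)"
    using card_Diff_singleton[OF assms(4)] by simp
  then show ?thesis using card_seteq[OF _ s] c fin by simp
qed


section \<open>Positions in the preference lists\<close>

text \<open>The edges better than the next one are \<open>e\<close> and those better than \<open>e\<close>; so the ranks of a worker
have no gaps, and links between consecutive ranks lead through the whole list.\<close>

lemma next_exists:
  assumes "e \<succ> d"
  shows "\<exists>c. e \<succ> c \<and> rk c = Suc (rk e)"
proof -
  obtain c where c: "e \<succ> c" "\<And>c'. e \<succ> c' \<Longrightarrow> rk c \<le> rk c'"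
    using ex_has_least_nat[of "\<lambda>c. e \<succ> c" d rk] assms by blast
  have "{x. x \<succ> c} = insert e {x. x \<succ> e}"
  proof (intro subset_antisym subsetI)
    fix x assume "x \<in> {x. x \<succ> c}"
    then have x: "x \<succ> c" by simp
    have "\<not> e \<succ> x" using c(2)[of x] rk_less[OF x] by linarith
    then have "x = e \<or> x \<succ> e" using better_total[of x e] x c(1) unfolding better_def by metis
    then show "x \<in> insert e {x. x \<succ> e}" by simp
  next
    fix x assume "x \<in> insert e {x. x \<succ> e}"
    then show "x \<in> {x. x \<succ> c}" using c(1) better_trans by (metis insertE mem_Collect_eq)
  qed
  then have "rk c = Suc (rk e)"
    unfolding rk_def using finite_better better_irrefl by simp
  then show ?thesis using c(1) by blast
qed

lemma next_le: "e \<succ> c \<Longrightarrow> rk c = Suc (rk e) \<Longrightarrow> e \<succ> d \<Longrightarrow> c = d \<or> c \<succ> d"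
  using better_total[of c d] rk_less[of e d] rk_less[of d c] unfolding better_def
  by (metis less_Suc_eq not_less_eq not_less_iff_gr_or_eq)

lemma rank_zero_exists:
  assumes "e \<in> E"
  shows "\<exists>c \<in> E. fst c = fst e \<and> rk c = 0"
proof -
  obtain c where c: "c \<in> E \<and> fst c = fst e" "\<And>c'. c' \<in> E \<and> fst c' = fst e \<Longrightarrow> rk c \<le> rk c'"
    using ex_has_least_nat[of "\<lambda>c. c \<in> E \<and> fst c = fst e" e rk] assms by blast
  have "\<not> x \<succ> c" for x using c rk_less[of x c] unfolding better_def by (metis not_less)
  then have "rk c = 0" unfolding rk_def by simp
  then show ?thesis using c(1) by blast
qed

lemma rk_inj: "a \<in> E \<Longrightarrow> b \<in> E \<Longrightarrow> fst a = fst b \<Longrightarrow> rk a = rk b \<Longrightarrow> a = b"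
  using better_total rk_less by (metis less_irrefl)


section \<open>Skipping a rotation\<close>

text \<open>The rotation number \<open>i\<close> and everything that depends on it is skipped along a full route. The
predecessors of the rotation number \<open>j\<close> come earlier on the route; one of them is missing if and only if it
is, or depends on, the rotation number \<open>i\<close>.\<close>

lemma skip_step:
  assumes least: "least_stable G X0" and full: "full_route G Ls" and i: "i < length Ls" and j: "j < length Ls"
    and Y: "stable G Y" and passed: "passed Y = {Ls ! l | l. l < j \<and> l \<noteq> i \<and> \<not> rot_less G (Ls ! i) (Ls ! l)}"
    and ji: "j \<noteq> i"
  shows "Ls ! j \<in> rotations_at G Y \<longleftrightarrow> \<not> rot_less G (Ls ! i) (Ls ! j)"
proof -
  have dist: "distinct Ls" and set: "set Ls = rotations G"
    using full_route_split[OF least full] by blast+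
  have idx: "l = m" if "l < length Ls" "m < length Ls" "Ls ! l = Ls ! m" for l m
    using that dist by (simp add: nth_eq_iff_index_eq)
  have inr: "Ls ! l \<in> rotations G" if "l < length Ls" for l using set that nth_mem by blast
  have order: "l < m" if lm: "rot_less G (Ls ! l) (Ls ! m)" "l < length Ls" "m < length Ls" for l m
  proof -
    obtain a b where ab: "a < b" "b < length Ls" "Ls ! a = Ls ! l" "Ls ! b = Ls ! m"
      using lm(1) full unfolding rot_less_def by blast
    have "a = l" using idx[of a l] ab lm by simp
    moreover have "b = m" using idx[of b m] ab lm by simp
    ultimately show ?thesis using ab by simp
  qed
  have notj: "Ls ! j \<notin> passed Y"
  proof
    assume "Ls ! j \<in> passed Y"
    then obtain l where "Ls ! j = Ls ! l" "l < j" unfolding passed by blast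
    then show False using idx[of l j] j by simp
  qed
  have noti: "Ls ! i \<notin> passed Y"
  proof
    assume "Ls ! i \<in> passed Y"
    then obtain l where "Ls ! i = Ls ! l" "l < j" "l \<noteq> i" unfolding passed by blast
    then show False using idx[of l i] i j by simp
  qed
  show ?thesis
    unfolding rotation_available_iff[OF least Y inr[OF j]]
  proof
    assume A: "Ls ! j \<notin> passed Y \<and> (\<forall>Q. rot_less G Q (Ls ! j) \<longrightarrow> Q \<in> passed Y)"
    show "\<not> rot_less G (Ls ! i) (Ls ! j)"
    proof
      assume "rot_less G (Ls ! i) (Ls ! j)"
      then show False using A noti by blast
    qed
  next
    assume n: "\<not> rot_less G (Ls ! i) (Ls ! j)"
    have "Q \<in> passed Y" if Q: "rot_less G Q (Ls ! j)" for Q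
    proof -
      have "Q \<in> set Ls" using Q set unfolding rot_less_def by blast
      then obtain l where l: "l < length Ls" "Q = Ls ! l" by (metis in_set_conv_nth)
      have "l < j" using order Q l j by blast
      moreover have "l \<noteq> i" using n Q l by blast
      moreover have "\<not> rot_less G (Ls ! i) (Ls ! l)" using n Q l rot_less_trans[OF least] by blast
      ultimately show ?thesis unfolding passed using l by blast
    qed
    then show "Ls ! j \<notin> passed Y \<and> (\<forall>Q. rot_less G Q (Ls ! j) \<longrightarrow> Q \<in> passed Y)" using notj by blast
  qed
qed

lemma skip_end:
  assumes least: "least_stable G X0" and full: "full_route G Ls" and i: "i < length Ls"
    and Y: "stable G Y"
    and passed: "passed Y = {Ls ! l | l. l < length Ls \<and> l \<noteq> i \<and> \<not> rot_less G (Ls ! i) (Ls ! l)}"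
  shows "Ls ! i \<in> rotations_at G Y"
    and "passed (apply_rotation (Ls ! i) Y) = {Q \<in> rotations G. \<not> rot_less G (Ls ! i) Q}"
proof -
  have dist: "distinct Ls" and set: "set Ls = rotations G"
    using full_route_split[OF least full] by blast+
  have idx: "l = m" if "l < length Ls" "m < length Ls" "Ls ! l = Ls ! m" for l m
    using that dist by (simp add: nth_eq_iff_index_eq)
  have inr: "Ls ! i \<in> rotations G" using set i nth_mem by blast
  have p: "passed Y = {Q \<in> rotations G. Q \<noteq> Ls ! i \<and> \<not> rot_less G (Ls ! i) Q}"
  proof (rule set_eqI)
    fix Q
    show "Q \<in> passed Y \<longleftrightarrow> Q \<in> {Q \<in> rotations G. Q \<noteq> Ls ! i \<and> \<not> rot_less G (Ls ! i) Q}"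
      unfolding passed set[symmetric] in_set_conv_nth mem_Collect_eq using idx i by metis
  qed
  have "Q \<in> passed Y" if Q: "rot_less G Q (Ls ! i)" for Q
  proof -
    have "Q \<in> rotations G" using Q unfolding rot_less_def by blast
    moreover have "Q \<noteq> Ls ! i" using Q rot_less_irrefl[OF least] by metis
    moreover have "\<not> rot_less G (Ls ! i) Q"
      using Q rot_less_irrefl[OF least] rot_less_trans[OF least] by metis
    ultimately show ?thesis unfolding p by simp
  qed
  moreover have "Ls ! i \<notin> passed Y" unfolding p by simp
  ultimately show av: "Ls ! i \<in> rotations_at G Y"
    using rotation_available_iff[OF least Y inr] by simp
  show "passed (apply_rotation (Ls ! i) Y) = {Q \<in> rotations G. \<not> rot_less G (Ls ! i) Q}"
    unfolding passed_apply[OF least Y av] p using inr rot_less_irrefl[OF least] by blast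
qed

end

section \<open>Reasoning about programs and their running time\<close>

text \<open>\<open>wp D Q c P s t\<close>: started in \<open>s\<close> at the time \<open>t\<close>, the program \<open>c\<close> ends in a state and at a time which
satisfy \<open>P\<close>. With the clock in the postcondition, invariants treat correctness and running time together.\<close>

definition wp ::
  "(nat \<Rightarrow> nat set) \<Rightarrow> (nat \<Rightarrow> nat set \<Rightarrow> nat set) \<Rightarrow> com \<Rightarrow>
   (store \<Rightarrow> nat \<Rightarrow> bool) \<Rightarrow> store \<Rightarrow> nat \<Rightarrow> bool" where
  "wp D Q c P s t \<longleftrightarrow> (\<exists>u s'. exec D Q c s u s' \<and> P s' (t + u))"

abbreviation seq :: "com \<Rightarrow> com \<Rightarrow> com" (infixr ";;" 60) where
  "c ;; d \<equiv> Seq c d"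

lemma wp_Nop: "wp D Q Nop P s t \<longleftrightarrow> P s (Suc t)"
  unfolding wp_def by (subst exec.simps) simp

lemma wp_Assign: "wp D Q (Assign x a) P s t \<longleftrightarrow> P (set_reg x (exp_val a s) s) (Suc t)"
  unfolding wp_def by (subst exec.simps) simp

lemma wp_Store: "wp D Q (Store x a b) P s t \<longleftrightarrow>
    P (set_arr x ((arr s x)(exp_val a s := exp_val b s)) s) (Suc t)"
  unfolding wp_def by (subst exec.simps) simp

lemma wp_Ask: "wp D Q (Ask a x y) P s t \<longleftrightarrow> P (ask D Q (exp_val a s) x y s) (Suc t)"
  unfolding wp_def by (subst exec.simps) simp

lemma wp_Seq: "wp D Q (c ;; d) P s t \<longleftrightarrow> wp D Q c (\<lambda>s' t'. wp D Q d P s' t') s t"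
proof
  assume "wp D Q (c ;; d) P s t"
  then obtain u s' where "exec D Q (c ;; d) s u s'" "P s' (t + u)" unfolding wp_def by blast
  then show "wp D Q c (\<lambda>s' t'. wp D Q d P s' t') s t"
    by cases (auto simp: wp_def add.assoc)
next
  assume "wp D Q c (\<lambda>s' t'. wp D Q d P s' t') s t"
  then show "wp D Q (c ;; d) P s t" unfolding wp_def by (metis exec.Seq add.assoc)
qed

lemma wp_Cond: "wp D Q (Cond b c d) P s t \<longleftrightarrow>
    (if test_val b s then wp D Q c P s (Suc t) else wp D Q d P s (Suc t))"
proof
  assume "wp D Q (Cond b c d) P s t"
  then obtain u s' where "exec D Q (Cond b c d) s u s'" "P s' (t + u)" unfolding wp_def by blast
  then show "if test_val b s then wp D Q c P s (Suc t) else wp D Q d P s (Suc t)"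
    by cases (auto simp: wp_def)
next
  assume "if test_val b s then wp D Q c P s (Suc t) else wp D Q d P s (Suc t)"
  then show "wp D Q (Cond b c d) P s t"
    unfolding wp_def by (metis exec.CondTrue exec.CondFalse add_Suc_right add_Suc Suc_eq_plus1)
qed

lemmas wp_simps = wp_Nop wp_Assign wp_Store wp_Ask wp_Seq wp_Cond

text \<open>Every iteration takes time, so an invariant that bounds the clock also ensures termination.\<close>

lemma wp_Loop:
  assumes inv: "I s t"
    and bound: "\<And>s t. I s t \<Longrightarrow> t \<le> T"
    and step: "\<And>s t. I s t \<Longrightarrow> test_val b s \<Longrightarrow> wp D Q c I s (Suc t)"
    and exit: "\<And>s t. I s t \<Longrightarrow> \<not> test_val b s \<Longrightarrow> P s (Suc t)"
  shows "wp D Q (Loop b c) P s t"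
  using inv
proof (induction "T - t" arbitrary: s t rule: less_induct)
  case less
  show ?case
  proof (cases "test_val b s")
    case False
    then show ?thesis
      using exec.LoopFalse[OF False] exit[OF less.prems] unfolding wp_def by (metis Suc_eq_plus1)
  next
    case True
    obtain u s' where u: "exec D Q c s u s'" "I s' (Suc t + u)"
      using step[OF less.prems True] unfolding wp_def by blast
    have "t < T" "T - (Suc t + u) < T - t" using bound[OF u(2)] by simp_all
    then obtain v s'' where "exec D Q (Loop b c) s' v s''" "P s'' (Suc t + u + v)"
      using less.hyps[OF _ u(2)] unfolding wp_def by blast
    then show ?thesis
      using exec.LoopTrue[OF True u(1)] unfolding wp_def
      by (metis add.assoc add.commute Suc_eq_plus1)
  qed
qed

lemma reg_set_reg [simp]: "reg (set_reg x v s) = (reg s)(x := v)"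
  and arr_set_reg [simp]: "arr (set_reg x v s) = arr s"
  and reg_set_arr [simp]: "reg (set_arr x h s) = reg s"
  and arr_set_arr [simp]: "arr (set_arr x h s) = (arr s)(x := h)"
  and reg_ask [simp]: "reg (ask D Q f x y s) = reg s"
  by (simp_all add: set_reg_def set_arr_def ask_def)

lemma arr_ask: "arr (ask D Q f x y s) z =
   (if z = y then (\<lambda>k. if k \<in> D f then (if k \<in> Q f {i \<in> D f. arr s x i \<noteq> 0} then 1 else 0)
                      else arr s y k) else arr s z)"
  by (simp add: ask_def)

text \<open>The frame condition of a specification, with the registers \<open>U\<close> and the arrays \<open>V\<close> that may be modified.\<close>

definition frame :: "string set \<Rightarrow> string set \<Rightarrow> store \<Rightarrow> store \<Rightarrow> bool" where
  "frame U V s s' \<longleftrightarrow> (\<forall>x. x \<notin> U \<longrightarrow> reg s' x = reg s x) \<and> (\<forall>x. x \<notin> V \<longrightarrow> arr s' x = arr s x)"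

lemma frame_refl [simp]: "frame U V s s"
  by (simp add: frame_def)

lemma frame_reg: "frame U V s s' \<Longrightarrow> x \<notin> U \<Longrightarrow> reg s' x = reg s x"
  by (simp add: frame_def)

lemma frame_set_reg [simp]: "x \<in> U \<Longrightarrow> frame U V s s' \<Longrightarrow> frame U V s (set_reg x v s')"
  and frame_set_arr [simp]: "x \<in> V \<Longrightarrow> frame U V s s' \<Longrightarrow> frame U V s (set_arr x h s')"
  and frame_ask [simp]: "x \<in> V \<Longrightarrow> frame U V s s' \<Longrightarrow> frame U V s (ask D Q f y x s')"
  by (auto simp: frame_def arr_ask)

lemma frame_trans: "frame U V s s' \<Longrightarrow> frame U' V' s' s'' \<Longrightarrow> U' \<subseteq> U \<Longrightarrow> V' \<subseteq> V \<Longrightarrow> frame U V s s''"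
  by (simp add: frame_def subset_eq) metis

text \<open>A linear search among the edge numbers \<open>k\<close>. If it fails, the result \<open>r\<close> is the number of edges.\<close>

definition scan :: "test \<Rightarrow> com" where
  "scan b = Assign ''r'' (Reg ''nE'') ;; Assign ''k'' (Num 0) ;;
     Loop (Less (Reg ''k'') (Reg ''nE''))
       (Cond b (Assign ''r'' (Reg ''k'')) Nop ;; Assign ''k'' (Inc (Reg ''k'')))"

lemma wp_scan:
  assumes n: "reg s ''nE'' = n"
    and b: "\<And>s' k. k < n \<Longrightarrow> frame {''r'', ''k''} {} s s' \<Longrightarrow> reg s' ''k'' = k \<Longrightarrow> test_val b s' \<longleftrightarrow> pr k"
    and P: "\<And>s' t'. frame {''r'', ''k''} {} s s' \<Longrightarrow> t' \<le> t + 4 * n + 3 \<Longrightarrow>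
       reg s' ''r'' < n \<and> pr (reg s' ''r'') \<or> reg s' ''r'' = n \<and> (\<forall>k < n. \<not> pr k) \<Longrightarrow> P s' t'"
  shows "wp D Q (scan b) P s t"
proof -
  define I where "I = (\<lambda>s' t'. frame {''r'', ''k''} {} s s' \<and> reg s' ''k'' \<le> n \<and>
     t' \<le> t + 2 + 4 * reg s' ''k'' \<and>
     (reg s' ''r'' < n \<and> pr (reg s' ''r'') \<or> reg s' ''r'' = n \<and> (\<forall>k < reg s' ''k''. \<not> pr k)))"
  show ?thesis unfolding scan_def wp_simps
  proof (rule wp_Loop[where I = I and T = "t + 2 + 4 * n"], goal_cases)
    case 1 show ?case using n by (simp add: I_def)
  next
    case (2 s' t') then show ?case by (simp add: I_def)
  next
    case (3 s' t')
    then have fr: "frame {''r'', ''k''} {} s s'" by (simp add: I_def)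
    have "reg s' ''k'' < n" using 3(2) frame_reg[OF fr, of "''nE''"] n by simp
    then show ?case
      unfolding wp_simps using b[OF _ fr refl] 3(1) by (auto simp: I_def less_Suc_eq)
  next
    case (4 s' t')
    then have fr: "frame {''r'', ''k''} {} s s'" by (simp add: I_def)
    show ?case
      by (rule P[OF fr]) (use 4 n frame_reg[OF fr, of "''nE''"] in \<open>auto simp: I_def\<close>)
  qed
qed


section \<open>The program\<close>

text \<open>The array \<open>cur\<close> flags the edges of the current matching, \<open>base\<close> those of the least stable one, and \<open>nxt\<close>
links every edge to the next best edge of its worker. The number \<open>nE\<close> of edges, which is not the number
of an edge, serves as \<^emph>\<open>none\<close>. Answers of the choice functions are written to \<open>ans\<close>.\<close>

definition link_edges :: com where
  "link_edges = Assign ''i'' (Num 0) ;; Loop (Less (Reg ''i'') (Reg ''nE''))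
     (scan (Conj (Equal (Cell ''endW'' (Reg ''k'')) (Cell ''endW'' (Reg ''i'')))
                 (Equal (Cell ''rank'' (Reg ''k'')) (Inc (Cell ''rank'' (Reg ''i''))))) ;;
      Store ''nxt'' (Reg ''i'') (Reg ''r'') ;; Assign ''i'' (Inc (Reg ''i'')))"

text \<open>The answer must differ from the offer in at most one edge, which is searched for.\<close>

definition find_displaced :: com where
  "find_displaced = scan (Conj (Neg (Equal (Cell ''cur'' (Reg ''k'')) (Num 0)))
     (Conj (Equal (Cell ''endF'' (Reg ''k'')) (Cell ''endF'' (Reg ''e'')))
           (Equal (Cell ''ans'' (Reg ''k'')) (Num 0))))"

text \<open>The edges of rank 0 stand for the workers. A worker that loses its edge proposes its next one at once,
so that after a round of the outer loop every worker treated so far is matched or has no edge left.\<close>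

definition run_proposals :: com where
  "run_proposals = Assign ''i'' (Num 0) ;; Loop (Less (Reg ''i'') (Reg ''nE''))
    (Cond (Equal (Cell ''rank'' (Reg ''i'')) (Num 0)) (Assign ''e'' (Reg ''i'')) (Assign ''e'' (Reg ''nE'')) ;;
     Loop (Less (Reg ''e'') (Reg ''nE''))
      (Store ''cur'' (Reg ''e'') (Num 1) ;; Ask (Cell ''endF'' (Reg ''e'')) ''cur'' ''ans'' ;;
       find_displaced ;;
       Cond (Less (Reg ''r'') (Reg ''nE''))
         (Store ''cur'' (Reg ''r'') (Num 0) ;; Assign ''e'' (Cell ''nxt'' (Reg ''r'')))
         (Assign ''e'' (Reg ''nE''))) ;;
     Assign ''i'' (Inc (Reg ''i'')))"

text \<open>Asking the firm of \<open>e\<close> whether it wants \<open>e\<close>.\<close>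

definition probe :: com where
  "probe = Store ''cur'' (Reg ''e'') (Num 1) ;; Ask (Cell ''endF'' (Reg ''e'')) ''cur'' ''ans'' ;;
     Store ''cur'' (Reg ''e'') (Num 0)"

definition first_wanted :: com where
  "first_wanted = Assign ''e'' (Cell ''nxt'' (Reg ''x'')) ;; Assign ''ok'' (Num 0) ;;
     Loop (Conj (Equal (Reg ''ok'') (Num 0)) (Less (Reg ''e'') (Reg ''nE'')))
       (probe ;; Cond (Equal (Cell ''ans'' (Reg ''e'')) (Num 0))
          (Assign ''e'' (Cell ''nxt'' (Reg ''e''))) (Assign ''ok'' (Num 1)))"

definition find_tandem :: com where
  "find_tandem = first_wanted ;; Cond (Less (Reg ''e'') (Reg ''nE'')) find_displaced (Assign ''r'' (Reg ''nE''))"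

text \<open>The cycle is popped from the stack, that is, in the reverse direction. The array \<open>tdm\<close>, which is not part
of the output, keeps for every new edge the edge that it displaces: the one popped just before, and for
the top of the stack the edge \<open>r\<close> which closes the cycle.\<close>

definition emit_rotation :: com where
  "emit_rotation = Assign ''tb'' (Reg ''r'') ;; Assign ''p'' (Cell ''plusStart'' (Reg ''nR'')) ;;
     Assign ''go'' (Num 1) ;;
     Loop (Equal (Reg ''go'') (Num 1))
       (Assign ''ht'' (Dec (Reg ''ht'')) ;; Assign ''x'' (Cell ''stk'' (Reg ''ht'')) ;;
        Store ''plus'' (Reg ''p'') (Cell ''alt'' (Reg ''ht'')) ;;
        Store ''minus'' (Reg ''p'') (Reg ''x'') ;; Store ''tdm'' (Reg ''p'') (Reg ''tb'') ;;
        Assign ''p'' (Inc (Reg ''p'')) ;;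
        Store ''cur'' (Reg ''x'') (Num 0) ;; Store ''cur'' (Cell ''alt'' (Reg ''ht'')) (Num 1) ;;
        Store ''ons'' (Reg ''x'') (Num 0) ;; Assign ''tb'' (Reg ''x'') ;;
        Cond (Equal (Reg ''x'') (Reg ''r'')) (Assign ''go'' (Num 0)) Nop) ;;
     Assign ''nR'' (Inc (Reg ''nR'')) ;;
     Store ''plusStart'' (Reg ''nR'') (Reg ''p'') ;; Store ''minusStart'' (Reg ''nR'') (Reg ''p'')"

text \<open>\<open>stk\<close> is the stack of height \<open>ht\<close>, \<open>ons\<close> flags its members, \<open>alt\<close> holds the new edge to which the worker of the
stack entry wants to move, and \<open>fin\<close> flags edges that belong to all better stable matchings.\<close>

definition push :: com where
  "push = Store ''stk'' (Reg ''ht'') (Reg ''r'') ;; Store ''ons'' (Reg ''r'') (Num 1) ;;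
     Assign ''ht'' (Inc (Reg ''ht''))"

definition restart :: com where
  "restart = scan (Conj (Neg (Equal (Cell ''cur'' (Reg ''k'')) (Num 0))) (Equal (Cell ''fin'' (Reg ''k'')) (Num 0))) ;;
     Cond (Less (Reg ''r'') (Reg ''nE'')) push (Assign ''run'' (Num 0))"

definition retire :: com where
  "retire = Store ''fin'' (Reg ''x'') (Num 1) ;; Store ''ons'' (Reg ''x'') (Num 0) ;;
     Assign ''ht'' (Dec (Reg ''ht''))"

text \<open>The top of the stack is retired if it has no tandem or if its tandem displaces a retired edge.\<close>

definition explore :: com where
  "explore = Assign ''x'' (Cell ''stk'' (Dec (Reg ''ht''))) ;; find_tandem ;;
     Cond (Conj (Less (Reg ''r'') (Reg ''nE'')) (Equal (Cell ''fin'' (Reg ''r'')) (Num 0)))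
       (Store ''alt'' (Dec (Reg ''ht'')) (Reg ''e'') ;;
        Cond (Equal (Cell ''ons'' (Reg ''r'')) (Num 0)) push emit_rotation)
       retire"

definition search_rotations :: com where
  "search_rotations = Assign ''run'' (Num 1) ;; Loop (Equal (Reg ''run'') (Num 1))
     (Cond (Equal (Reg ''ht'') (Num 0)) restart explore)"

text \<open>For one worker of a listed rotation: no edge between the old and the new one may be wanted, and the
new one must be wanted and displace the edge which it displaced when the rotation was found.\<close>

definition test_entry :: com where
  "test_entry = Assign ''e'' (Cell ''nxt'' (Cell ''minus'' (Reg ''p''))) ;;
     Loop (Neg (Equal (Reg ''e'') (Cell ''plus'' (Reg ''p''))))
       (probe ;; Cond (Equal (Cell ''ans'' (Reg ''e'')) (Num 0)) Nop (Assign ''ok'' (Num 0)) ;;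
        Assign ''e'' (Cell ''nxt'' (Reg ''e''))) ;;
     probe ;; Cond (Conj (Neg (Equal (Cell ''ans'' (Reg ''e'')) (Num 0)))
                         (Equal (Cell ''ans'' (Cell ''tdm'' (Reg ''p''))) (Num 0))) Nop (Assign ''ok'' (Num 0))"

definition test_rotation :: com where
  "test_rotation = Assign ''ok'' (Num 1) ;; Assign ''p'' (Cell ''plusStart'' (Reg ''j'')) ;;
     Loop (Less (Reg ''p'') (Cell ''plusStart'' (Inc (Reg ''j''))))
       (Cond (Equal (Cell ''cur'' (Cell ''minus'' (Reg ''p''))) (Num 0)) (Assign ''ok'' (Num 0)) test_entry ;;
        Assign ''p'' (Inc (Reg ''p'')))"

definition apply_listed :: com where
  "apply_listed = Assign ''p'' (Cell ''plusStart'' (Reg ''j'')) ;;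
     Loop (Less (Reg ''p'') (Cell ''plusStart'' (Inc (Reg ''j''))))
       (Store ''cur'' (Cell ''minus'' (Reg ''p'')) (Num 0) ;; Store ''cur'' (Cell ''plus'' (Reg ''p'')) (Num 1) ;;
        Assign ''p'' (Inc (Reg ''p'')))"

definition copy_flags :: "string \<Rightarrow> string \<Rightarrow> com" where
  "copy_flags x y = Assign ''k'' (Num 0) ;; Loop (Less (Reg ''k'') (Reg ''nE''))
     (Store y (Reg ''k'') (Cell x (Reg ''k'')) ;; Assign ''k'' (Inc (Reg ''k'')))"

text \<open>Applying everything that is available, in the order of the list and except for the rotation number \<open>i\<close>.\<close>

definition skip_pass :: com where
  "skip_pass = Assign ''j'' (Num 0) ;; Loop (Less (Reg ''j'') (Reg ''nR''))
     (Cond (Equal (Reg ''j'') (Reg ''i'')) Nop (test_rotation ;; Cond (Equal (Reg ''ok'') (Num 1)) apply_listed Nop) ;;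
      Assign ''j'' (Inc (Reg ''j'')))"

definition cover_pass :: com where
  "cover_pass = Assign ''j'' (Num 0) ;; Loop (Less (Reg ''j'') (Reg ''nR''))
     (test_rotation ;; Cond (Equal (Reg ''ok'') (Num 1))
        (Store ''tail'' (Reg ''nH'') (Reg ''i'') ;; Store ''head'' (Reg ''nH'') (Reg ''j'') ;;
         Assign ''nH'' (Inc (Reg ''nH''))) Nop ;;
      Assign ''j'' (Inc (Reg ''j'')))"

definition build_hasse :: com where
  "build_hasse = Assign ''i'' (Num 0) ;; Loop (Less (Reg ''i'') (Reg ''nR''))
     (copy_flags ''base'' ''cur'' ;; skip_pass ;; Assign ''j'' (Reg ''i'') ;; apply_listed ;; cover_pass ;;
      Assign ''i'' (Inc (Reg ''i'')))"

definition poset_program :: com where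
  "poset_program = link_edges ;; run_proposals ;; copy_flags ''cur'' ''base'' ;; search_rotations ;; build_hasse"


section \<open>The input and its basic operations\<close>

locale market_input = stable_market G for G :: "(nat, nat) market" +
  fixes es :: "(nat \<times> nat) list"
  assumes numbering: "numbering G es"
begin

abbreviation "n \<equiv> length es"
abbreviation "D \<equiv> edge_numbers es"
abbreviation "Q \<equiv> choice_oracle G es"

definition matched :: "(nat \<Rightarrow> nat) \<Rightarrow> (nat \<times> nat) set" where
  "matched h = (\<lambda>i. es ! i) ` {i. i < n \<and> h i \<noteq> 0}"

lemma set_es: "set es = E" and distinct_es: "distinct es"
  using numbering by (simp_all add: numbering_def)

lemma card_E: "card E = n"
  using set_es distinct_es distinct_card by metis

lemma nth_E [simp]: "i < n \<Longrightarrow> es ! i \<in> E"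
  using set_es nth_mem by metis

lemma nth_inj: "i < n \<Longrightarrow> j < n \<Longrightarrow> es ! i = es ! j \<longleftrightarrow> i = j"
  using distinct_es by (simp add: nth_eq_iff_index_eq)

lemma E_nth: "e \<in> E \<Longrightarrow> \<exists>i < n. e = es ! i"
  using set_es by (metis in_set_conv_nth)

lemma matched_iff [simp]:
  assumes "i < n"
  shows "es ! i \<in> matched h \<longleftrightarrow> h i \<noteq> 0"
proof -
  have "inj_on (\<lambda>i. es ! i) {..<n}" using distinct_es by (simp add: inj_on_nth)
  then have "(es ! i \<in> (\<lambda>i. es ! i) ` {i. i < n \<and> h i \<noteq> 0}) = (i \<in> {i. i < n \<and> h i \<noteq> 0})"
    by (rule inj_on_image_mem_iff[where B = "{..<n}"]) (use assms in \<open>simp_all add: subset_eq\<close>)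
  then show ?thesis using assms by (simp add: matched_def)
qed

lemma matched_sub: "matched h \<subseteq> E"
  unfolding matched_def by (rule image_subsetI) simp

lemma matched_eqI:
  assumes "X \<subseteq> E" "\<And>i. i < n \<Longrightarrow> h i \<noteq> 0 \<longleftrightarrow> es ! i \<in> X"
  shows "matched h = X"
proof (rule set_eqI)
  fix e
  show "e \<in> matched h \<longleftrightarrow> e \<in> X"
  proof (cases "e \<in> E")
    case True
    then obtain i where "i < n" "e = es ! i" using E_nth by blast
    then show ?thesis using assms(2) by simp
  next
    case False
    then show ?thesis using assms(1) matched_sub by blast
  qed
qed

lemma matched_insert: "e < n \<Longrightarrow> v \<noteq> 0 \<Longrightarrow> matched (h(e := v)) = insert (es ! e) (matched h)"
  by (rule matched_eqI) (use matched_sub[of h] nth_inj in simp_all)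

lemma matched_remove: "e < n \<Longrightarrow> matched (h(e := 0)) = matched h - {es ! e}"
  by (rule matched_eqI) (use matched_sub[of h] nth_inj in \<open>blast, simp\<close>)

text \<open>The part of the input in the memory that the program reads.\<close>

definition static :: "store \<Rightarrow> bool" where
  "static s \<longleftrightarrow> reg s ''nE'' = n \<and>
     (\<forall>i < n. arr s ''endW'' i = fst (es ! i) \<and> arr s ''endF'' i = snd (es ! i) \<and> arr s ''rank'' i = rk (es ! i))"

definition linked :: "store \<Rightarrow> bool" where
  "linked s \<longleftrightarrow> (\<forall>i < n. arr s ''nxt'' i < n \<and> es ! i \<succ> es ! (arr s ''nxt'' i) \<and>
       rk (es ! (arr s ''nxt'' i)) = Suc (rk (es ! i)) \<or>
     arr s ''nxt'' i = n \<and> \<not> (\<exists>d. es ! i \<succ> d))"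

lemma static_frame:
  "static s \<Longrightarrow> frame U V s s' \<Longrightarrow> ''nE'' \<notin> U \<Longrightarrow> ''endW'' \<notin> V \<Longrightarrow> ''endF'' \<notin> V \<Longrightarrow> ''rank'' \<notin> V \<Longrightarrow> static s'"
  by (simp add: static_def frame_def)

lemma linked_frame: "linked s \<Longrightarrow> frame U V s s' \<Longrightarrow> ''nxt'' \<notin> V \<Longrightarrow> linked s'"
  by (simp add: linked_def frame_def)

lemma static_input: "static (input_store G es)"
proof -
  have "{e \<in> E. (e, es ! i) \<in> pref G (fst (es ! i))} = {e. e \<succ> es ! i}" if "i < n" for i
  proof -
    have "pref G (fst (es ! i)) \<subseteq> at_W (fst (es ! i)) E \<times> at_W (fst (es ! i)) E"
      using market fst_in_W[OF nth_E[OF that]] unfolding market_def by blast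
    then have "fst e = fst (es ! i)" if "(e, es ! i) \<in> pref G (fst (es ! i))" for e
      using that unfolding at_W_def by blast
    then show ?thesis using nth_E[OF that] unfolding better_def by (intro Collect_cong) metis
  qed
  then show ?thesis by (simp add: static_def input_store_def rk_def)
qed

lemma ask_answer:
  assumes "static s" "e < n" "i < n" "snd (es ! i) = snd (es ! e)"
  shows "arr (ask D Q (snd (es ! e)) ''cur'' ''ans'' s) ''ans'' i \<noteq> 0 \<longleftrightarrow>
    es ! i \<in> C (snd (es ! e)) (at_F (snd (es ! e)) (matched (arr s ''cur'')))"
proof -
  have "(\<lambda>k. es ! k) ` {i \<in> D (snd (es ! e)). arr s ''cur'' i \<noteq> 0} =
      at_F (snd (es ! e)) (matched (arr s ''cur''))"
    unfolding edge_numbers_def matched_def at_F_def by auto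
  then show ?thesis using assms by (simp add: arr_ask choice_oracle_def edge_numbers_def)
qed


text \<open>By \<open>next_exists\<close> the successor in the list is recognised by its rank, so one scan finds it.\<close>

lemma wp_link_edges:
  assumes st: "static s"
    and P: "\<And>s' t'. frame {''i'', ''r'', ''k''} {''nxt''} s s' \<Longrightarrow> linked s' \<Longrightarrow>
       t' \<le> t + 2 + n * (4 * n + 6) \<Longrightarrow> P s' t'"
  shows "wp D Q link_edges P s t"
proof -
  let ?nx = "\<lambda>s' i. arr s' ''nxt'' i < n \<and> es ! i \<succ> es ! (arr s' ''nxt'' i) \<and>
       rk (es ! (arr s' ''nxt'' i)) = Suc (rk (es ! i)) \<or>
     arr s' ''nxt'' i = n \<and> \<not> (\<exists>d. es ! i \<succ> d)"
  define I where "I = (\<lambda>s' t'. frame {''i'', ''r'', ''k''} {''nxt''} s s' \<and> reg s' ''i'' \<le> n \<and>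
     (\<forall>i < reg s' ''i''. ?nx s' i) \<and> t' \<le> t + 1 + reg s' ''i'' * (4 * n + 6))"
  show ?thesis unfolding link_edges_def wp_simps
  proof (rule wp_Loop[where I = I and T = "t + 1 + n * (4 * n + 6)"], goal_cases)
    case 1 show ?case by (simp add: I_def)
  next
    case (2 s' t') then show ?case
      using mult_le_mono1[of "reg s' ''i''" n "4 * n + 6"] unfolding I_def by linarith
  next
    case (3 s1 t1)
    then have fr: "frame {''i'', ''r'', ''k''} {''nxt''} s s1" by (simp add: I_def)
    have st1: "static s1" by (rule static_frame[OF st fr]) simp_all
    let ?i = "reg s1 ''i''"
    have i: "?i < n" using 3(2) st1 by (simp add: static_def)
    show ?case unfolding wp_simps
    proof (rule wp_scan[where n = n and
          pr = "\<lambda>k. fst (es ! k) = fst (es ! ?i) \<and> rk (es ! k) = Suc (rk (es ! ?i))"], goal_cases)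
      case 1 then show ?case using st1 by (simp add: static_def)
    next
      case (2 s2 k)
      have "static s2" by (rule static_frame[OF st1 2(2)]) simp_all
      then show ?case using 2 i by (simp add: static_def frame_def)
    next
      case (3 s2 t2)
      let ?r = "reg s2 ''r''"
      have i2: "reg s2 ''i'' = ?i" using 3(1) by (simp add: frame_def)
      have fr2: "frame {''i'', ''r'', ''k''} {''nxt''} s s2" by (rule frame_trans[OF fr 3(1)]) simp_all
      have nx: "?r < n \<and> es ! ?i \<succ> es ! ?r \<and> rk (es ! ?r) = Suc (rk (es ! ?i)) \<or>
          ?r = n \<and> \<not> (\<exists>d. es ! ?i \<succ> d)"
      proof (cases "?r < n")
        case True
        then show ?thesis using 3(3) rk_less_iff[of "es ! ?i" "es ! ?r"] i by simp
      next
        case False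
        then have none: "?r = n" "\<And>k. k < n \<Longrightarrow> fst (es ! k) = fst (es ! ?i) \<Longrightarrow> rk (es ! k) \<noteq> Suc (rk (es ! ?i))"
          using 3(3) by blast+
        have "\<not> es ! ?i \<succ> d" for d
        proof
          assume "es ! ?i \<succ> d"
          then obtain c where c: "es ! ?i \<succ> c" "rk c = Suc (rk (es ! ?i))" using next_exists by blast
          then obtain k where "k < n" "c = es ! k" using E_nth unfolding better_def by metis
          then show False using none(2) c unfolding better_def by metis
        qed
        then show ?thesis using none(1) by blast
      qed
      have old: "?nx s2 j" if "j < ?i" for j
        using \<open>I s1 t1\<close> that 3(1) by (simp add: I_def frame_def)
      have "t2 \<le> t + ?i * (4 * n + 6) + 4 * n + 5" using 3(2) \<open>I s1 t1\<close> by (simp add: I_def)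
      then show ?case using fr2 i2 i nx old by (auto simp: I_def less_Suc_eq)
    qed
  next
    case (4 s1 t1)
    then have fr: "frame {''i'', ''r'', ''k''} {''nxt''} s s1" by (simp add: I_def)
    have "static s1" by (rule static_frame[OF st fr]) simp_all
    then have "reg s1 ''i'' = n" using 4 by (simp add: I_def static_def)
    then show ?case using P[OF fr] 4(1) by (simp add: I_def linked_def)
  qed
qed


section \<open>The run of the proposals\<close>

lemma wp_find_displaced:
  assumes st: "static s" and e: "reg s ''e'' < n"
    and P: "\<And>s' t'. frame {''r'', ''k''} {} s s' \<Longrightarrow> t' \<le> t + 4 * n + 3 \<Longrightarrow>
       reg s' ''r'' < n \<and> arr s ''cur'' (reg s' ''r'') \<noteq> 0 \<and>
         snd (es ! reg s' ''r'') = snd (es ! reg s ''e'') \<and> arr s ''ans'' (reg s' ''r'') = 0 \<or>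
       reg s' ''r'' = n \<and> (\<forall>k < n. arr s ''cur'' k \<noteq> 0 \<longrightarrow> snd (es ! k) = snd (es ! reg s ''e'') \<longrightarrow>
         arr s ''ans'' k \<noteq> 0) \<Longrightarrow> P s' t'"
  shows "wp D Q find_displaced P s t"
  unfolding find_displaced_def
proof (rule wp_scan[where n = n and pr = "\<lambda>k. arr s ''cur'' k \<noteq> 0 \<and>
      snd (es ! k) = snd (es ! reg s ''e'') \<and> arr s ''ans'' k = 0"], goal_cases)
  case 1 then show ?case using st by (simp add: static_def)
next
  case (2 s' k)
  then show ?case using st e by (simp add: static_def frame_def)
next
  case (3 s' t')
  show ?case by (rule P) (use 3 in auto)
qed

text \<open>The invariant of the proposals: the workers whose best edges have numbers below \<open>i\<close> have been
  served, except for the one which is about to propose the edge number \<open>e\<close> (if \<open>e < n\<close>).\<close>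

definition proposing :: "(nat \<times> nat) set \<Rightarrow> (nat \<times> nat) set \<Rightarrow> nat \<Rightarrow> nat \<Rightarrow> bool" where
  "proposing P X i e \<longleftrightarrow> proposal_state P X \<and>
     (e < n \<longrightarrow> es ! e \<notin> P \<and> (\<forall>d. d \<succ> es ! e \<longrightarrow> d \<in> P \<and> d \<notin> X) \<and>
        (\<exists>j < i. j < n \<and> rk (es ! j) = 0 \<and> fst (es ! j) = fst (es ! e))) \<and>
     (\<forall>j < i. j < n \<longrightarrow> rk (es ! j) = 0 \<longrightarrow> (\<exists>x \<in> X. fst x = fst (es ! j)) \<or>
        (\<forall>d \<in> E. fst d = fst (es ! j) \<longrightarrow> d \<in> P) \<or> (e < n \<and> fst (es ! e) = fst (es ! j))) \<and>
     (\<forall>p \<in> P. \<exists>j < i. j < n \<and> rk (es ! j) = 0 \<and> fst (es ! j) = fst p)"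

lemma proposing_start: "proposing {} {} 0 n"
proof -
  have "at_F f {} = ({} :: (nat \<times> nat) set)" for f :: nat by (simp add: at_F_def)
  moreover have "C f {} = {}" if "f \<in> Fpart G" for f using choice_sub[OF that, of "{}"] by simp
  ultimately show ?thesis unfolding proposing_def proposal_state_def by simp
qed

lemma proposing_end:
  assumes "proposing P X n n"
  shows "least_stable G X"
proof (rule proposal_end)
  show p: "proposal_state P X" using assms unfolding proposing_def by blast
  note q = p[unfolded proposal_state_def]
  fix e assume e: "e \<in> E" "e \<notin> P"
  obtain c where c: "c \<in> E" "fst c = fst e" "rk c = 0" using rank_zero_exists[OF e(1)] by blast
  obtain j where j: "j < n" "c = es ! j" using E_nth[OF c(1)] by blast
  have "(\<exists>x \<in> X. fst x = fst c) \<or> (\<forall>d \<in> E. fst d = fst c \<longrightarrow> d \<in> P)"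
    using assms j c(3) unfolding proposing_def by blast
  then obtain x where x: "x \<in> X" "fst x = fst e" using e c(2) by metis
  have "x \<in> P" "x \<in> E" using x q by blast+
  then have "x \<succ> e \<or> e \<succ> x" using better_total[of x e] x(2) e by metis
  then show "\<exists>x \<in> X. x \<succ> e" using q e(2) x(1) \<open>x \<in> P\<close> by blast
qed

lemma proposing_next:
  assumes "proposing P X i n" "i < n"
  shows "rk (es ! i) = 0 \<Longrightarrow> proposing P X (Suc i) i"
    and "rk (es ! i) \<noteq> 0 \<Longrightarrow> proposing P X (Suc i) n"
proof -
  note p = assms(1)[unfolded proposing_def]
  show "proposing P X (Suc i) n" if "rk (es ! i) \<noteq> 0"
    using p that unfolding proposing_def by (metis less_Suc_eq less_irrefl)
  assume r: "rk (es ! i) = 0"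
  have "es ! i \<notin> P"
  proof
    assume "es ! i \<in> P"
    then obtain j where j: "j < i" "j < n" "rk (es ! j) = 0" "fst (es ! j) = fst (es ! i)" using p by blast
    then have "es ! j = es ! i" using rk_inj[of "es ! j" "es ! i"] assms(2) r by simp
    then show False using nth_inj j assms(2) by simp
  qed
  moreover have "\<not> d \<succ> es ! i" for d using r rk_less[of d "es ! i"] by (metis not_less_zero)
  ultimately show "proposing P X (Suc i) i"
    using p r assms(2) unfolding proposing_def by (metis less_Suc_eq less_irrefl)
qed

lemma proposing_accept:
  assumes "proposing P X i e" "e < n"
    and "\<And>x. x \<in> insert (es ! e) X \<Longrightarrow> snd x = snd (es ! e) \<Longrightarrow> x \<in> grow X (es ! e)"
  shows "proposing (insert (es ! e) P) (insert (es ! e) X) i n"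
proof -
  let ?e = "es ! e"
  note p = assms(1)[unfolded proposing_def]
  have ps: "proposal_state P X" and new: "?e \<notin> P" and up: "\<And>d. d \<succ> ?e \<Longrightarrow> d \<in> P \<and> d \<notin> X"
    using p assms(2) by blast+
  have XE: "X \<subseteq> E" using ps unfolding proposal_state_def by blast
  have "grow X ?e \<subseteq> insert ?e (at_F (snd ?e) X)"
    using choice_sub[OF snd_in_F insert_at_F_sub[OF XE]] nth_E[OF assms(2)] by blast
  moreover have "insert ?e (at_F (snd ?e) X) \<subseteq> grow X ?e"
  proof
    fix x assume "x \<in> insert ?e (at_F (snd ?e) X)"
    then show "x \<in> grow X ?e" using assms(3)[of x] by (cases "x = ?e") simp_all
  qed
  ultimately have "grow X ?e = insert ?e (at_F (snd ?e) X)" by (rule subset_antisym)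
  moreover have "at_F (snd ?e) X \<subseteq> X" by (simp add: at_F_def)
  ultimately have "insert ?e X = (X - at_F (snd ?e) X) \<union> grow X ?e" by blast
  then have "proposal_state (insert ?e P) (insert ?e X)"
    using proposal_step[OF ps nth_E[OF assms(2)] new up] by blast
  then show ?thesis using p assms(2) unfolding proposing_def by (metis insert_iff less_irrefl)
qed

text \<open>The displaced edge \<open>r\<close> is the worst proposal of its worker so far: in a state of proposals only the worst one
can be kept. Therefore the next edge in the list is new.\<close>

lemma proposing_displace:
  assumes "proposing P X i e" "e < n" "r < n"
    and "es ! r \<in> insert (es ! e) X" "snd (es ! r) = snd (es ! e)" "es ! r \<notin> grow X (es ! e)"
    and "e' < n \<and> es ! r \<succ> es ! e' \<and> rk (es ! e') = Suc (rk (es ! r)) \<or> e' = n \<and> \<not> (\<exists>d. es ! r \<succ> d)"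
  shows "proposing (insert (es ! e) P) (insert (es ! e) X - {es ! r}) i e'"
proof -
  let ?e = "es ! e" and ?r = "es ! r" and ?P = "insert (es ! e) P" and ?X = "insert (es ! e) X - {es ! r}"
  note p = assms(1)[unfolded proposing_def]
  have ps: "proposal_state P X" and new: "?e \<notin> P" and up: "\<And>d. d \<succ> ?e \<Longrightarrow> d \<in> P \<and> d \<notin> X"
    using p assms(2) by blast+
  note q = ps[unfolded proposal_state_def]
  have XP: "X \<subseteq> P" and XE: "X \<subseteq> E" using q by blast+
  have eX: "?e \<notin> X" using XP new by blast
  have rin: "?r \<in> insert ?e (at_F (snd ?e) X)" using assms(4,5) by simp
  have "grow X ?e = insert ?e (at_F (snd ?e) X) - {?r}"
    by (rule proposal_displaces[OF ps nth_E[OF assms(2)] eX rin assms(6)])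
  moreover have "at_F (snd ?e) X \<subseteq> X" by (simp add: at_F_def)
  moreover have "?r \<notin> X - at_F (snd ?e) X" using assms(5) by simp
  ultimately have "?X = (X - at_F (snd ?e) X) \<union> grow X ?e" by blast
  then have ps': "proposal_state ?P ?X" using proposal_step[OF ps nth_E[OF assms(2)] new up] by blast
  note q' = ps'[unfolded proposal_state_def]
  have rP: "?r \<in> ?P" using assms(4) XP by blast
  have rX: "?r \<notin> ?X" by simp
  have own: "\<exists>j < i. j < n \<and> rk (es ! j) = 0 \<and> fst (es ! j) = fst x" if "x \<in> ?P" for x
  proof (cases "x = ?e")
    case True then show ?thesis using p assms(2) by simp
  next
    case False then have "x \<in> P" using that by simp
    then show ?thesis using p by simp
  qed
  have act: "es ! e' \<notin> ?P \<and> (\<forall>d. d \<succ> es ! e' \<longrightarrow> d \<in> ?P \<and> d \<notin> ?X) \<and>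
      (\<exists>j < i. j < n \<and> rk (es ! j) = 0 \<and> fst (es ! j) = fst (es ! e'))" if "e' < n"
  proof (intro conjI allI impI)
    have e': "?r \<succ> es ! e'" "rk (es ! e') = Suc (rk ?r)" using assms(7) that by auto
    show "es ! e' \<notin> ?P"
    proof
      assume "es ! e' \<in> ?P"
      then have cases: "es ! e' = ?e \<or> es ! e' \<in> P" by blast
      then have "?r \<in> P \<and> ?r \<notin> X" using q up e'(1) by metis
      then show False using assms(4) new by auto
    qed
    fix d assume d: "d \<succ> es ! e'"
    have "d = ?r \<or> d \<succ> ?r"
    proof -
      have "d \<in> E" "fst d = fst ?r" using d e'(1) unfolding better_def by simp_all
      then have "d = ?r \<or> d \<succ> ?r \<or> ?r \<succ> d" using better_total[of d ?r] nth_E[OF assms(3)] by blast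
      moreover have "\<not> ?r \<succ> d"
      proof
        assume "?r \<succ> d"
        then have "es ! e' = d \<or> es ! e' \<succ> d" by (rule next_le[OF e'])
        then show False using d better_asym better_irrefl by metis
      qed
      ultimately show ?thesis by blast
    qed
    then show "d \<in> ?P" "d \<notin> ?X" using rP q' by blast+
  next
    have "?r \<succ> es ! e'" using assms(7) that by auto
    then have fst: "fst (es ! e') = fst ?r" by (simp add: better_def)
    show "\<exists>j < i. j < n \<and> rk (es ! j) = 0 \<and> fst (es ! j) = fst (es ! e')"
      unfolding fst by (rule own[OF rP])
  qed
  have cov: "(\<exists>x \<in> ?X. fst x = fst (es ! j)) \<or>
        (\<forall>d \<in> E. fst d = fst (es ! j) \<longrightarrow> d \<in> ?P) \<or> (e' < n \<and> fst (es ! e') = fst (es ! j))"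
    if j: "j < i" "j < n" "rk (es ! j) = 0" for j
  proof (cases "fst (es ! j) = fst ?r")
    case True
    show ?thesis
    proof (cases "e' < n")
      case True
      then have "?r \<succ> es ! e'" using assms(7) by auto
      then show ?thesis using True \<open>fst (es ! j) = fst ?r\<close> by (simp add: better_def)
    next
      case False
      then have none: "\<not> ?r \<succ> d" for d using assms(7) by blast
      have "d \<in> ?P" if "d \<in> E" "fst d = fst (es ! j)" for d
      proof -
        have "d = ?r \<or> d \<succ> ?r"
          using better_total[of d ?r] none that True nth_E[OF assms(3)] by metis
        then show ?thesis using rP q' by blast
      qed
      then show ?thesis by blast
    qed
  next
    case False
    consider x where "x \<in> X" "fst x = fst (es ! j)" | "\<forall>d \<in> E. fst d = fst (es ! j) \<longrightarrow> d \<in> P"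
      | "fst ?e = fst (es ! j)" using p j by blast
    then show ?thesis
    proof cases
      case 1 then have "x \<in> ?X" using False by auto
      then show ?thesis using 1 by blast
    next
      case 2 then show ?thesis by blast
    next
      case 3 then have "?e \<in> ?X" using False by auto
      then show ?thesis using 3 by blast
    qed
  qed
  show ?thesis unfolding proposing_def using ps' act cov own by blast
qed


text \<open>Every round of the inner loop makes a new proposal, so the number of proposals measures the time.\<close>

lemma wp_run_proposals:
  assumes st: "static s" and li: "linked s" and empty: "matched (arr s ''cur'') = {}"
    and P: "\<And>s' t'. frame {''i'', ''e'', ''r'', ''k''} {''cur'', ''ans''} s s' \<Longrightarrow>
       least_stable G (matched (arr s' ''cur'')) \<Longrightarrow>
       t' \<le> t + 2 + 5 * n + n * (4 * n + 9) \<Longrightarrow> P s' t'"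
  shows "wp D Q run_proposals P s t"
proof -
  \<comment> \<open>the invariants of the inner loop (in round \<open>i\<close>) and of the outer loop\<close>
  define I where "I = (\<lambda>i s' t'. frame {''i'', ''e'', ''r'', ''k''} {''cur'', ''ans''} s s' \<and>
     reg s' ''e'' \<le> n \<and> reg s' ''i'' = i \<and> i < n \<and>
     (\<exists>P. proposing P (matched (arr s' ''cur'')) (Suc i) (reg s' ''e'') \<and>
        t' \<le> t + 4 + 5 * i + card P * (4 * n + 9)))"
  define J where "J = (\<lambda>s' t'. frame {''i'', ''e'', ''r'', ''k''} {''cur'', ''ans''} s s' \<and>
     reg s' ''i'' \<le> n \<and> (\<exists>P. proposing P (matched (arr s' ''cur'')) (reg s' ''i'') n \<and>
        t' \<le> t + 1 + 5 * reg s' ''i'' + card P * (4 * n + 9)))"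
  have cardP: "card P * (4 * n + 9) \<le> n * (4 * n + 9)" if "proposing P X i e" for P X i e
  proof -
    have "P \<subseteq> E" using that unfolding proposing_def proposal_state_def by blast
    then have "card P \<le> n" using card_mono[OF finite_E] card_E by metis
    then show ?thesis by (rule mult_le_mono1)
  qed
  show ?thesis unfolding run_proposals_def wp_simps
  proof (rule wp_Loop[where I = J and T = "t + 1 + 5 * n + n * (4 * n + 9)"], goal_cases)
    case 1 show ?case using proposing_start empty by (auto simp: J_def intro!: exI[of _ "{}"])
  next
    case (2 s' t')
    then obtain P where P: "proposing P (matched (arr s' ''cur'')) (reg s' ''i'') n"
        "t' \<le> t + 1 + 5 * reg s' ''i'' + card P * (4 * n + 9)" "reg s' ''i'' \<le> n" by (auto simp: J_def)
    then show ?case using cardP[OF P(1)] by linarith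
  next
    case (4 s1 t1)
    then have fr: "frame {''i'', ''e'', ''r'', ''k''} {''cur'', ''ans''} s s1" by (simp add: J_def)
    have "static s1" by (rule static_frame[OF st fr]) simp_all
    then have i: "reg s1 ''i'' = n" using 4 by (simp add: J_def static_def)
    obtain Q where Q: "proposing Q (matched (arr s1 ''cur'')) n n" "t1 \<le> t + 1 + 5 * n + card Q * (4 * n + 9)"
      using 4(1) i by (auto simp: J_def)
    show ?case by (rule P[OF fr proposing_end[OF Q(1)]]) (use cardP[OF Q(1)] Q(2) in linarith)
  next
    case (3 s1 t1)
    then have fr1: "frame {''i'', ''e'', ''r'', ''k''} {''cur'', ''ans''} s s1" by (simp add: J_def)
    have st1: "static s1" by (rule static_frame[OF st fr1]) simp_all
    let ?i = "reg s1 ''i''"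
    have i: "?i < n" using 3(2) st1 by (simp add: static_def)
    obtain P1 where P1: "proposing P1 (matched (arr s1 ''cur'')) ?i n"
        "t1 \<le> t + 1 + 5 * ?i + card P1 * (4 * n + 9)" using 3(1) by (auto simp: J_def)
    have start: "I ?i (set_reg ''e'' (if rk (es ! ?i) = 0 then ?i else n) s1) (Suc (Suc (Suc t1)))"
      using P1(2) fr1 i proposing_next[OF P1(1) i] by (auto simp: I_def intro!: exI[of _ P1])
    have loop: "wp D Q (Loop (Less (Reg ''e'') (Reg ''nE''))
      (Store ''cur'' (Reg ''e'') (Num 1) ;; Ask (Cell ''endF'' (Reg ''e'')) ''cur'' ''ans'' ;;
       find_displaced ;;
       Cond (Less (Reg ''r'') (Reg ''nE''))
         (Store ''cur'' (Reg ''r'') (Num 0) ;; Assign ''e'' (Cell ''nxt'' (Reg ''r'')))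
         (Assign ''e'' (Reg ''nE''))))
      (\<lambda>s' t'. wp D Q (Assign ''i'' (Inc (Reg ''i''))) J s' t') s2 t2" if "I ?i s2 t2" for s2 t2
    proof (rule wp_Loop[where I = "I ?i" and T = "t + 4 + 5 * ?i + n * (4 * n + 9)"], goal_cases)
      case 1 then show ?case by (rule that)
    next
      case (2 s' t')
      then obtain P where P: "proposing P (matched (arr s' ''cur'')) (Suc ?i) (reg s' ''e'')"
          "t' \<le> t + 4 + 5 * ?i + card P * (4 * n + 9)" by (auto simp: I_def)
      then show ?case using cardP[OF P(1)] by linarith
    next
      case (4 s3 t3)
      then have fr: "frame {''i'', ''e'', ''r'', ''k''} {''cur'', ''ans''} s s3" by (simp add: I_def)
      have "static s3" by (rule static_frame[OF st fr]) simp_all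
      then have "reg s3 ''e'' = n" using 4 by (simp add: I_def static_def)
      then show ?case using 4(1) fr unfolding wp_simps by (auto simp: I_def J_def)
    next
      case (3 s3 t3)
      then have fr3: "frame {''i'', ''e'', ''r'', ''k''} {''cur'', ''ans''} s s3" by (simp add: I_def)
      have st3: "static s3" by (rule static_frame[OF st fr3]) simp_all
      let ?e = "reg s3 ''e''" and ?X = "matched (arr s3 ''cur'')"
      have e: "?e < n" using 3(2) st3 by (simp add: static_def)
      obtain P3 where P3: "proposing P3 ?X (Suc ?i) ?e"
          "t3 \<le> t + 4 + 5 * ?i + card P3 * (4 * n + 9)" using 3(1) by (auto simp: I_def)
      have newP: "es ! ?e \<notin> P3" using P3(1) e unfolding proposing_def by blast
      have XE: "?X \<subseteq> E" by (rule matched_sub)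
      have "P3 \<subseteq> E" using P3(1) unfolding proposing_def proposal_state_def by blast
      then have "finite P3" using finite_E finite_subset by blast
      then have card': "card (insert (es ! ?e) P3) = Suc (card P3)" using newP by simp
      define s4 where "s4 = set_arr ''cur'' ((arr s3 ''cur'')(?e := 1)) s3"
      define s5 where "s5 = ask D Q (snd (es ! ?e)) ''cur'' ''ans'' s4"
      have X4: "matched (arr s4 ''cur'') = insert (es ! ?e) ?X" using matched_insert[OF e] by (simp add: s4_def)
      have fr4: "frame {''i'', ''e'', ''r'', ''k''} {''cur'', ''ans''} s s4" using fr3 by (simp add: s4_def)
      have st4: "static s4" by (rule static_frame[OF st fr4]) simp_all
      have fr5: "frame {''i'', ''e'', ''r'', ''k''} {''cur'', ''ans''} s s5" using fr4 by (simp add: s5_def)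
      have st5: "static s5" by (rule static_frame[OF st fr5]) simp_all
      have li5: "linked s5" by (rule linked_frame[OF li fr5]) simp
      have reg5: "reg s5 = reg s3" "arr s5 ''cur'' = (arr s3 ''cur'')(?e := 1)" by (simp_all add: s5_def s4_def arr_ask)
      have ans: "arr s5 ''ans'' k \<noteq> 0 \<longleftrightarrow> es ! k \<in> grow ?X (es ! ?e)" if "k < n" "snd (es ! k) = snd (es ! ?e)" for k
        using ask_answer[OF st4 e that] unfolding X4 s5_def by (simp add: at_F_insert)
      have endF: "exp_val (Cell ''endF'' (Reg ''e'')) s4 = snd (es ! ?e)" using st4 e by (simp add: static_def s4_def)
      show ?case
        unfolding wp_simps
      proof (simp only: exp_val.simps One_nat_def[symmetric], fold s4_def, insert endF, simp only: exp_val.simps, fold s5_def,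
          rule wp_find_displaced, goal_cases)
        case 1 show ?case by (rule st5)
      next
        case 2 show ?case using e reg5 by simp
      next
        case (3 s6 t6)
        have fr6: "frame {''i'', ''e'', ''r'', ''k''} {''cur'', ''ans''} s s6" by (rule frame_trans[OF fr5 3(2)]) simp_all
        have st6: "static s6" by (rule static_frame[OF st5 3(2)]) simp_all
        have li6: "linked s6" by (rule linked_frame[OF li5 3(2)]) simp
        have cur6: "arr s6 ''cur'' = (arr s3 ''cur'')(?e := 1)" "reg s6 ''i'' = ?i"
          using 3(2) reg5 \<open>I ?i s3 t3\<close> by (simp_all add: frame_def I_def)
        have X6: "matched (arr s6 ''cur'') = insert (es ! ?e) ?X" using matched_insert[OF e] cur6 by simp
        let ?r = "reg s6 ''r''"
        have time: "t6 + 3 \<le> t + 4 + 5 * ?i + card (insert (es ! ?e) P3) * (4 * n + 9)"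
          using 3(3) P3(2) unfolding card' by simp
        show ?case
        proof (cases "?r < n")
          case True
          then have r: "arr s5 ''cur'' ?r \<noteq> 0" "snd (es ! ?r) = snd (es ! ?e)" "arr s5 ''ans'' ?r = 0"
            using 3(4) reg5 by auto
          have rX: "es ! ?r \<in> insert (es ! ?e) ?X"
            using r(1) True cur6 X6 reg5 matched_iff by metis
          have rg: "es ! ?r \<notin> grow ?X (es ! ?e)" using ans[OF True r(2)] r(3) by simp
          let ?e' = "arr s6 ''nxt'' ?r"
          have nx: "?e' < n \<and> es ! ?r \<succ> es ! ?e' \<and> rk (es ! ?e') = Suc (rk (es ! ?r)) \<or>
              ?e' = n \<and> \<not> (\<exists>d. es ! ?r \<succ> d)" using li6 True by (simp add: linked_def)
          then have "?e' \<le> n" by auto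
          then show ?thesis
            using True st6 proposing_displace[OF P3(1) e True rX r(2) rg nx] matched_remove[OF True] X6 cur6 fr6 i time
            by (auto simp: I_def static_def)
        next
          case False
          then have none: "?r = n" "\<And>k. k < n \<Longrightarrow> arr s5 ''cur'' k \<noteq> 0 \<Longrightarrow> snd (es ! k) = snd (es ! ?e) \<Longrightarrow>
              arr s5 ''ans'' k \<noteq> 0" using 3(4) reg5 by auto
          have "x \<in> grow ?X (es ! ?e)" if x: "x \<in> insert (es ! ?e) ?X" "snd x = snd (es ! ?e)" for x
          proof -
            have "x \<in> E" using x(1) XE nth_E[OF e] by blast
            then obtain k where k: "k < n" "x = es ! k" using E_nth by blast
            then have "arr s5 ''cur'' k \<noteq> 0" using x(1) X6 cur6 reg5 matched_iff by metis
            then show ?thesis using none(2)[OF k(1)] ans[OF k(1)] x(2) k(2) by simp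
          qed
          then have "proposing (insert (es ! ?e) P3) (insert (es ! ?e) ?X) (Suc ?i) n"
            by (rule proposing_accept[OF P3(1) e])
          then show ?thesis using False none(1) st6 X6 cur6 fr6 i time by (auto simp: I_def static_def)
        qed
      qed
    qed
    have "exp_val (Cell ''rank'' (Reg ''i'')) s1 = rk (es ! ?i)" "reg s1 ''nE'' = n"
      using st1 i by (simp_all add: static_def)
    then show ?case unfolding wp_simps using loop[OF start, unfolded wp_simps]
      by (cases "rk (es ! ?i) = 0") simp_all
  qed
qed

lemma rk_less_n:
  assumes "e < n"
  shows "rk (es ! e) < n"
proof -
  have "insert (es ! e) {e'. e' \<succ> es ! e} \<subseteq> E"
    using nth_E[OF assms] unfolding better_def by (simp add: Collect_mono subset_eq)
  then have "card (insert (es ! e) {e'. e' \<succ> es ! e}) \<le> n"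
    using card_mono[OF finite_E] card_E by metis
  then show ?thesis using finite_better better_irrefl unfolding rk_def by simp
qed


lemma wp_probe:
  assumes st: "static s" and e: "reg s ''e'' < n" "arr s ''cur'' (reg s ''e'') = 0"
    and P: "\<And>s'. frame {} {''ans''} s s' \<Longrightarrow>
      (\<And>k. k < n \<Longrightarrow> snd (es ! k) = snd (es ! reg s ''e'') \<Longrightarrow>
         arr s' ''ans'' k \<noteq> 0 \<longleftrightarrow> es ! k \<in> grow (matched (arr s ''cur'')) (es ! reg s ''e'')) \<Longrightarrow>
      P s' (t + 3)"
  shows "wp D Q probe P s t"
proof -
  let ?e = "reg s ''e''"
  define s1 where "s1 = set_arr ''cur'' ((arr s ''cur'')(?e := 1)) s"
  define s2 where "s2 = ask D Q (snd (es ! ?e)) ''cur'' ''ans'' s1"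
  have st1: "static s1" using st by (simp add: static_def s1_def)
  have X1: "matched (arr s1 ''cur'') = insert (es ! ?e) (matched (arr s ''cur''))"
    using matched_insert[OF e(1)] by (simp add: s1_def)
  have endF: "arr s1 ''endF'' (reg s1 ''e'') = snd (es ! ?e)" using st1 e by (simp add: static_def s1_def)
  define s3 where "s3 = set_arr ''cur'' ((arr s2 ''cur'')(?e := 0)) s2"
  have "arr s3 ''cur'' = arr s ''cur''" using e by (simp add: s3_def s2_def s1_def arr_ask fun_upd_idem)
  then have fr: "frame {} {''ans''} s s3"
    by (simp add: frame_def s3_def) (simp add: s2_def s1_def arr_ask)
  have "arr s3 ''ans'' k \<noteq> 0 \<longleftrightarrow> es ! k \<in> grow (matched (arr s ''cur'')) (es ! ?e)"
    if "k < n" "snd (es ! k) = snd (es ! ?e)" for k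
    using ask_answer[OF st1 e(1) that] unfolding X1 by (simp add: s3_def s2_def at_F_insert)
  from P[OF fr this] have "P s3 (t + 3)" .
  then show ?thesis using endF unfolding probe_def wp_simps s3_def s2_def s1_def
    by (simp add: numeral_3_eq_3)
qed


text \<open>While no wanted edge has been found, the rank of the current edge bounds the number of rounds.\<close>

lemma wp_first_wanted:
  assumes st: "static s" and li: "linked s" and X: "stable G (matched (arr s ''cur''))"
    and x: "reg s ''x'' < n" "arr s ''cur'' (reg s ''x'') \<noteq> 0"
    and P: "\<And>s' t'. frame {''e'', ''ok''} {''ans''} s s' \<Longrightarrow> t' \<le> t + 6 * n + 9 \<Longrightarrow>
      reg s' ''e'' < n \<and> W_admissible G (matched (arr s ''cur'')) (es ! reg s' ''e'') \<and>
         fst (es ! reg s' ''e'') = fst (es ! reg s ''x'') \<and>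
         (\<forall>k < n. snd (es ! k) = snd (es ! reg s' ''e'') \<longrightarrow>
           (arr s' ''ans'' k \<noteq> 0 \<longleftrightarrow> es ! k \<in> grow (matched (arr s ''cur'')) (es ! reg s' ''e''))) \<or>
      reg s' ''e'' = n \<and> (\<forall>d. es ! reg s ''x'' \<succ> d \<longrightarrow> d \<notin> grow (matched (arr s ''cur'')) d) \<Longrightarrow> P s' t'"
  shows "wp D Q first_wanted P s t"
proof -
  let ?X = "matched (arr s ''cur'')" and ?x = "es ! reg s ''x''"
  define I where "I = (\<lambda>s' t'. frame {''e'', ''ok''} {''ans''} s s' \<and>
    (reg s' ''e'' < n \<and> ?x \<succ> es ! reg s' ''e'' \<and>
       (\<forall>d. ?x \<succ> d \<longrightarrow> d = es ! reg s' ''e'' \<or> es ! reg s' ''e'' \<succ> d \<or> d \<notin> grow ?X d) \<and>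
       (reg s' ''ok'' = 0 \<and> t' \<le> t + 2 + 6 * rk (es ! reg s' ''e'') \<or>
        reg s' ''ok'' \<noteq> 0 \<and> t' \<le> t + 8 + 6 * n \<and> es ! reg s' ''e'' \<in> grow ?X (es ! reg s' ''e'') \<and>
        (\<forall>k < n. snd (es ! k) = snd (es ! reg s' ''e'') \<longrightarrow>
           (arr s' ''ans'' k \<noteq> 0 \<longleftrightarrow> es ! k \<in> grow ?X (es ! reg s' ''e''))))
     \<or> reg s' ''e'' = n \<and> reg s' ''ok'' = 0 \<and> t' \<le> t + 2 + 6 * n \<and> (\<forall>d. ?x \<succ> d \<longrightarrow> d \<notin> grow ?X d)))"
  have xX: "?x \<in> ?X" using x by simp
  have notX: "arr s ''cur'' k = 0" if "k < n" "?x \<succ> es ! k" for k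
  proof (rule ccontr)
    assume "arr s ''cur'' k \<noteq> 0"
    then have "es ! k \<in> ?X" using that(1) by simp
    then have "es ! k = ?x" using stable_unique[OF X _ xX] that(2) unfolding better_def by metis
    then show False using that(2) better_irrefl by simp
  qed
  show ?thesis unfolding first_wanted_def wp_simps
  proof (rule wp_Loop[where I = I and T = "t + 8 + 6 * n"], goal_cases)
    case 1
    let ?e = "arr s ''nxt'' (reg s ''x'')"
    have nx: "?e < n \<and> ?x \<succ> es ! ?e \<and> rk (es ! ?e) = Suc (rk ?x) \<or> ?e = n \<and> \<not> (\<exists>d. ?x \<succ> d)"
      using li x(1) by (simp add: linked_def)
    have "\<forall>d. ?x \<succ> d \<longrightarrow> d = es ! ?e \<or> es ! ?e \<succ> d" if "?e < n"
    proof (intro allI impI)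
      fix d assume "?x \<succ> d"
      then show "d = es ! ?e \<or> es ! ?e \<succ> d" using nx that next_le[of ?x "es ! ?e" d] by auto
    qed
    then show ?case using nx by (auto simp: I_def)
  next
    case (2 s' t')
    have "reg s' ''e'' < n \<longrightarrow> rk (es ! reg s' ''e'') \<le> n" using rk_less_n less_imp_le by blast
    then show ?case using 2 unfolding I_def by linarith
  next
    case (3 s1 t1)
    then have fr1: "frame {''e'', ''ok''} {''ans''} s s1" by (simp add: I_def)
    have st1: "static s1" by (rule static_frame[OF st fr1]) simp_all
    have li1: "linked s1" by (rule linked_frame[OF li fr1]) simp
    let ?e = "reg s1 ''e''"
    have e: "?e < n" "reg s1 ''ok'' = 0" using 3(2) st1 by (simp_all add: static_def)
    have xe: "?x \<succ> es ! ?e" and before: "\<forall>d. ?x \<succ> d \<longrightarrow> d = es ! ?e \<or> es ! ?e \<succ> d \<or> d \<notin> grow ?X d"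
      and t1: "t1 \<le> t + 2 + 6 * rk (es ! ?e)" using 3(1) e by (auto simp: I_def)
    have cur1: "arr s1 ''cur'' = arr s ''cur''" using fr1 by (simp add: frame_def)
    show ?case unfolding wp_Seq
    proof (rule wp_probe[OF st1 e(1)], goal_cases)
      case 1 show ?case using notX[OF e(1) xe] cur1 by simp
    next
      case (2 s2)
      have fr2: "frame {''e'', ''ok''} {''ans''} s s2" by (rule frame_trans[OF fr1 2(1)]) simp_all
      have e2: "reg s2 ''e'' = ?e" "reg s2 ''ok'' = 0" "arr s2 ''nxt'' = arr s1 ''nxt''"
        using 2(1) e(2) by (simp_all add: frame_def)
      have ans: "arr s2 ''ans'' k \<noteq> 0 \<longleftrightarrow> es ! k \<in> grow ?X (es ! ?e)" if "k < n" "snd (es ! k) = snd (es ! ?e)" for k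
        using 2(2)[OF that] cur1 by simp
      have rkn: "rk (es ! ?e) < n" by (rule rk_less_n[OF e(1)])
      show ?case
      proof (cases "arr s2 ''ans'' ?e = 0")
        case False
        let ?s3 = "set_reg ''ok'' 1 s2"
        have "es ! ?e \<in> grow ?X (es ! ?e)" using ans[OF e(1)] False by simp
        moreover have "\<forall>k < n. snd (es ! k) = snd (es ! ?e) \<longrightarrow>
            (arr ?s3 ''ans'' k \<noteq> 0 \<longleftrightarrow> es ! k \<in> grow ?X (es ! ?e))" using ans by simp
        moreover have "reg ?s3 ''e'' = ?e" "reg ?s3 ''ok'' \<noteq> 0" using e2 by simp_all
        moreover have "Suc (Suc (Suc t1 + 3)) \<le> t + 8 + 6 * n" using t1 rkn by simp
        moreover have "frame {''e'', ''ok''} {''ans''} s ?s3" using fr2 by simp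
        ultimately have "I ?s3 (Suc (Suc (Suc t1 + 3)))"
          unfolding I_def using e(1) xe before by metis
        then show ?thesis using False e2 unfolding wp_simps by simp
      next
        case True
        then have no: "es ! ?e \<notin> grow ?X (es ! ?e)" using ans[OF e(1)] by simp
        let ?e' = "arr s1 ''nxt'' ?e"
        have nx: "?e' < n \<and> es ! ?e \<succ> es ! ?e' \<and> rk (es ! ?e') = Suc (rk (es ! ?e)) \<or>
            ?e' = n \<and> \<not> (\<exists>d. es ! ?e \<succ> d)" using li1 e(1) by (simp add: linked_def)
        have "?x \<succ> es ! ?e'" "\<forall>d. ?x \<succ> d \<longrightarrow> d = es ! ?e' \<or> es ! ?e' \<succ> d \<or> d \<notin> grow ?X d" if "?e' < n"
        proof -
          have e': "es ! ?e \<succ> es ! ?e'" "rk (es ! ?e') = Suc (rk (es ! ?e))" using nx that by auto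
          show "?x \<succ> es ! ?e'" by (rule better_trans[OF xe e'(1)])
          show "\<forall>d. ?x \<succ> d \<longrightarrow> d = es ! ?e' \<or> es ! ?e' \<succ> d \<or> d \<notin> grow ?X d"
            using before no next_le[OF e'] by metis
        qed
        moreover have "\<forall>d. ?x \<succ> d \<longrightarrow> d \<notin> grow ?X d" if "?e' = n"
          using before no nx that by (metis less_irrefl)
        ultimately show ?thesis using True e2 nx t1 rkn fr2 unfolding wp_simps by (auto simp: I_def)
      qed
    qed
  next
    case (4 s1 t1)
    then have fr1: "frame {''e'', ''ok''} {''ans''} s s1" by (simp add: I_def)
    have st1: "static s1" by (rule static_frame[OF st fr1]) simp_all
    let ?e = "reg s1 ''e''"
    show ?case
    proof (rule P[OF fr1], goal_cases)
      case 1
      have "?e < n \<longrightarrow> rk (es ! ?e) < n" using rk_less_n by blast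
      then show ?case using 4(1) by (auto simp: I_def)
    next
      case 2
      show ?case
      proof (cases "?e < n")
        case True
        then have "reg s1 ''ok'' \<noteq> 0" using 4(2) st1 by (simp add: static_def)
        then have a: "?x \<succ> es ! ?e" "es ! ?e \<in> grow ?X (es ! ?e)"
          "\<forall>d. ?x \<succ> d \<longrightarrow> d = es ! ?e \<or> es ! ?e \<succ> d \<or> d \<notin> grow ?X d"
          "\<forall>k < n. snd (es ! k) = snd (es ! ?e) \<longrightarrow> (arr s1 ''ans'' k \<noteq> 0 \<longleftrightarrow> es ! k \<in> grow ?X (es ! ?e))"
          using 4(1) True by (auto simp: I_def)
        have "W_admissible G ?X (es ! ?e)"
          unfolding W_admissible_iff[OF X] using xX a(1-3) by blast
        moreover have "fst (es ! ?e) = fst ?x" using a(1) by (simp add: better_def)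
        ultimately show ?thesis using True a(4) by blast
      next
        case False
        then show ?thesis using 4(1) by (auto simp: I_def)
      qed
    qed
  qed
qed


lemma wp_find_tandem:
  assumes st: "static s" and li: "linked s" and X: "stable G (matched (arr s ''cur''))"
    and x: "reg s ''x'' < n" "arr s ''cur'' (reg s ''x'') \<noteq> 0"
    and P: "\<And>s' t'. frame {''e'', ''ok'', ''r'', ''k''} {''ans''} s s' \<Longrightarrow> t' \<le> t + 10 * n + 13 \<Longrightarrow>
      reg s' ''e'' < n \<and> reg s' ''r'' < n \<and> fst (es ! reg s' ''e'') = fst (es ! reg s ''x'') \<and>
         tandem G (matched (arr s ''cur'')) (es ! reg s' ''e'') (es ! reg s' ''r'') \<or>
      reg s' ''r'' = n \<and> (\<forall>a b. fst a = fst (es ! reg s ''x'') \<longrightarrow> \<not> tandem G (matched (arr s ''cur'')) a b) \<Longrightarrow>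
      P s' t'"
  shows "wp D Q find_tandem P s t"
  unfolding find_tandem_def wp_Seq
proof (rule wp_first_wanted[OF st li X x], goal_cases)
  case (1 s1 t1)
  let ?X = "matched (arr s ''cur'')" and ?x = "es ! reg s ''x''" and ?e = "reg s1 ''e''"
  have xX: "?x \<in> ?X" using x by simp
  have st1: "static s1" by (rule static_frame[OF st 1(1)]) simp_all
  have fr1: "frame {''e'', ''ok'', ''r'', ''k''} {''ans''} s s1"
    by (rule frame_trans[OF frame_refl 1(1)]) simp_all
  have cur1: "arr s1 ''cur'' = arr s ''cur''" using fr1 by (simp add: frame_def)
  have nE: "reg s1 ''nE'' = n" using st1 by (simp add: static_def)
  show ?case
  proof (cases "?e < n")
    case False
    then have e: "?e = n" "\<forall>d. ?x \<succ> d \<longrightarrow> d \<notin> grow ?X d" using 1(3) by auto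
    have no: "\<not> tandem G ?X a b" if "fst a = fst ?x" for a b
    proof
      assume t: "tandem G ?X a b"
      obtain y where y: "y \<in> ?X" "y \<succ> a" "a \<in> grow ?X a"
        using tandemD(1)[OF X t] unfolding W_admissible_iff[OF X] by blast
      have "y = ?x" using stable_unique[OF X y(1) xX] y(2) that unfolding better_def by metis
      then show False using e(2) y by simp
    qed
    show ?thesis unfolding wp_simps
      using P[of "set_reg ''r'' n s1" "Suc (Suc t1)"] False no fr1 1(2) nE by simp
  next
    case True
    then have a: "W_admissible G ?X (es ! ?e)" "fst (es ! ?e) = fst ?x"
      and ans: "\<And>k. k < n \<Longrightarrow> snd (es ! k) = snd (es ! ?e) \<Longrightarrow>
           (arr s1 ''ans'' k \<noteq> 0 \<longleftrightarrow> es ! k \<in> grow ?X (es ! ?e))" using 1(3) by auto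
    have "wp D Q find_displaced P s1 (Suc t1)"
    proof (rule wp_find_displaced[OF st1 True], goal_cases)
      case (1 s2 t2)
      note found = 1(3)
      have time: "t2 \<le> t + 10 * n + 13" using 1(2) \<open>t1 \<le> t + 6 * n + 9\<close> by simp
      have fr2: "frame {''e'', ''ok'', ''r'', ''k''} {''ans''} s s2" by (rule frame_trans[OF fr1 1(1)]) simp_all
      have e2: "reg s2 ''e'' = ?e" using 1(1) by (simp add: frame_def)
      show ?case
      proof (rule P[OF fr2], goal_cases)
        case 1
        show ?case by (rule time)
      next
        case 2
        show ?case
        proof (cases "reg s2 ''r'' < n")
          case True
          then have r: "es ! reg s2 ''r'' \<in> ?X" "snd (es ! reg s2 ''r'') = snd (es ! ?e)"
            "es ! reg s2 ''r'' \<notin> grow ?X (es ! ?e)" using found ans[OF True] cur1 by auto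
          then have "tandem G ?X (es ! ?e) (es ! reg s2 ''r'')" by (rule tandemI[OF X a(1)])
          then show ?thesis using True a(2) e2 \<open>?e < n\<close> by simp
        next
          case False
          then have none: "reg s2 ''r'' = n" "\<And>k. k < n \<Longrightarrow> arr s ''cur'' k \<noteq> 0 \<Longrightarrow> snd (es ! k) = snd (es ! ?e) \<Longrightarrow>
            arr s1 ''ans'' k \<noteq> 0" using found cur1 by auto
          have "\<not> tandem G ?X c b" if "fst c = fst ?x" for c b
          proof
            assume t: "tandem G ?X c b"
            then have c: "c = es ! ?e"
              using W_admissible_unique[OF X tandemD(1)[OF X t] a(1)] that a(2) by simp
            note t' = tandemD[OF X t]
            have "b \<in> E" using t'(4) matched_sub by blast
            then obtain k where k: "k < n" "b = es ! k" using E_nth by blast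
            then have "arr s ''cur'' k \<noteq> 0" using t'(4) by simp
            then have "b \<in> grow ?X c" using none(2)[OF k(1)] ans[OF k(1)] k(2) t'(5) c by simp
            then show False using t'(6,7) by simp
          qed
          then show ?thesis using none(1) by simp
        qed
      qed
    qed
    then show ?thesis unfolding wp_simps using True nE by simp
  qed
qed


section \<open>The search for rotations\<close>

text \<open>\<open>stk\<close> holds a path of matched edges in which every edge displaces the next one, via the
  edges in \<open>alt\<close>; the flags \<open>fin\<close> mark edges which belong to every better stable matching.\<close>

definition search_inv ::
  "(nat \<times> nat) set \<Rightarrow> nat \<Rightarrow> (nat \<Rightarrow> nat) \<Rightarrow> (nat \<Rightarrow> nat) \<Rightarrow> (nat \<Rightarrow> nat) \<Rightarrow> (nat \<Rightarrow> nat) \<Rightarrow> bool" where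
  "search_inv X ht stk alt ons fin \<longleftrightarrow> stable G X \<and>
     (\<forall>t < ht. stk t < n \<and> es ! stk t \<in> X \<and> fin (stk t) = 0) \<and> inj_on stk {..<ht} \<and>
     (\<forall>k < n. ons k \<noteq> 0 \<longleftrightarrow> k \<in> stk ` {..<ht}) \<and>
     (\<forall>t. Suc t < ht \<longrightarrow> alt t < n \<and> fst (es ! alt t) = fst (es ! stk t) \<and>
        tandem G X (es ! alt t) (es ! stk (Suc t))) \<and>
     (\<forall>k < n. fin k \<noteq> 0 \<longrightarrow> (\<forall>Y. stable G Y \<longrightarrow> leF X Y \<longrightarrow> es ! k \<in> Y))"

text \<open>A new start is the case of the empty stack; otherwise the new entry is displaced by the tandem of the
former top.\<close>

lemma search_push:
  assumes "search_inv X ht stk alt ons fin" "r < n" "es ! r \<in> X" "fin r = 0" "ons r = 0"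
    and "\<And>t. Suc t < ht \<Longrightarrow> alt' t = alt t"
    and "\<And>t. Suc t = ht \<Longrightarrow> alt' t < n \<and> fst (es ! alt' t) = fst (es ! stk t) \<and> tandem G X (es ! alt' t) (es ! r)"
  shows "search_inv X (Suc ht) (stk(ht := r)) alt' (ons(r := 1)) fin"
proof -
  note s = assms(1)[unfolded search_inv_def]
  have new: "r \<notin> stk ` {..<ht}" using s assms(2,5) by blast
  have img: "(stk(ht := r)) ` {..<Suc ht} = insert r (stk ` {..<ht})"
    by (auto simp: lessThan_Suc)
  have "inj_on (stk(ht := r)) {..<Suc ht}"
    using s new by (simp add: lessThan_Suc inj_on_insert inj_on_fun_updI)
  moreover have "alt' t < n \<and> fst (es ! alt' t) = fst (es ! (stk(ht := r)) t) \<and>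
        tandem G X (es ! alt' t) (es ! (stk(ht := r)) (Suc t))" if "Suc t < Suc ht" for t
    using that s assms(6)[of t] assms(7)[of t] by (cases "Suc t = ht") auto
  ultimately show ?thesis using s assms(2-4) unfolding search_inv_def img
    by (simp add: less_Suc_eq)
qed

lemma search_retire:
  assumes "search_inv X ht stk alt ons fin" "0 < ht" "\<And>Y. stable G Y \<Longrightarrow> leF X Y \<Longrightarrow> es ! stk (ht - 1) \<in> Y"
  shows "search_inv X (ht - 1) stk alt (ons(stk (ht - 1) := 0)) (fin(stk (ht - 1) := 1))"
proof -
  note s = assms(1)[unfolded search_inv_def]
  let ?x = "stk (ht - 1)"
  have split: "{..<ht} = insert (ht - 1) {..<ht - 1}" using assms(2) by auto
  have inj: "inj_on stk (insert (ht - 1) {..<ht - 1})" using s unfolding split[symmetric] by blast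
  then have x: "?x \<notin> stk ` {..<ht - 1}" by (simp add: inj_on_insert)
  have ne: "stk t \<noteq> ?x" if "t < ht - 1" for t
    using x that by (metis image_eqI lessThan_iff)
  have ons: "ons k \<noteq> 0 \<longleftrightarrow> k = ?x \<or> k \<in> stk ` {..<ht - 1}" if "k < n" for k
    using s that unfolding split by simp
  show ?thesis unfolding search_inv_def
  proof (intro conjI)
    show "\<forall>t < ht - 1. stk t < n \<and> es ! stk t \<in> X \<and> (fin(?x := 1)) (stk t) = 0"
      using s ne assms(2) by simp
    show "inj_on stk {..<ht - 1}" using inj by (simp add: inj_on_insert)
    show "\<forall>k < n. (ons(?x := 0)) k \<noteq> 0 \<longleftrightarrow> k \<in> stk ` {..<ht - 1}" using ons x by simp
    show "\<forall>k < n. (fin(?x := 1)) k \<noteq> 0 \<longrightarrow> (\<forall>Y. stable G Y \<longrightarrow> leF X Y \<longrightarrow> es ! k \<in> Y)"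
      using s assms(3) by simp
  qed (use s in auto)
qed

text \<open>The retired edges and those in the stack are different edges.\<close>

lemma search_bound:
  assumes "search_inv X ht stk alt ons fin"
  shows "card {k. k < n \<and> fin k \<noteq> 0} + ht \<le> n"
proof -
  note s = assms(1)[unfolded search_inv_def]
  have "card (stk ` {..<ht}) = ht" using s by (simp add: card_image)
  moreover have "{k. k < n \<and> fin k \<noteq> 0} \<inter> stk ` {..<ht} = {}" using s by auto
  then have "card ({k. k < n \<and> fin k \<noteq> 0} \<union> stk ` {..<ht}) =
      card {k. k < n \<and> fin k \<noteq> 0} + card (stk ` {..<ht})"
    by (simp add: card_Un_disjoint)
  moreover have "{k. k < n \<and> fin k \<noteq> 0} \<union> stk ` {..<ht} \<subseteq> {..<n}" using s by auto
  then have "card ({k. k < n \<and> fin k \<noteq> 0} \<union> stk ` {..<ht}) \<le> n"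
    using card_mono[of "{..<n}"] by simp
  ultimately show ?thesis by simp
qed

text \<open>When the path runs into itself, its end is a rotation. Cutting it off does not spoil the
  rest of the path, because the tandems on the rest persist.\<close>

lemma search_cycle:
  assumes "search_inv X ht stk alt ons fin" "q < ht"
    and "\<And>t. Suc t < ht \<Longrightarrow> alt' t = alt t"
    and "\<And>t. Suc t = ht \<Longrightarrow> alt' t < n \<and> fst (es ! alt' t) = fst (es ! stk t) \<and> tandem G X (es ! alt' t) (es ! stk q)"
    and "\<And>k. k < n \<Longrightarrow> ons' k \<noteq> 0 \<longleftrightarrow> ons k \<noteq> 0 \<and> k \<notin> stk ` {q..<ht}"
    and "L = ((\<lambda>t. es ! alt' t) ` {q..<ht}, (\<lambda>t. es ! stk t) ` {q..<ht})"
  shows "L \<in> rotations_at G X"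
    and "search_inv (apply_rotation L X) q stk alt' ons' fin"
    and "t \<in> {q..<ht} \<Longrightarrow> tandem G X (es ! alt' t) (es ! (if Suc t = ht then stk q else stk (Suc t)))"
    and "inj_on (\<lambda>t. es ! alt' t) {q..<ht}" and "inj_on (\<lambda>t. es ! stk t) {q..<ht}"
    and "t < ht \<Longrightarrow> alt' t < n \<and> fst (es ! alt' t) = fst (es ! stk t)"
proof -
  note s = assms(1)[unfolded search_inv_def]
  have X: "stable G X" using s by blast
  let ?d = "\<lambda>t. if Suc t = ht then stk q else stk (Suc t)"
  have alt: "alt' t < n \<and> fst (es ! alt' t) = fst (es ! stk t) \<and> tandem G X (es ! alt' t) (es ! ?d t)"
    if "t < ht" for t
  proof (cases "Suc t = ht")
    case True then show ?thesis using assms(4)[OF True] by simp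
  next
    case False
    then have "Suc t < ht" using that by simp
    then show ?thesis using s assms(3) False by simp
  qed
  then show "t < ht \<Longrightarrow> alt' t < n \<and> fst (es ! alt' t) = fst (es ! stk t)" by blast
  show tan: "tandem G X (es ! alt' t) (es ! ?d t)" if "t \<in> {q..<ht}" for t using alt that by simp
  have inj: "t = u" if "t < ht" "u < ht" "es ! stk t = es ! stk u" for t u
  proof -
    have "stk t = stk u" using s nth_inj that by metis
    then show ?thesis using s that by (meson inj_onD lessThan_iff)
  qed
  have inja: "t = u" if "t < ht" "u < ht" "es ! alt' t = es ! alt' u" for t u
  proof -
    have "fst (es ! stk t) = fst (es ! stk u)" using alt that by metis
    moreover have "es ! stk t \<in> X" "es ! stk u \<in> X" using s that by simp_all
    ultimately have "es ! stk t = es ! stk u" by (intro stable_unique[OF X])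
    then show ?thesis using inj that by blast
  qed
  show ia: "inj_on (\<lambda>t. es ! alt' t) {q..<ht}" using inja by (auto intro!: inj_onI)
  show ist: "inj_on (\<lambda>t. es ! stk t) {q..<ht}" using inj by (auto intro!: inj_onI)
  let ?m = "ht - q"
  define ts where "ts = map (\<lambda>t. (es ! alt' t, es ! ?d t)) [q..<ht]"
  have dq: "?d (q + i) = stk (q + Suc i mod ?m)" if "i < ?m" for i
    using that by (cases "Suc i = ?m") (auto simp: mod_Suc)
  have snds: "set (map snd ts) = (\<lambda>t. es ! stk t) ` {q..<ht}"
  proof -
    have "(\<lambda>t. es ! ?d t) ` {q..<ht} = (\<lambda>t. es ! stk t) ` {q..<ht}"
    proof (intro subset_antisym image_subsetI)
      fix t assume "t \<in> {q..<ht}"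
      then show "es ! ?d t \<in> (\<lambda>t. es ! stk t) ` {q..<ht}" by (cases "Suc t = ht") auto
    next
      fix t assume t: "t \<in> {q..<ht}"
      show "es ! stk t \<in> (\<lambda>t. es ! ?d t) ` {q..<ht}"
      proof (cases "t = q")
        case True
        then show ?thesis using t by (intro image_eqI[of _ _ "ht - 1"]) auto
      next
        case False
        then show ?thesis using t by (intro image_eqI[of _ _ "t - 1"]) auto
      qed
    qed
    then show ?thesis by (simp add: ts_def)
  qed
  have fsts: "set (map fst ts) = (\<lambda>t. es ! alt' t) ` {q..<ht}" by (simp add: ts_def)
  have "tandem_circuit X ts" unfolding tandem_circuit_def
  proof (intro conjI allI impI)
    show "ts \<noteq> []" using assms(2) by (simp add: ts_def)
    show "\<forall>t \<in> set ts. tandem G X (fst t) (snd t)" using tan by (simp add: ts_def)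
    show "distinct (map fst ts)" using ia by (simp add: ts_def comp_def distinct_map)
    have "card (set (map snd ts)) = length (map snd ts)"
      unfolding snds using ist by (simp add: card_image ts_def)
    then show "distinct (map snd ts)" by (rule card_distinct)
    fix i assume "i < length ts"
    then have i: "i < ?m" by (simp add: ts_def)
    have j: "Suc i mod ?m < ?m" using i by simp
    have step: "fst (es ! alt' (q + Suc i mod ?m)) = fst (es ! stk (q + Suc i mod ?m))"
      using alt[of "q + Suc i mod ?m"] j by simp
    have tsn: "ts ! k = (es ! alt' (q + k), es ! ?d (q + k))" if "k < ?m" for k
      using that by (simp add: ts_def)
    have len: "length ts = ?m" by (simp add: ts_def)
    show "fst (snd (ts ! i)) = fst (fst (ts ! (Suc i mod length ts)))"
      by (simp only: len tsn[OF i] tsn[OF j] fst_conv snd_conv dq[OF i] step)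
  qed
  then show L: "L \<in> rotations_at G X" using assms(6) fsts snds rotations_at_iff by metis
  let ?X' = "apply_rotation L X"
  have X': "stable G ?X'" by (rule stable_apply_rotation[OF X L])
  have le: "leF X ?X'" by (rule leF_apply_rotation[OF X L])
  have keep: "es ! stk t \<in> ?X'" if "t < q" for t
  proof -
    have "es ! stk t \<notin> snd L"
    proof
      assume "es ! stk t \<in> snd L"
      then obtain u where "u \<in> {q..<ht}" "es ! stk t = es ! stk u" unfolding assms(6) by auto
      then show False using inj[of t u] that by simp
    qed
    then show ?thesis using s that assms(2) unfolding apply_rotation_def by simp
  qed
  show "search_inv ?X' q stk alt' ons' fin" unfolding search_inv_def
  proof (intro conjI allI impI)
    show "stable G ?X'" by (rule X')
    show "stk t < n" "es ! stk t \<in> ?X'" "fin (stk t) = 0" if "t < q" for t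
      using s keep that assms(2) by simp_all
    show "inj_on stk {..<q}" using s assms(2) by (auto intro: inj_on_subset)
    show "ons' k \<noteq> 0 \<longleftrightarrow> k \<in> stk ` {..<q}" if "k < n" for k
    proof -
      have "stk ` {..<ht} = stk ` {..<q} \<union> stk ` {q..<ht}"
        using assms(2) by (simp add: image_Un[symmetric] ivl_disj_un)
      moreover have "stk ` {..<q} \<inter> stk ` {q..<ht} = {}"
      proof -
        have sub: "{..<q} \<subseteq> {..<ht}" "{q..<ht} \<subseteq> {..<ht}" using assms(2) by auto
        have "inj_on stk {..<ht}" using s by blast
        then have "stk ` {..<q} \<inter> stk ` {q..<ht} = stk ` ({..<q} \<inter> {q..<ht})"
          using inj_on_image_Int[OF _ sub] by metis
        moreover have "{..<q} \<inter> {q..<ht} = {}" by auto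
        ultimately show ?thesis by simp
      qed
      moreover have "ons k \<noteq> 0 \<longleftrightarrow> k \<in> stk ` {..<ht}" using s that by blast
      ultimately show ?thesis using assms(5)[OF that] by (metis UnE UnI1 disjoint_iff)
    qed
    fix t assume t: "Suc t < q"
    show "alt' t < n" "fst (es ! alt' t) = fst (es ! stk t)" using alt t assms(2) by simp_all
    have "tandem G X (es ! alt' t) (es ! stk (Suc t))" using alt[of t] t assms(2) by auto
    then show "tandem G ?X' (es ! alt' t) (es ! stk (Suc t))"
      using tandem_persists[OF X X' le _ keep[OF t], of "es ! alt' t" "es ! stk t"] keep[of t] s alt[of t] t assms(2)
      by simp
  next
    fix k Y assume "k < n" "fin k \<noteq> 0" "stable G Y" "leF ?X' Y"
    then show "es ! k \<in> Y" using s leF_trans_stable[OF X X' _ le] by blast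
  qed
qed

section \<open>Listing the rotations\<close>

abbreviation entries :: "store \<Rightarrow> nat \<Rightarrow> nat set" where
  "entries s j \<equiv> {arr s ''plusStart'' j ..< arr s ''plusStart'' (Suc j)}"

abbreviation edge_at :: "store \<Rightarrow> string \<Rightarrow> nat \<Rightarrow> nat \<times> nat" where
  "edge_at s x p \<equiv> es ! arr s x p"

text \<open>The \<open>j\<close>-th block of the output arrays contains the rotation \<open>R\<close>. The old and the new edge of a worker
stand at the same position of the arrays \<open>minus\<close> and \<open>plus\<close>.\<close>

definition listed :: "store \<Rightarrow> nat \<Rightarrow> (nat, nat) rotation \<Rightarrow> bool" where
  "listed s j R \<longleftrightarrow> arr s ''plusStart'' j \<le> arr s ''plusStart'' (Suc j) \<and>
     fst R = edge_at s ''plus'' ` entries s j \<and> snd R = edge_at s ''minus'' ` entries s j \<and>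
     (\<forall>p \<in> entries s j. arr s ''plus'' p < n \<and> arr s ''minus'' p < n \<and> arr s ''tdm'' p < n \<and>
        edge_at s ''minus'' p \<succ> edge_at s ''plus'' p) \<and>
     (\<exists>Z. stable G Z \<and> R \<in> rotations_at G Z \<and>
        (\<forall>p \<in> entries s j. tandem G Z (edge_at s ''plus'' p) (edge_at s ''tdm'' p)))"

text \<open>The rotations of a route from \<open>X0\<close> to \<open>X\<close> have been listed. The last equation, which every rotation
preserves by \<open>depth_apply_rotation\<close>, serves to bound the total length of the tests.\<close>

definition route_listed ::
  "store \<Rightarrow> (nat \<times> nat) set \<Rightarrow> (nat, nat) rotation list \<Rightarrow> (nat \<times> nat) set \<Rightarrow> bool" where
  "route_listed s X0 Ls X \<longleftrightarrow> route G X0 Ls X \<and> reg s ''nR'' = length Ls \<and> arr s ''plusStart'' 0 = 0 \<and>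
     (\<forall>j \<le> length Ls. arr s ''minusStart'' j = arr s ''plusStart'' j) \<and>
     (\<forall>j < length Ls. listed s j (Ls ! j)) \<and>
     (\<Sum>p < arr s ''plusStart'' (length Ls). Suc (rk (edge_at s ''plus'' p))) + depth X0 =
     depth X + (\<Sum>p < arr s ''plusStart'' (length Ls). Suc (rk (edge_at s ''minus'' p)))"

lemma route_listed_frame:
  assumes "route_listed s X0 Ls X" "frame U V s s'" "''nR'' \<notin> U"
    "''plus'' \<notin> V" "''minus'' \<notin> V" "''tdm'' \<notin> V" "''plusStart'' \<notin> V" "''minusStart'' \<notin> V"
  shows "route_listed s' X0 Ls X"
  using assms unfolding route_listed_def listed_def by (simp add: frame_def)


abbreviation "emit_regs \<equiv> {''tb'', ''p'', ''go'', ''ht'', ''x'', ''nR''}"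
abbreviation "emit_arrs \<equiv> {''plus'', ''minus'', ''tdm'', ''cur'', ''ons'', ''plusStart'', ''minusStart''}"

text \<open>Thirteen instructions and tests per entry. The stack entry number \<open>t\<close> is written to the position
\<open>p0 + (ht - 1 - t)\<close>.\<close>

lemma wp_emit_rotation:
  fixes s :: store
  defines "ht \<equiv> reg s ''ht''" and "p0 \<equiv> arr s ''plusStart'' (reg s ''nR'')"
    and "stk \<equiv> arr s ''stk''" and "alt \<equiv> arr s ''alt''"
  assumes q: "q < ht" "stk q = reg s ''r''" and inj: "inj_on stk {..<ht}"
    and dis: "\<And>t u. t < ht \<Longrightarrow> u < ht \<Longrightarrow> q \<le> t \<Longrightarrow> alt t \<noteq> stk u"
    and P: "\<And>s' t'. frame emit_regs emit_arrs s s' \<Longrightarrow> t' \<le> t + 13 * (ht - q) + 7 \<Longrightarrow>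
      reg s' ''ht'' = q \<Longrightarrow> reg s' ''nR'' = Suc (reg s ''nR'') \<Longrightarrow>
      arr s' ''plusStart'' = (arr s ''plusStart'')(Suc (reg s ''nR'') := p0 + (ht - q)) \<Longrightarrow>
      arr s' ''minusStart'' = (arr s ''minusStart'')(Suc (reg s ''nR'') := p0 + (ht - q)) \<Longrightarrow>
      (\<And>p. p < p0 \<Longrightarrow> arr s' ''plus'' p = arr s ''plus'' p \<and> arr s' ''minus'' p = arr s ''minus'' p \<and>
         arr s' ''tdm'' p = arr s ''tdm'' p) \<Longrightarrow>
      (\<And>p. p0 \<le> p \<Longrightarrow> p < p0 + (ht - q) \<Longrightarrow> arr s' ''plus'' p = alt (ht - 1 - (p - p0)) \<and>
         arr s' ''minus'' p = stk (ht - 1 - (p - p0)) \<and>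
         arr s' ''tdm'' p = (if p = p0 then stk q else stk (Suc (ht - 1 - (p - p0))))) \<Longrightarrow>
      (\<And>k. arr s' ''cur'' k \<noteq> 0 \<longleftrightarrow> k \<in> alt ` {q..<ht} \<or> arr s ''cur'' k \<noteq> 0 \<and> k \<notin> stk ` {q..<ht}) \<Longrightarrow>
      (\<And>k. arr s' ''ons'' k \<noteq> 0 \<longleftrightarrow> arr s ''ons'' k \<noteq> 0 \<and> k \<notin> stk ` {q..<ht}) \<Longrightarrow> P s' t'"
  shows "wp D Q emit_rotation P s t"
proof -
  define I where "I = (\<lambda>s' t'. let u = reg s' ''ht'' in
     frame {''tb'', ''p'', ''go'', ''ht'', ''x''} {''plus'', ''minus'', ''tdm'', ''cur'', ''ons''} s s' \<and>
     q \<le> u \<and> u \<le> ht \<and> reg s' ''p'' = p0 + (ht - u) \<and> t' \<le> t + 3 + 13 * (ht - u) \<and>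
     (reg s' ''go'' = 1 \<and> q < u \<or> reg s' ''go'' = 0 \<and> u = q) \<and>
     reg s' ''tb'' = (if u = ht then stk q else stk u) \<and>
     (\<forall>p < p0. arr s' ''plus'' p = arr s ''plus'' p \<and> arr s' ''minus'' p = arr s ''minus'' p \<and>
         arr s' ''tdm'' p = arr s ''tdm'' p) \<and>
     (\<forall>p. p0 \<le> p \<longrightarrow> p < p0 + (ht - u) \<longrightarrow> arr s' ''plus'' p = alt (ht - 1 - (p - p0)) \<and>
         arr s' ''minus'' p = stk (ht - 1 - (p - p0)) \<and>
         arr s' ''tdm'' p = (if p = p0 then stk q else stk (Suc (ht - 1 - (p - p0))))) \<and>
     (\<forall>k. arr s' ''cur'' k \<noteq> 0 \<longleftrightarrow> k \<in> alt ` {u..<ht} \<or> arr s ''cur'' k \<noteq> 0 \<and> k \<notin> stk ` {u..<ht}) \<and>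
     (\<forall>k. arr s' ''ons'' k \<noteq> 0 \<longleftrightarrow> arr s ''ons'' k \<noteq> 0 \<and> k \<notin> stk ` {u..<ht}))"
  show ?thesis unfolding emit_rotation_def wp_simps
  proof (rule wp_Loop[where I = I and T = "t + 3 + 13 * ht"], goal_cases)
    case 1
    show ?case using q by (simp add: I_def Let_def p0_def[symmetric] ht_def[symmetric])
  next
    case (2 s' t')
    have "t' \<le> t + 3 + 13 * (ht - reg s' ''ht'')" using 2 by (simp add: I_def Let_def)
    also have "\<dots> \<le> t + 3 + 13 * ht" by simp
    finally show ?case .
  next
    case (3 s1 t1)
    define u where "u = reg s1 ''ht'' - 1"
    have fr: "frame {''tb'', ''p'', ''go'', ''ht'', ''x''} {''plus'', ''minus'', ''tdm'', ''cur'', ''ons''} s s1"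
      using 3(1) by (simp add: I_def Let_def)
    have u: "reg s1 ''ht'' = Suc u" "q \<le> u" "u < ht" using 3 by (auto simp: I_def Let_def u_def)
    have same: "arr s1 ''stk'' = stk" "arr s1 ''alt'' = alt" "reg s1 ''r'' = stk q"
      using fr q by (simp_all add: frame_def stk_def alt_def)
    have p: "reg s1 ''p'' = p0 + (ht - Suc u)" and t1: "t1 \<le> t + 3 + 13 * (ht - Suc u)"
      and tb: "reg s1 ''tb'' = (if Suc u = ht then stk q else stk (Suc u))"
      and old: "\<forall>p < p0. arr s1 ''plus'' p = arr s ''plus'' p \<and> arr s1 ''minus'' p = arr s ''minus'' p \<and>
         arr s1 ''tdm'' p = arr s ''tdm'' p"
      and new: "\<forall>p. p0 \<le> p \<longrightarrow> p < p0 + (ht - Suc u) \<longrightarrow> arr s1 ''plus'' p = alt (ht - 1 - (p - p0)) \<and>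
         arr s1 ''minus'' p = stk (ht - 1 - (p - p0)) \<and>
         arr s1 ''tdm'' p = (if p = p0 then stk q else stk (Suc (ht - 1 - (p - p0))))"
      and cur: "\<And>k. arr s1 ''cur'' k \<noteq> 0 \<longleftrightarrow> k \<in> alt ` {Suc u..<ht} \<or> arr s ''cur'' k \<noteq> 0 \<and> k \<notin> stk ` {Suc u..<ht}"
      and ons: "\<And>k. arr s1 ''ons'' k \<noteq> 0 \<longleftrightarrow> arr s ''ons'' k \<noteq> 0 \<and> k \<notin> stk ` {Suc u..<ht}"
      using 3(1) u by (simp_all add: I_def Let_def)
    have split: "{u..<ht} = insert u {Suc u..<ht}" using u(3) by auto
    have len: "ht - u = Suc (ht - Suc u)" using u(3) by simp
    define s2 where "s2 = set_reg ''tb'' (stk u) (set_arr ''ons'' ((arr s1 ''ons'')(stk u := 0))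
       (set_arr ''cur'' ((arr s1 ''cur'')(stk u := 0, alt u := 1)) (set_reg ''p'' (Suc (reg s1 ''p''))
       (set_arr ''tdm'' ((arr s1 ''tdm'')(reg s1 ''p'' := reg s1 ''tb''))
       (set_arr ''minus'' ((arr s1 ''minus'')(reg s1 ''p'' := stk u))
       (set_arr ''plus'' ((arr s1 ''plus'')(reg s1 ''p'' := alt u))
       (set_reg ''x'' (stk u) (set_reg ''ht'' u s1))))))))"
    have new2: "arr s2 ''plus'' p = alt (ht - 1 - (p - p0)) \<and>
         arr s2 ''minus'' p = stk (ht - 1 - (p - p0)) \<and>
         arr s2 ''tdm'' p = (if p = p0 then stk q else stk (Suc (ht - 1 - (p - p0))))"
      if "p0 \<le> p" "p < p0 + (ht - u)" for p
    proof (cases "p = reg s1 ''p''")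
      case True
      have i: "ht - 1 - (p - p0) = u" using True \<open>reg s1 ''p'' = _\<close> u(3) by simp
      have "p = p0 \<longleftrightarrow> Suc u = ht" using True \<open>reg s1 ''p'' = _\<close> u(3) by auto
      then show ?thesis using True tb unfolding i by (simp add: s2_def)
    next
      case False
      then have "p < p0 + (ht - Suc u)" using that(2) p len by simp
      then show ?thesis using new that(1) False by (simp add: s2_def)
    qed
    have cur2: "arr s2 ''cur'' k \<noteq> 0 \<longleftrightarrow> k \<in> alt ` {u..<ht} \<or> arr s ''cur'' k \<noteq> 0 \<and> k \<notin> stk ` {u..<ht}" for k
    proof -
      have "stk u \<noteq> alt t" if "u \<le> t" "t < ht" for t using dis[of t u] that u by simp
      then have "stk u \<notin> alt ` {u..<ht}" by (metis atLeastLessThan_iff imageE)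
      moreover have "arr s2 ''cur'' k \<noteq> 0 \<longleftrightarrow> k = alt u \<or> k \<noteq> stk u \<and> arr s1 ''cur'' k \<noteq> 0"
        by (simp add: s2_def)
      ultimately show ?thesis unfolding cur split by auto
    qed
    have ons2: "arr s2 ''ons'' k \<noteq> 0 \<longleftrightarrow> arr s ''ons'' k \<noteq> 0 \<and> k \<notin> stk ` {u..<ht}" for k
    proof -
      have "arr s2 ''ons'' k \<noteq> 0 \<longleftrightarrow> k \<noteq> stk u \<and> arr s1 ''ons'' k \<noteq> 0" by (simp add: s2_def)
      then show ?thesis unfolding ons split by auto
    qed
    have old2: "\<forall>p < p0. arr s2 ''plus'' p = arr s ''plus'' p \<and> arr s2 ''minus'' p = arr s ''minus'' p \<and>
         arr s2 ''tdm'' p = arr s ''tdm'' p"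
      using old p by (simp add: s2_def)
    have fr2: "frame {''tb'', ''p'', ''go'', ''ht'', ''x''} {''plus'', ''minus'', ''tdm'', ''cur'', ''ons''} s s2"
      using fr by (simp add: s2_def)
    have reg2: "reg s2 ''ht'' = u" "reg s2 ''p'' = p0 + (ht - u)" "reg s2 ''tb'' = stk u"
      "reg s2 ''x'' = stk u" "reg s2 ''r'' = stk q" "reg s2 ''go'' = 1"
      using p len same 3(2) by (simp_all add: s2_def)
    have eq: "stk u = stk q \<longleftrightarrow> u = q" using inj_on_eq_iff[OF inj, of u q] u q(1) by simp
    have end_go: "I (if stk u = stk q then set_reg ''go'' 0 s2 else s2) (t1 + 13)"
    proof (cases "u = q")
      case True
      then show ?thesis using fr2 reg2 new2 cur2 ons2 old2 u t1 len unfolding eq I_def Let_def by auto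
    next
      case False
      then show ?thesis using fr2 reg2 new2 cur2 ons2 old2 u t1 len unfolding eq I_def Let_def by auto
    qed
    have run: "wp D Q (Assign ''ht'' (Dec (Reg ''ht'')) ;; Assign ''x'' (Cell ''stk'' (Reg ''ht'')) ;;
        Store ''plus'' (Reg ''p'') (Cell ''alt'' (Reg ''ht'')) ;;
        Store ''minus'' (Reg ''p'') (Reg ''x'') ;; Store ''tdm'' (Reg ''p'') (Reg ''tb'') ;;
        Assign ''p'' (Inc (Reg ''p'')) ;;
        Store ''cur'' (Reg ''x'') (Num 0) ;; Store ''cur'' (Cell ''alt'' (Reg ''ht'')) (Num 1) ;;
        Store ''ons'' (Reg ''x'') (Num 0) ;; Assign ''tb'' (Reg ''x'')) R s1 t0
      \<longleftrightarrow> R s2 (t0 + 10)" for R t0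
      using u same by (simp add: wp_simps s2_def set_arr_def set_reg_def eval_nat_numeral)
    have "wp D Q (Cond (Equal (Reg ''x'') (Reg ''r'')) (Assign ''go'' (Num 0)) Nop) I s2 (Suc t1 + 10)"
      using end_go reg2 by (simp add: wp_simps eval_nat_numeral split: if_splits)
    then show ?case
      using run[of "\<lambda>s' t'. wp D Q (Cond (Equal (Reg ''x'') (Reg ''r'')) (Assign ''go'' (Num 0)) Nop) I s' t'" "Suc t1"]
      unfolding wp_Seq by blast
  next
    case (4 s1 t1)
    let ?s = "set_arr ''minusStart'' ((arr s1 ''minusStart'')(Suc (reg s1 ''nR'') := reg s1 ''p''))
       (set_arr ''plusStart'' ((arr s1 ''plusStart'')(Suc (reg s1 ''nR'') := reg s1 ''p''))
         (set_reg ''nR'' (Suc (reg s1 ''nR'')) s1))"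
    have u: "reg s1 ''ht'' = q" using 4 by (auto simp: I_def Let_def)
    note I = 4(1)[unfolded I_def Let_def u]
    have fr: "frame emit_regs emit_arrs s ?s" using I by (auto simp: frame_def)
    have keep: "reg s1 ''nR'' = reg s ''nR''" "arr s1 ''plusStart'' = arr s ''plusStart''"
      "arr s1 ''minusStart'' = arr s ''minusStart''" using I by (simp_all add: frame_def)
    have "P ?s (Suc (Suc (Suc (Suc t1))))"
      by (rule P[OF fr]) (use I u keep in \<open>simp_all\<close>)
    then show ?case by (simp add: wp_simps)
  qed
qed

lemma rev_segment: "q < ht \<Longrightarrow> bij_betw (\<lambda>p. ht - 1 - (p - p0)) {p0..<p0 + (ht - q)} {q..<ht :: nat}"
  by (rule bij_betw_byWitness[where f' = "\<lambda>t. p0 + (ht - 1 - t)"]) auto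

lemma route_listed_snoc:
  assumes rl: "route_listed s X0 Ls X" and X: "stable G X" and L: "L \<in> rotations_at G X"
    and q: "q < ht"
    and L_def: "L = ((\<lambda>t. es ! alt t) ` {q..<ht}, (\<lambda>t. es ! stk t) ` {q..<ht})"
    and alt: "\<And>t. q \<le> t \<Longrightarrow> t < ht \<Longrightarrow> alt t < n \<and> stk t < n \<and> fst (es ! alt t) = fst (es ! stk t) \<and>
      tandem G X (es ! alt t) (es ! (if Suc t = ht then stk q else stk (Suc t)))"
    and inj: "inj_on (\<lambda>t. es ! alt t) {q..<ht}" "inj_on (\<lambda>t. es ! stk t) {q..<ht}"
    and nR: "reg s' ''nR'' = Suc (reg s ''nR'')"
    and ps: "arr s' ''plusStart'' = (arr s ''plusStart'')(Suc (reg s ''nR'') := p0 + (ht - q))"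
    and ms: "arr s' ''minusStart'' = (arr s ''minusStart'')(Suc (reg s ''nR'') := p0 + (ht - q))"
    and p0: "p0 = arr s ''plusStart'' (reg s ''nR'')"
    and old: "\<And>p. p < p0 \<Longrightarrow> arr s' ''plus'' p = arr s ''plus'' p \<and> arr s' ''minus'' p = arr s ''minus'' p \<and>
         arr s' ''tdm'' p = arr s ''tdm'' p"
    and new: "\<And>p. p0 \<le> p \<Longrightarrow> p < p0 + (ht - q) \<Longrightarrow> arr s' ''plus'' p = alt (ht - 1 - (p - p0)) \<and>
         arr s' ''minus'' p = stk (ht - 1 - (p - p0)) \<and>
         arr s' ''tdm'' p = (if p = p0 then stk q else stk (Suc (ht - 1 - (p - p0))))"
  shows "route_listed s' X0 (Ls @ [L]) (apply_rotation L X)"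
proof -
  note r = rl[unfolded route_listed_def]
  let ?N = "length Ls" and ?B = "{p0..<p0 + (ht - q)}" and ?g = "\<lambda>p. ht - 1 - (p - p0)"
  have nRs: "reg s ''nR'' = ?N" and pN: "arr s ''plusStart'' ?N = p0" using r p0 by simp_all
  have mono: "arr s ''plusStart'' j \<le> p0" if "j \<le> ?N" for j
  proof -
    have "arr s ''plusStart'' j \<le> arr s ''plusStart'' (j + i)" if "j + i \<le> ?N" for i
      using that
    proof (induction i)
      case (Suc i)
      then have "listed s (j + i) (Ls ! (j + i))" using r by simp
      then show ?case using Suc unfolding listed_def by simp
    qed simp
    from this[of "?N - j"] show ?thesis using that pN by simp
  qed
  have bij: "bij_betw ?g ?B {q..<ht}" by (rule rev_segment[OF q])
  have gB: "q \<le> ?g p" "?g p < ht" if "p \<in> ?B" for p using bij_betwE[OF bij] that by auto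
  have newB: "arr s' ''plus'' p = alt (?g p)" "arr s' ''minus'' p = stk (?g p)" if "p \<in> ?B" for p
    using new that by auto
  have imgs: "edge_at s' ''plus'' ` ?B = fst L" "edge_at s' ''minus'' ` ?B = snd L"
  proof -
    have "edge_at s' ''plus'' ` ?B = (\<lambda>p. es ! alt (?g p)) ` ?B" using newB by (intro image_cong) simp_all
    also have "\<dots> = (\<lambda>t. es ! alt t) ` ?g ` ?B" by (simp only: image_image)
    finally show "edge_at s' ''plus'' ` ?B = fst L" using bij_betw_imp_surj_on[OF bij] L_def by simp
    have "edge_at s' ''minus'' ` ?B = (\<lambda>p. es ! stk (?g p)) ` ?B" using newB by (intro image_cong) simp_all
    also have "\<dots> = (\<lambda>t. es ! stk t) ` ?g ` ?B" by (simp only: image_image)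
    finally show "edge_at s' ''minus'' ` ?B = snd L" using bij_betw_imp_surj_on[OF bij] L_def by simp
  qed
  have psN: "arr s' ''plusStart'' ?N = p0" "arr s' ''plusStart'' (Suc ?N) = p0 + (ht - q)"
    using ps nRs pN by simp_all
  have rotL: "stable G (apply_rotation L X)" by (rule stable_apply_rotation[OF X L])
  have listN: "listed s' ?N L"
    unfolding listed_def psN
  proof (intro conjI ballI)
    show "p0 \<le> p0 + (ht - q)" by simp
    show "fst L = edge_at s' ''plus'' ` ?B" "snd L = edge_at s' ''minus'' ` ?B" using imgs by simp_all
    fix p assume p: "p \<in> ?B"
    note a = alt[OF gB[OF p]]
    show "arr s' ''plus'' p < n" "arr s' ''minus'' p < n" using newB[OF p] a by simp_all
    have "arr s' ''tdm'' p = (if p = p0 then stk q else stk (Suc (?g p)))" using new p by simp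
    moreover have "p = p0 \<longleftrightarrow> Suc (?g p) = ht" using p q by auto
    ultimately have d: "arr s' ''tdm'' p = (if Suc (?g p) = ht then stk q else stk (Suc (?g p)))" by simp
    then show "arr s' ''tdm'' p < n" using alt[of q] alt[of "Suc (?g p)"] gB[OF p] q by auto
    have "edge_at s' ''plus'' p \<in> fst L" "edge_at s' ''minus'' p \<in> snd L" using imgs p by blast+
    then show "edge_at s' ''minus'' p \<succ> edge_at s' ''plus'' p"
      using rotationD(12)[OF X L] newB[OF p] a by simp
  next
    have "tandem G X (edge_at s' ''plus'' p) (edge_at s' ''tdm'' p)" if p: "p \<in> ?B" for p
    proof -
      have "arr s' ''tdm'' p = (if p = p0 then stk q else stk (Suc (?g p)))" using new p by simp
      moreover have "p = p0 \<longleftrightarrow> Suc (?g p) = ht" using p q by auto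
      ultimately have "arr s' ''tdm'' p = (if Suc (?g p) = ht then stk q else stk (Suc (?g p)))" by simp
      then show ?thesis using alt[OF gB[OF p]] newB[OF p] by simp
    qed
    then show "\<exists>Z. stable G Z \<and> L \<in> rotations_at G Z \<and>
        (\<forall>p \<in> ?B. tandem G Z (edge_at s' ''plus'' p) (edge_at s' ''tdm'' p))" using X L by blast
  qed
  have listed_old: "listed s' j (Ls ! j)" if j: "j < ?N" for j
  proof -
    have e: "arr s' ''plusStart'' j = arr s ''plusStart'' j" "arr s' ''plusStart'' (Suc j) = arr s ''plusStart'' (Suc j)"
      using ps nRs j by simp_all
    have "p < p0" if "p \<in> entries s j" for p using that mono[of "Suc j"] j by simp
    then have same: "\<And>p. p \<in> entries s j \<Longrightarrow> arr s' ''plus'' p = arr s ''plus'' p"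
      "\<And>p. p \<in> entries s j \<Longrightarrow> arr s' ''minus'' p = arr s ''minus'' p"
      "\<And>p. p \<in> entries s j \<Longrightarrow> arr s' ''tdm'' p = arr s ''tdm'' p" using old by blast+
    have "listed s j (Ls ! j)" using r j by blast
    moreover have "edge_at s' ''plus'' ` entries s j = edge_at s ''plus'' ` entries s j"
      "edge_at s' ''minus'' ` entries s j = edge_at s ''minus'' ` entries s j"
      by (rule image_cong[OF refl], simp only: same)+
    ultimately show ?thesis unfolding listed_def e using same by simp
  qed
  let ?S = "\<lambda>s x P. \<Sum>p < P. Suc (rk (edge_at s x p))"
  have sums: "?S s' ''plus'' (p0 + (ht - q)) = ?S s ''plus'' p0 + (\<Sum>a \<in> fst L. Suc (rk a))"
    "?S s' ''minus'' (p0 + (ht - q)) = ?S s ''minus'' p0 + (\<Sum>b \<in> snd L. Suc (rk b))"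
  proof -
    have un: "{..<p0 + (ht - q)} = {..<p0} \<union> ?B" "{..<p0} \<inter> ?B = {}" by auto
    have spl: "(\<Sum>p < p0 + (ht - q). h p) = (\<Sum>p < p0. h p) + (\<Sum>p \<in> ?B. h p)" for h :: "nat \<Rightarrow> nat"
      unfolding un(1) by (rule sum.union_disjoint) (use un(2) in simp_all)
    have "(\<Sum>p \<in> ?B. Suc (rk (edge_at s' ''plus'' p))) = (\<Sum>p \<in> ?B. Suc (rk (es ! alt (?g p))))"
      using newB by (intro sum.cong) simp_all
    also have "\<dots> = (\<Sum>t \<in> {q..<ht}. Suc (rk (es ! alt t)))" by (rule sum.reindex_bij_betw[OF bij])
    also have "\<dots> = (\<Sum>a \<in> fst L. Suc (rk a))" unfolding L_def by (simp add: sum.reindex[OF inj(1)])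
    finally show "?S s' ''plus'' (p0 + (ht - q)) = ?S s ''plus'' p0 + (\<Sum>a \<in> fst L. Suc (rk a))"
      unfolding spl using old by simp
    have "(\<Sum>p \<in> ?B. Suc (rk (edge_at s' ''minus'' p))) = (\<Sum>p \<in> ?B. Suc (rk (es ! stk (?g p))))"
      using newB by (intro sum.cong) simp_all
    also have "\<dots> = (\<Sum>t \<in> {q..<ht}. Suc (rk (es ! stk t)))" by (rule sum.reindex_bij_betw[OF bij])
    also have "\<dots> = (\<Sum>b \<in> snd L. Suc (rk b))" unfolding L_def by (simp add: sum.reindex[OF inj(2)])
    finally show "?S s' ''minus'' (p0 + (ht - q)) = ?S s ''minus'' p0 + (\<Sum>b \<in> snd L. Suc (rk b))"
      unfolding spl using old by simp
  qed
  have sumN: "?S s ''plus'' p0 + depth X0 = depth X + ?S s ''minus'' p0" using r pN by simp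
  have total: "?S s' ''plus'' (p0 + (ht - q)) + depth X0 = depth (apply_rotation L X) + ?S s' ''minus'' (p0 + (ht - q))"
    unfolding sums using sumN depth_apply_rotation(1)[OF X L] by simp
  have "route G X0 (Ls @ [L]) (apply_rotation L X)" using r L by (auto simp: route_append)
  moreover have "\<forall>j \<le> Suc ?N. arr s' ''minusStart'' j = arr s' ''plusStart'' j"
    using r ps ms nRs by simp
  moreover have "listed s' j ((Ls @ [L]) ! j)" if "j < Suc ?N" for j
    using that listed_old listN by (cases "j = ?N") (simp_all add: nth_append)
  moreover have "arr s' ''plusStart'' 0 = 0" using ps r by simp
  ultimately show ?thesis unfolding route_listed_def using nR nRs total psN(2) by simp
qed


abbreviation "search_regs \<equiv> {''run'', ''ht'', ''x'', ''e'', ''ok'', ''r'', ''k'', ''tb'', ''p'', ''go'', ''nR''}"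
abbreviation "search_arrs \<equiv> {''stk'', ''ons'', ''fin'', ''alt'', ''cur'', ''ans'', ''plus'', ''minus'', ''tdm'',
  ''plusStart'', ''minusStart''}"

definition search_state :: "(nat \<times> nat) set \<Rightarrow> store \<Rightarrow> bool" where
  "search_state X0 s \<longleftrightarrow> (\<exists>Ls. route_listed s X0 Ls (matched (arr s ''cur''))) \<and>
     search_inv (matched (arr s ''cur'')) (reg s ''ht'') (arr s ''stk'') (arr s ''alt'') (arr s ''ons'') (arr s ''fin'')"

text \<open>Every step of the search increases this quantity: a push increases the height, retiring an
  edge costs one unit of height but counts twice, and applying a rotation increases the depth by
  at least the number of popped edges.\<close>

definition progress :: "store \<Rightarrow> nat" where
  "progress s = 2 * depth (matched (arr s ''cur'')) + 2 * card {k. k < n \<and> arr s ''fin'' k \<noteq> 0} +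
     reg s ''ht'' + (1 - reg s ''run'')"

lemma progress_le:
  assumes "search_state X0 s"
  shows "progress s \<le> 4 * n + 1"
proof -
  have inv: "search_inv (matched (arr s ''cur'')) (reg s ''ht'') (arr s ''stk'') (arr s ''alt'') (arr s ''ons'') (arr s ''fin'')"
    using assms by (simp add: search_state_def)
  then have "stable G (matched (arr s ''cur''))" by (simp add: search_inv_def)
  then have "depth (matched (arr s ''cur'')) \<le> n" using depth_le stableD(1,2) card_E by metis
  then show ?thesis using search_bound[OF inv] by (simp add: progress_def)
qed

lemma wp_restart:
  assumes st: "static s" and ss: "search_state X0 s" and run: "reg s ''run'' = 1" and ht: "reg s ''ht'' = 0"
    and P: "\<And>s' t'. frame search_regs search_arrs s s' \<Longrightarrow> t' \<le> t + 4 * n + 7 \<Longrightarrow>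
      search_state X0 s' \<Longrightarrow> progress s < progress s' \<Longrightarrow>
      reg s' ''run'' = 1 \<or> reg s' ''run'' = 0 \<and> (\<forall>k < n. arr s' ''cur'' k \<noteq> 0 \<longrightarrow> arr s' ''fin'' k \<noteq> 0) \<Longrightarrow> P s' t'"
  shows "wp D Q restart P s t"
  unfolding restart_def wp_Seq
proof (rule wp_scan[where n = n and pr = "\<lambda>k. arr s ''cur'' k \<noteq> 0 \<and> arr s ''fin'' k = 0"], goal_cases)
  case 1 show ?case using st by (simp add: static_def)
next
  case (2 s' k) then show ?case by (simp add: frame_def)
next
  case (3 s1 t1)
  have nE: "reg s1 ''nE'' = n" "reg s1 ''ht'' = 0" "reg s1 ''run'' = 1" and arr1: "arr s1 = arr s"
    using 3(1) st ht run by (simp_all add: frame_def static_def fun_eq_iff)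
  have fr1: "frame search_regs search_arrs s s1" by (rule frame_trans[OF frame_refl 3(1)]) simp_all
  obtain Ls where rl: "route_listed s X0 Ls (matched (arr s ''cur''))"
    and inv: "search_inv (matched (arr s ''cur'')) 0 (arr s ''stk'') (arr s ''alt'') (arr s ''ons'') (arr s ''fin'')"
    using ss ht by (auto simp: search_state_def)
  have rl1: "route_listed s1 X0 Ls (matched (arr s ''cur''))" by (rule route_listed_frame[OF rl 3(1)]) simp_all
  let ?r = "reg s1 ''r''"
  show ?case
  proof (cases "?r < n")
    case True
    then have r: "arr s ''cur'' ?r \<noteq> 0" "arr s ''fin'' ?r = 0" using 3(3) by auto
    let ?s = "set_reg ''ht'' 1 (set_arr ''ons'' ((arr s1 ''ons'')(?r := 1)) (set_arr ''stk'' ((arr s1 ''stk'')(0 := ?r)) s1))"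
    have "arr s ''ons'' ?r = 0" using inv True by (simp add: search_inv_def)
    then have "search_inv (matched (arr s ''cur'')) (Suc 0) ((arr s ''stk'')(0 := ?r)) (arr s ''alt'')
        ((arr s ''ons'')(?r := 1)) (arr s ''fin'')"
      using search_push[OF inv True] r True by simp
    moreover have "route_listed ?s X0 Ls (matched (arr s ''cur''))"
      by (rule route_listed_frame[OF rl1, where U = "{''ht''}" and V = "{''ons'', ''stk''}"]) simp_all
    ultimately have "search_state X0 ?s" unfolding search_state_def using arr1 by auto
    moreover have "progress s < progress ?s" using arr1 ht nE run by (simp add: progress_def)
    ultimately have "P ?s (Suc (Suc (Suc (Suc t1))))"
      by (intro P) (use fr1 3(2) nE in simp_all)
    then show ?thesis using True nE by (simp add: wp_simps push_def)
  next
    case False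
    then have none: "\<forall>k < n. arr s ''cur'' k \<noteq> 0 \<longrightarrow> arr s ''fin'' k \<noteq> 0" using 3(3) by auto
    let ?s = "set_reg ''run'' 0 s1"
    have "route_listed ?s X0 Ls (matched (arr s ''cur''))"
      by (rule route_listed_frame[OF rl1, where U = "{''run''}" and V = "{}"]) simp_all
    then have "search_state X0 ?s" unfolding search_state_def using arr1 inv nE by auto
    moreover have "progress s < progress ?s" using arr1 ht nE run by (simp add: progress_def)
    ultimately have "P ?s (Suc (Suc t1))"
      by (intro P) (use fr1 3(2) nE none arr1 in simp_all)
    then show ?thesis using False nE by (simp add: wp_simps)
  qed
qed

lemma wp_push:
  "wp D Q push P s t \<longleftrightarrow> P (set_reg ''ht'' (Suc (reg s ''ht'')) (set_arr ''ons'' ((arr s ''ons'')(reg s ''r'' := 1))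
     (set_arr ''stk'' ((arr s ''stk'')(reg s ''ht'' := reg s ''r'')) s))) (t + 3)"
  by (simp add: push_def wp_simps numeral_3_eq_3)

lemma wp_retire:
  "wp D Q retire P s t \<longleftrightarrow> P (set_reg ''ht'' (reg s ''ht'' - 1) (set_arr ''ons'' ((arr s ''ons'')(reg s ''x'' := 0))
     (set_arr ''fin'' ((arr s ''fin'')(reg s ''x'' := 1)) s))) (t + 3)"
  by (simp add: retire_def wp_simps numeral_3_eq_3)

text \<open>If the top \<open>x\<close> of the stack were missing in a better stable matching \<open>Y\<close>, then by \<open>advance\<close> it would have a tandem,
and the displaced edge would be missing in \<open>Y\<close>, too. So \<open>x\<close> may be retired if there is no tandem or if the
displaced edge is retired. In the other cases the stack grows or its end is a rotation.\<close>

lemma wp_explore: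
  assumes st: "static s" and li: "linked s" and ss: "search_state X0 s" and run: "reg s ''run'' = 1"
    and ht: "reg s ''ht'' \<noteq> 0"
    and P: "\<And>s' t'. frame search_regs search_arrs s s' \<Longrightarrow> t' \<le> t + 23 * n + 30 \<Longrightarrow>
      search_state X0 s' \<Longrightarrow> progress s < progress s' \<Longrightarrow> reg s' ''run'' = 1 \<Longrightarrow> P s' t'"
  shows "wp D Q explore P s t"
proof -
  define h where "h = reg s ''ht''"
  define stk where "stk = arr s ''stk''"
  define alt where "alt = arr s ''alt''"
  define fin where "fin = arr s ''fin''"
  define X where "X = matched (arr s ''cur'')"
  define x where "x = stk (h - 1)"
  obtain Ls where rl: "route_listed s X0 Ls X" and inv: "search_inv X h stk alt (arr s ''ons'') fin"
    using ss unfolding search_state_def h_def stk_def alt_def fin_def X_def by blast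
  note i = inv[unfolded search_inv_def]
  have h: "0 < h" using ht by (simp add: h_def)
  have X: "stable G X" using i by blast
  have x: "x < n" "es ! x \<in> X" "fin x = 0" using i h by (simp_all add: x_def)
  have curx: "arr s ''cur'' x \<noteq> 0" using x by (simp add: X_def)
  define s1 where "s1 = set_reg ''x'' x s"
  have st1: "static s1" using st by (simp add: static_def s1_def)
  have li1: "linked s1" using li by (simp add: linked_def s1_def)
  have arr1: "arr s1 = arr s" "reg s1 ''x'' = x" by (simp_all add: s1_def)
  have fr1: "frame search_regs search_arrs s s1" by (simp add: s1_def)
  have body: "wp D Q (find_tandem ;;
     Cond (Conj (Less (Reg ''r'') (Reg ''nE'')) (Equal (Cell ''fin'' (Reg ''r'')) (Num 0)))
       (Store ''alt'' (Dec (Reg ''ht'')) (Reg ''e'') ;;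
        Cond (Equal (Cell ''ons'' (Reg ''r'')) (Num 0)) push emit_rotation)
       retire) P s1 (Suc t)"
    unfolding wp_Seq
  proof (rule wp_find_tandem[OF st1 li1], goal_cases)
    case 1 show ?case using X arr1 by (simp add: X_def)
  next
    case 2 show ?case using x arr1 by simp
  next
    case 3 show ?case using curx arr1 by simp
  next
    case (4 s2 t2)
    have fr2: "frame search_regs search_arrs s s2" by (rule frame_trans[OF fr1 4(1)]) simp_all
    have fr: "frame {''x'', ''e'', ''ok'', ''r'', ''k''} {''ans''} s s2"
      by (rule frame_trans[OF _ 4(1), of _ _ s]) (simp_all add: s1_def)
    have rl2: "route_listed s2 X0 Ls X" by (rule route_listed_frame[OF rl fr]) simp_all
    have arr2: "arr s2 ''stk'' = stk" "arr s2 ''alt'' = alt" "arr s2 ''fin'' = fin" "arr s2 ''cur'' = arr s ''cur''"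
      "arr s2 ''ons'' = arr s ''ons''" "reg s2 ''ht'' = h" "reg s2 ''run'' = 1" "reg s2 ''x'' = x" "reg s2 ''nE'' = n"
      "reg s2 ''nR'' = reg s ''nR''"
      using fr 4(1) run st arr1 by (simp_all add: frame_def stk_def alt_def fin_def h_def static_def)
    let ?r = "reg s2 ''r''" and ?e = "reg s2 ''e''"
    have t2: "t2 \<le> t + 10 * n + 14" using 4(2) by simp
    have found: "?e < n \<and> ?r < n \<and> fst (es ! ?e) = fst (es ! x) \<and> tandem G X (es ! ?e) (es ! ?r) \<or>
      ?r = n \<and> (\<forall>a b. fst a = fst (es ! x) \<longrightarrow> \<not> tandem G X a b)"
      using 4(3) arr1 by (simp add: X_def)
    have retire: "wp D Q retire P s2 (Suc t2)" if stay: "\<And>Y. stable G Y \<Longrightarrow> leF X Y \<Longrightarrow> es ! x \<in> Y"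
    proof -
      let ?s = "set_reg ''ht'' (h - 1) (set_arr ''ons'' ((arr s ''ons'')(x := 0))
         (set_arr ''fin'' (fin(x := 1)) s2))"
      have "search_inv X (h - 1) stk alt ((arr s ''ons'')(x := 0)) (fin(x := 1))"
        using search_retire[OF inv h] stay by (simp add: x_def)
      moreover have "route_listed ?s X0 Ls X"
        by (rule route_listed_frame[OF rl2, where U = "{''ht''}" and V = "{''ons'', ''fin''}"]) simp_all
      ultimately have "search_state X0 ?s" unfolding search_state_def using arr2 by (auto simp: X_def)
      moreover have "progress s < progress ?s"
      proof -
        have "{k. k < n \<and> (fin(x := 1)) k \<noteq> 0} = insert x {k. k < n \<and> fin k \<noteq> 0}" using x by auto
        then have "card {k. k < n \<and> (fin(x := 1)) k \<noteq> 0} = Suc (card {k. k < n \<and> fin k \<noteq> 0})"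
          using x by simp
        then show ?thesis using h arr2 run unfolding progress_def by (simp add: fin_def[symmetric] h_def[symmetric])
      qed
      ultimately have "P ?s (Suc t2 + 3)"
        by (intro P) (use fr2 t2 arr2 in simp_all)
      then show ?thesis using arr2 by (simp add: wp_retire)
    qed
    show ?case
    proof (cases "?r < n \<and> fin ?r = 0")
      case False
      have "es ! x \<in> Y" if Y: "stable G Y" "leF X Y" for Y
      proof (rule ccontr)
        assume "es ! x \<notin> Y"
        then obtain a b where ab: "fst a = fst (es ! x)" "tandem G X a b" "b \<notin> Y"
          using advance[OF X Y x(2)] by blast
        then have t: "?e < n" "?r < n" "fst (es ! ?e) = fst (es ! x)" "tandem G X (es ! ?e) (es ! ?r)"
          using found by blast+
        then have "b = es ! ?r" using tandem_unique[OF X ab(2) t(4)] ab(1) by simp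
        moreover have "fin ?r \<noteq> 0" using False t(2) by simp
        ultimately show False using i t(2) Y ab(3) by blast
      qed
      then have "wp D Q retire P s2 (Suc t2)" by (rule retire)
      then show ?thesis using False arr2 unfolding wp_Cond by auto
    next
      case True
      then have r: "?r < n" "fin ?r = 0" by simp_all
      then have e: "?e < n" "fst (es ! ?e) = fst (es ! x)" "tandem G X (es ! ?e) (es ! ?r)"
        using found by auto
      have rX: "es ! ?r \<in> X" by (rule tandemD(4)[OF X e(3)])
      define alt' where "alt' = alt(h - 1 := ?e)"
      define s3 where "s3 = set_arr ''alt'' alt' s2"
      have alt_old: "alt' u = alt u" if "Suc u < h" for u using that by (auto simp: alt'_def)
      have alt_new: "alt' u < n \<and> fst (es ! alt' u) = fst (es ! stk u) \<and> tandem G X (es ! alt' u) (es ! ?r)"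
        if "Suc u = h" for u using that e by (auto simp: alt'_def x_def)
      have fr3: "frame search_regs search_arrs s s3" using fr2 by (simp add: s3_def)
      have rl3: "route_listed s3 X0 Ls X"
        by (rule route_listed_frame[OF rl2, where U = "{}" and V = "{''alt''}"]) (simp_all add: s3_def)
      have store: "wp D Q (Cond (Equal (Cell ''ons'' (Reg ''r'')) (Num 0)) push emit_rotation) P s3 (Suc (Suc t2)) \<Longrightarrow> ?thesis"
        using True arr2 unfolding wp_simps(6) wp_Seq wp_Store
        by (cases "arr s ''ons'' ?r = 0") (simp_all add: s3_def alt'_def)
      show ?thesis
      proof (rule store, cases "arr s ''ons'' ?r = 0")
        case True
        let ?s = "set_reg ''ht'' (Suc h) (set_arr ''ons'' ((arr s ''ons'')(?r := 1)) (set_arr ''stk'' (stk(h := ?r)) s3))"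
        have "search_inv X (Suc h) (stk(h := ?r)) alt' ((arr s ''ons'')(?r := 1)) fin"
          by (rule search_push[OF inv r(1) rX r(2) True alt_old alt_new])
        moreover have "route_listed ?s X0 Ls X"
          by (rule route_listed_frame[OF rl3, where U = "{''ht''}" and V = "{''ons'', ''stk''}"]) simp_all
        ultimately have "search_state X0 ?s" unfolding search_state_def using arr2
          by (auto simp: X_def s3_def)
        moreover have "progress s < progress ?s"
          using arr2 run unfolding progress_def by (simp add: s3_def fin_def[symmetric] h_def[symmetric])
        ultimately have "P ?s (Suc (Suc (Suc t2)) + 3)"
          by (intro P) (use fr3 t2 arr2 in \<open>simp_all add: s3_def\<close>)
        then show "wp D Q (Cond (Equal (Cell ''ons'' (Reg ''r'')) (Num 0)) push emit_rotation) P s3 (Suc (Suc t2))"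
          unfolding wp_Cond wp_push using True arr2 by (simp add: s3_def)
      next
        case False
        then have "?r \<in> stk ` {..<h}" using i r(1) by blast
        then obtain q where q: "q < h" "stk q = ?r" by auto
        define L where "L = ((\<lambda>t. es ! alt' t) ` {q..<h}, (\<lambda>t. es ! stk t) ` {q..<h})"
        have alt_new': "alt' u < n \<and> fst (es ! alt' u) = fst (es ! stk u) \<and> tandem G X (es ! alt' u) (es ! stk q)"
          if "Suc u = h" for u using alt_new[OF that] q(2) by simp
        define ons' where "ons' = (\<lambda>k. if k \<in> stk ` {q..<h} then 0 else arr s ''ons'' k)"
        have ons': "ons' k \<noteq> 0 \<longleftrightarrow> arr s ''ons'' k \<noteq> 0 \<and> k \<notin> stk ` {q..<h}" for k
          by (simp add: ons'_def)
        note tandem_circuit = search_cycle[OF inv q(1) alt_old alt_new' ons' L_def]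
        have "wp D Q emit_rotation P s3 (Suc (Suc (Suc t2)))"
        proof (rule wp_emit_rotation[where q = q], goal_cases)
          case 1 show ?case using q(1) arr2 by (simp add: s3_def)
        next
          case 2 show ?case using q arr2 by (simp add: s3_def)
        next
          case 3 show ?case using i arr2 by (simp add: s3_def)
        next
          case (4 u v)
          then have uv: "q \<le> u" "u < h" "v < h" using arr2 by (simp_all add: s3_def)
          have "es ! alt' u \<notin> X" using tandemD(3)[OF X tandem_circuit(3)[of u]] uv by simp
          moreover have "es ! stk v \<in> X" using i uv by blast
          ultimately show ?case using arr2 by (auto simp: s3_def)
        next
          case (5 s4 t4)
          have reg3: "reg s3 ''ht'' = h" "reg s3 ''nR'' = reg s ''nR''" "arr s3 ''stk'' = stk" "arr s3 ''alt'' = alt'"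
            "arr s3 ''ons'' = arr s ''ons''" "arr s3 ''cur'' = arr s ''cur''" "arr s3 ''fin'' = fin" "reg s3 ''run'' = 1"
            using arr2 by (simp_all add: s3_def)
          note post = 5[unfolded reg3]
          have keep4: "arr s4 ''stk'' = stk" "arr s4 ''alt'' = alt'" "arr s4 ''fin'' = fin" "reg s4 ''run'' = 1"
            using post(1) reg3 by (simp_all add: frame_def)
          have fr4: "frame search_regs search_arrs s s4" by (rule frame_trans[OF fr3 post(1)]) auto
          let ?X' = "apply_rotation L X"
          have altn: "alt' u < n \<and> stk u < n" if "q \<le> u" "u < h" for u
            using tandem_circuit(6)[of u] i that by simp
          have m4: "matched (arr s4 ''cur'') = ?X'"
          proof (rule matched_eqI)
            show "?X' \<subseteq> E" using stableD(1)[OF stable_apply_rotation[OF X tandem_circuit(1)]] .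
            fix k assume k: "k < n"
            have "es ! k \<in> fst L \<longleftrightarrow> k \<in> alt' ` {q..<h}"
              unfolding L_def fst_conv using altn nth_inj[OF k] by (auto simp: image_iff)
            moreover have "es ! k \<in> snd L \<longleftrightarrow> k \<in> stk ` {q..<h}"
              unfolding L_def snd_conv using altn nth_inj[OF k] by (auto simp: image_iff)
            ultimately show "arr s4 ''cur'' k \<noteq> 0 \<longleftrightarrow> es ! k \<in> ?X'"
              unfolding post(9) apply_rotation_def using k by (auto simp: X_def)
          qed
          have "search_inv ?X' q stk alt' (arr s4 ''ons'') fin"
            by (rule search_cycle(2)[OF inv q(1) alt_old alt_new' post(10) L_def])
          moreover have "route_listed s4 X0 (Ls @ [L]) ?X'"
          proof (rule route_listed_snoc[OF rl3 X tandem_circuit(1) q(1) L_def _ tandem_circuit(4,5)])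
            fix u assume u: "q \<le> u" "u < h"
            show "alt' u < n \<and> stk u < n \<and> fst (es ! alt' u) = fst (es ! stk u) \<and>
                tandem G X (es ! alt' u) (es ! (if Suc u = h then stk q else stk (Suc u)))"
              using altn[OF u] tandem_circuit(6)[of u] tandem_circuit(3)[of u] u by simp
          next
            show "reg s4 ''nR'' = Suc (reg s3 ''nR'')" using post(4) reg3 by simp
          next
            show "arr s4 ''plusStart'' = (arr s3 ''plusStart'')(Suc (reg s3 ''nR'') := arr s3 ''plusStart'' (reg s3 ''nR'') + (h - q))"
              using post(5) reg3 by simp
          next
            show "arr s4 ''minusStart'' = (arr s3 ''minusStart'')(Suc (reg s3 ''nR'') := arr s3 ''plusStart'' (reg s3 ''nR'') + (h - q))"
              using post(6) reg3 by simp
          qed (use post(7,8) reg3 in auto)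
          ultimately have "search_state X0 s4"
            unfolding search_state_def m4 using post(3) keep4 by auto
          moreover have "progress s < progress s4"
          proof -
            have "card (snd L) = h - q" unfolding L_def snd_conv using tandem_circuit(5) by (simp add: card_image)
            then have "depth X + (h - q) \<le> depth ?X'" using depth_apply_rotation(3)[OF X tandem_circuit(1)] by simp
            then show ?thesis unfolding progress_def m4 X_def[symmetric] keep4 post(3) run fin_def[symmetric] h_def[symmetric]
              using q(1) by simp
          qed
          moreover have "t4 \<le> t + 23 * n + 30"
          proof -
            have "h \<le> n" using search_bound[OF inv] by simp
            then show ?thesis using post(2) t2 by simp
          qed
          ultimately show ?case using P[OF fr4] keep4 by blast
        qed
        then show "wp D Q (Cond (Equal (Cell ''ons'' (Reg ''r'')) (Num 0)) push emit_rotation) P s3 (Suc (Suc t2))"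
          unfolding wp_Cond using False arr2 by (simp add: s3_def)
      qed
    qed
  qed
  have "exp_val (Cell ''stk'' (Dec (Reg ''ht''))) s = x" by (simp add: x_def stk_def h_def)
  then show ?thesis using body unfolding explore_def wp_Seq wp_Assign s1_def by simp
qed

text \<open>When all edges of the matching are retired, no rotation is available, since applying it would remove
an edge; so the greatest stable matching has been reached.\<close>

lemma wp_search_rotations:
  assumes st: "static s" and li: "linked s" and ss: "search_state X0 s" and least: "least_stable G X0"
    and P: "\<And>s' t' Ls. frame search_regs search_arrs s s' \<Longrightarrow> t' \<le> t + 2 + (4 * n + 1) * (23 * n + 32) \<Longrightarrow>
      route_listed s' X0 Ls (matched (arr s' ''cur'')) \<Longrightarrow> greatest_stable G (matched (arr s' ''cur'')) \<Longrightarrow> P s' t'"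
  shows "wp D Q search_rotations P s t"
proof -
  let ?K = "23 * n + 32"
  define I where "I = (\<lambda>s' t'. frame search_regs search_arrs s s' \<and> search_state X0 s' \<and>
     (reg s' ''run'' = 1 \<or> reg s' ''run'' = 0 \<and> (\<forall>k < n. arr s' ''cur'' k \<noteq> 0 \<longrightarrow> arr s' ''fin'' k \<noteq> 0)) \<and>
     t' \<le> t + 1 + progress s' * ?K)"
  have bound: "progress s' * ?K \<le> (4 * n + 1) * ?K" if "search_state X0 s'" for s'
    using progress_le[OF that] by (rule mult_le_mono1)
  show ?thesis unfolding search_rotations_def wp_Seq wp_Assign
  proof (rule wp_Loop[where I = I and T = "t + 1 + (4 * n + 1) * ?K"], goal_cases)
    case 1
    have "route_listed (set_reg ''run'' 1 s) X0 Ls X" if "route_listed s X0 Ls X" for Ls X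
      by (rule route_listed_frame[OF that, where U = "{''run''}" and V = "{}"]) simp_all
    then show ?case using ss by (auto simp: I_def search_state_def)
  next
    case (2 s' t') then show ?case using bound[of s'] unfolding I_def by linarith
  next
    case (3 s1 t1)
    have fr1: "frame search_regs search_arrs s s1" and ss1: "search_state X0 s1" and run: "reg s1 ''run'' = 1"
      and t1: "t1 \<le> t + 1 + progress s1 * ?K" using 3 by (auto simp: I_def)
    have st1: "static s1" by (rule static_frame[OF st fr1]) simp_all
    have li1: "linked s1" by (rule linked_frame[OF li fr1]) simp
    have time: "t' \<le> t + 1 + progress s' * ?K" if "progress s1 < progress s'" "t' \<le> t1 + ?K" for s' t'
    proof -
      have "(progress s1 + 1) * ?K \<le> progress s' * ?K" using that(1) by (intro mult_le_mono1) simp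
      then show ?thesis using that(2) t1 by (simp add: algebra_simps)
    qed
    show ?case unfolding wp_Cond
    proof (simp split: if_split, intro conjI impI)
      assume ht: "reg s1 ''ht'' = 0"
      show "wp D Q restart I s1 (Suc (Suc t1))"
      proof (rule wp_restart[OF st1 ss1 run ht])
        fix s2 t2 assume a: "frame search_regs search_arrs s1 s2" "t2 \<le> Suc (Suc t1) + 4 * n + 7"
          "search_state X0 s2" "progress s1 < progress s2"
          "reg s2 ''run'' = 1 \<or> reg s2 ''run'' = 0 \<and> (\<forall>k < n. arr s2 ''cur'' k \<noteq> 0 \<longrightarrow> arr s2 ''fin'' k \<noteq> 0)"
        have "frame search_regs search_arrs s s2" by (rule frame_trans[OF fr1 a(1)]) simp_all
        then show "I s2 t2" unfolding I_def using a time[OF a(4)] by simp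
      qed
    next
      assume ht: "0 < reg s1 ''ht''"
      show "wp D Q explore I s1 (Suc (Suc t1))"
      proof (rule wp_explore[OF st1 li1 ss1 run])
        show "reg s1 ''ht'' \<noteq> 0" using ht by simp
        fix s2 t2 assume a: "frame search_regs search_arrs s1 s2" "t2 \<le> Suc (Suc t1) + 23 * n + 30"
          "search_state X0 s2" "progress s1 < progress s2" "reg s2 ''run'' = 1"
        have "frame search_regs search_arrs s s2" by (rule frame_trans[OF fr1 a(1)]) simp_all
        then show "I s2 t2" unfolding I_def using a time[OF a(4)] by simp
      qed
    qed
  next
    case (4 s1 t1)
    have fr1: "frame search_regs search_arrs s s1" and ss1: "search_state X0 s1"
      and all_fin: "\<And>k. k < n \<Longrightarrow> arr s1 ''cur'' k \<noteq> 0 \<Longrightarrow> arr s1 ''fin'' k \<noteq> 0"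
      and t1: "t1 \<le> t + 1 + progress s1 * ?K" using 4 by (auto simp: I_def)
    let ?X = "matched (arr s1 ''cur'')"
    obtain Ls where rl: "route_listed s1 X0 Ls ?X"
      and inv: "search_inv ?X (reg s1 ''ht'') (arr s1 ''stk'') (arr s1 ''alt'') (arr s1 ''ons'') (arr s1 ''fin'')"
      using ss1 by (auto simp: search_state_def)
    note i = inv[unfolded search_inv_def]
    have X: "stable G ?X" using i by blast
    have "rotations_at G ?X = {}"
    proof (rule ccontr)
      assume "rotations_at G ?X \<noteq> {}"
      then obtain L where L: "L \<in> rotations_at G ?X" by blast
      note r = rotationD[OF X L]
      obtain b where b: "b \<in> snd L" using r(2) by blast
      then have bX: "b \<in> ?X" using r(1) by blast
      then obtain k where k: "k < n" "b = es ! k" using E_nth matched_sub by blast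
      then have "arr s1 ''fin'' k \<noteq> 0" using all_fin bX by simp
      then have "b \<in> apply_rotation L ?X"
        using i k stable_apply_rotation[OF X L] leF_apply_rotation[OF X L] by blast
      then show False using b r(1,4) unfolding apply_rotation_def by blast
    qed
    then have "greatest_stable G ?X" by (rule terminal_greatest[OF least X])
    then show ?case using P[OF fr1 _ rl] t1 bound[OF ss1] by simp
  qed
qed

section \<open>The Hasse diagram\<close>

definition passes :: "store \<Rightarrow> (nat \<times> nat) set \<Rightarrow> nat \<Rightarrow> bool" where
  "passes s Y p \<longleftrightarrow> edge_at s ''minus'' p \<in> Y \<and>
     (\<forall>d. edge_at s ''minus'' p \<succ> d \<longrightarrow> d \<succ> edge_at s ''plus'' p \<longrightarrow> d \<notin> grow Y d) \<and>
     edge_at s ''plus'' p \<in> grow Y (edge_at s ''plus'' p) \<and>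
     edge_at s ''tdm'' p \<notin> grow Y (edge_at s ''plus'' p)"

text \<open>The tests establish the tandems of the cycle in which the rotation was found. Conversely, if the rotation
is available, it consists of just these tandems by \<open>rotation_pairing\<close>.\<close>

lemma available_iff_passes:
  assumes least: "least_stable G X0" and Y: "stable G Y" and R: "listed s j R"
  shows "R \<in> rotations_at G Y \<longleftrightarrow> (\<forall>p \<in> entries s j. passes s Y p)"
proof -
  note l = R[unfolded listed_def]
  obtain Z where Z: "stable G Z" "R \<in> rotations_at G Z"
    "\<And>p. p \<in> entries s j \<Longrightarrow> tandem G Z (edge_at s ''plus'' p) (edge_at s ''tdm'' p)" using l by blast
  have fstR: "fst R = edge_at s ''plus'' ` entries s j" and sndR: "snd R = edge_at s ''minus'' ` entries s j"
    using l by blast+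
  have mp: "edge_at s ''minus'' p \<succ> edge_at s ''plus'' p" if "p \<in> entries s j" for p using l that by blast
  have plusR: "edge_at s ''plus'' p \<in> fst R" if "p \<in> entries s j" for p using fstR that by blast
  have minusR: "edge_at s ''minus'' p \<in> snd R" if "p \<in> entries s j" for p using sndR that by blast
  note rZ = rotationD[OF Z(1,2)]
  have tdmR: "edge_at s ''tdm'' p \<in> snd R" if p: "p \<in> entries s j" for p
    using rZ(8)[OF plusR[OF p]] tandem_unique[OF Z(1) _ Z(3)[OF p]] by blast
  show ?thesis
  proof
    assume RY: "R \<in> rotations_at G Y"
    note r = rotationD[OF Y RY]
    show "\<forall>p \<in> entries s j. passes s Y p"
    proof
      fix p assume p: "p \<in> entries s j"
      have t: "tandem G Y (edge_at s ''plus'' p) (edge_at s ''tdm'' p)"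
        by (rule rotation_pairing[OF least Z(1) Y Z(2) RY Z(3)[OF p] plusR[OF p]])
      note t' = tandemD[OF Y t]
      have mY: "edge_at s ''minus'' p \<in> Y" using minusR[OF p] r(1) by blast
      obtain x where x: "x \<in> Y" "x \<succ> edge_at s ''plus'' p" "edge_at s ''plus'' p \<in> grow Y (edge_at s ''plus'' p)"
        "\<forall>e. x \<succ> e \<longrightarrow> e \<in> grow Y e \<longrightarrow> e \<noteq> edge_at s ''plus'' p \<longrightarrow> edge_at s ''plus'' p \<succ> e"
        using t'(1) unfolding W_admissible_iff[OF Y] by blast
      have "x = edge_at s ''minus'' p"
        using stable_unique[OF Y x(1) mY] x(2) mp[OF p] unfolding better_def by metis
      then have "d \<notin> grow Y d" if "edge_at s ''minus'' p \<succ> d" "d \<succ> edge_at s ''plus'' p" for d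
        using x(4) that better_asym better_irrefl by metis
      moreover have "edge_at s ''tdm'' p \<notin> grow Y (edge_at s ''plus'' p)" using t'(6,7) by simp
      ultimately show "passes s Y p" unfolding passes_def using mY x(3) by blast
    qed
  next
    assume pass: "\<forall>p \<in> entries s j. passes s Y p"
    have RY: "snd R \<subseteq> Y"
      unfolding sndR by (rule image_subsetI) (use pass in \<open>simp add: passes_def\<close>)
    have tan: "tandem G Y (edge_at s ''plus'' p) (edge_at s ''tdm'' p)" if p: "p \<in> entries s j" for p
    proof -
      let ?a = "edge_at s ''plus'' p" and ?m = "edge_at s ''minus'' p"
      have ps: "?m \<in> Y" "\<And>d. ?m \<succ> d \<Longrightarrow> d \<succ> ?a \<Longrightarrow> d \<notin> grow Y d" "?a \<in> grow Y ?a"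
        "edge_at s ''tdm'' p \<notin> grow Y ?a" using pass p unfolding passes_def by blast+
      have "?a \<succ> e" if e: "?m \<succ> e" "e \<in> grow Y e" "e \<noteq> ?a" for e
      proof -
        have "?a \<succ> e \<or> e \<succ> ?a" using better_total[of ?a e] mp[OF p] e(1,3) unfolding better_def by metis
        then show ?thesis using ps(2)[OF e(1)] e(2) by blast
      qed
      then have "W_admissible G Y ?a" unfolding W_admissible_iff[OF Y] using ps(1,3) mp[OF p] by blast
      moreover have "edge_at s ''tdm'' p \<in> Y" using tdmR[OF p] RY by blast
      moreover have "snd (edge_at s ''tdm'' p) = snd ?a" using tandemD(5)[OF Z(1) Z(3)[OF p]] .
      ultimately show ?thesis using tandemI[OF Y] ps(4) by blast
    qed
    obtain ts where ts: "tandem_circuit Z ts" "R = (set (map fst ts), set (map snd ts))"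
      using Z(2) rotations_at_iff by blast
    have "tandem G Y (fst t) (snd t)" if t: "t \<in> set ts" for t
    proof -
      have tz: "tandem G Z (fst t) (snd t)" using ts(1) t unfolding tandem_circuit_def by blast
      have "fst t \<in> fst R" using ts(2) t by simp
      then obtain p where p: "p \<in> entries s j" "fst t = edge_at s ''plus'' p" using fstR by blast
      then have "snd t = edge_at s ''tdm'' p"
        using tandem_unique[OF Z(1) tz Z(3)[OF p(1)]] by simp
      then show ?thesis using tan[OF p(1)] p(2) by simp
    qed
    then have "tandem_circuit Y ts" using ts(1) unfolding tandem_circuit_def by blast
    then show "R \<in> rotations_at G Y" using ts(2) rotations_at_iff by blast
  qed
qed

text \<open>The number of steps in the list of the worker from the old to the new edge.\<close>

definition gap :: "store \<Rightarrow> nat \<Rightarrow> nat" where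
  "gap s p = rk (edge_at s ''plus'' p) - rk (edge_at s ''minus'' p)"


text \<open>The edges looked at are worse than the old edge of the worker. Since this is an edge of the stable matching
\<open>Y\<close>, none of them is, and so \<open>probe\<close> leaves the matching as it was.\<close>

lemma wp_test_entry:
  fixes s :: store
  defines "p \<equiv> reg s ''p''" and "Y \<equiv> matched (arr s ''cur'')"
  assumes st: "static s" and li: "linked s" and Y: "stable G Y"
    and m: "arr s ''minus'' p < n" and a: "arr s ''plus'' p < n" and b: "arr s ''tdm'' p < n"
    and ma: "edge_at s ''minus'' p \<succ> edge_at s ''plus'' p" and mY: "edge_at s ''minus'' p \<in> Y"
    and sb: "snd (edge_at s ''tdm'' p) = snd (edge_at s ''plus'' p)"
    and ok: "reg s ''ok'' = 0 \<or> reg s ''ok'' = 1"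
    and P: "\<And>s' t'. frame {''e'', ''ok''} {''ans''} s s' \<Longrightarrow> t' \<le> t + 7 + 7 * gap s p \<Longrightarrow>
      reg s' ''ok'' = (if reg s ''ok'' = 1 \<and> passes s Y p then 1 else 0) \<Longrightarrow> P s' t'"
  shows "wp D Q test_entry P s t"
proof -
  let ?m = "edge_at s ''minus'' p" and ?a = "edge_at s ''plus'' p"
  have notY: "arr s ''cur'' k = 0" if "k < n" "?m \<succ> es ! k" for k
  proof (rule ccontr)
    assume "arr s ''cur'' k \<noteq> 0"
    then have "es ! k \<in> Y" using that(1) by (simp add: Y_def)
    then have "es ! k = ?m" using stable_unique[OF Y _ mY] that(2) unfolding better_def by metis
    then show False using that(2) better_irrefl by simp
  qed
  define I where "I = (\<lambda>s' t'. frame {''e'', ''ok''} {''ans''} s s' \<and> reg s' ''e'' < n \<and> ?m \<succ> es ! reg s' ''e'' \<and>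
     (es ! reg s' ''e'' = ?a \<or> es ! reg s' ''e'' \<succ> ?a) \<and>
     reg s' ''ok'' = (if reg s ''ok'' = 1 \<and> (\<forall>d. ?m \<succ> d \<longrightarrow> d \<succ> es ! reg s' ''e'' \<longrightarrow> d \<notin> grow Y d) then 1 else 0) \<and>
     t' + 7 \<le> t + 1 + 7 * (rk (es ! reg s' ''e'') - rk ?m))"
  have nx: "arr s ''nxt'' k < n \<and> es ! k \<succ> es ! arr s ''nxt'' k \<and> rk (es ! arr s ''nxt'' k) = Suc (rk (es ! k)) \<and>
      (es ! arr s ''nxt'' k = d \<or> es ! arr s ''nxt'' k \<succ> d)" if "k < n" "es ! k \<succ> d" for k d
  proof -
    have l: "arr s ''nxt'' k < n" "es ! k \<succ> es ! arr s ''nxt'' k" "rk (es ! arr s ''nxt'' k) = Suc (rk (es ! k))"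
      using li that unfolding linked_def by blast+
    then show ?thesis using next_le[OF l(2,3) that(2)] by blast
  qed
  show ?thesis unfolding test_entry_def wp_Seq wp_Assign
  proof (rule wp_Loop[where I = I and T = "t + 1 + 7 * gap s p"], goal_cases)
    case 1
    note x = nx[OF m ma]
    have "d \<notin> grow Y d" if "?m \<succ> d" "d \<succ> es ! arr s ''nxt'' (arr s ''minus'' p)" for d
      using nx[OF m that(1)] that(2) better_asym better_irrefl by metis
    then show ?case using x ok unfolding I_def by (auto simp: p_def[symmetric])
  next
    case (2 s' t')
    have "rk (es ! reg s' ''e'') \<le> rk ?a" using 2 rk_less unfolding I_def by (metis less_imp_le order_refl)
    then show ?case using 2 unfolding I_def gap_def by linarith
  next
    case (3 s1 t1)
    let ?e = "reg s1 ''e''"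
    have fr1: "frame {''e'', ''ok''} {''ans''} s s1" and e: "?e < n" "?m \<succ> es ! ?e"
      and ea: "es ! ?e = ?a \<or> es ! ?e \<succ> ?a"
      and ok1: "reg s1 ''ok'' = (if reg s ''ok'' = 1 \<and> (\<forall>d. ?m \<succ> d \<longrightarrow> d \<succ> es ! ?e \<longrightarrow> d \<notin> grow Y d) then 1 else 0)"
      and t1: "t1 + 7 \<le> t + 1 + 7 * (rk (es ! ?e) - rk ?m)" using 3(1) unfolding I_def by blast+
    have same: "arr s1 ''plus'' = arr s ''plus''" "reg s1 ''p'' = p" "arr s1 ''cur'' = arr s ''cur''"
      "arr s1 ''nxt'' = arr s ''nxt''"
      using fr1 by (simp_all add: frame_def p_def)
    have "es ! ?e \<noteq> ?a" using 3(2) same nth_inj[OF e(1) a] by simp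
    then have ea': "es ! ?e \<succ> ?a" using ea by blast
    note x = nx[OF e(1) ea']
    have st1: "static s1" by (rule static_frame[OF st fr1]) simp_all
    show ?case unfolding wp_Seq
    proof (rule wp_probe[OF st1 e(1)], goal_cases)
      case 1 show ?case using notY[OF e] same by simp
    next
      case (2 s2)
      have fr2: "frame {''e'', ''ok''} {''ans''} s s2" by (rule frame_trans[OF fr1 2(1)]) simp_all
      have e2: "reg s2 ''e'' = ?e" "arr s2 ''nxt'' = arr s ''nxt''" "reg s2 ''ok'' = reg s1 ''ok''"
        using 2(1) same by (simp_all add: frame_def)
      have ans: "arr s2 ''ans'' ?e = 0 \<longleftrightarrow> es ! ?e \<notin> grow Y (es ! ?e)"
        using 2(2)[OF e(1) refl] same by (auto simp: Y_def)
      define s3 where "s3 = (if arr s2 ''ans'' ?e = 0 then s2 else set_reg ''ok'' 0 s2)"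
      let ?e' = "arr s ''nxt'' ?e"
      \<comment> \<open>one round checks exactly one further edge\<close>
      have split: "?m \<succ> d \<and> d \<succ> es ! ?e' \<longleftrightarrow> d = es ! ?e \<or> ?m \<succ> d \<and> d \<succ> es ! ?e" for d
      proof
        assume d: "?m \<succ> d \<and> d \<succ> es ! ?e'"
        have "d = es ! ?e \<or> d \<succ> es ! ?e \<or> es ! ?e \<succ> d"
          using better_total[of d "es ! ?e"] d e unfolding better_def by metis
        moreover have "\<not> es ! ?e \<succ> d" using nx[OF e(1)] d better_asym better_irrefl by metis
        ultimately show "d = es ! ?e \<or> ?m \<succ> d \<and> d \<succ> es ! ?e" using d by blast
      next
        assume "d = es ! ?e \<or> ?m \<succ> d \<and> d \<succ> es ! ?e"
        moreover have "es ! ?e \<succ> es ! ?e'" using x by blast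
        ultimately show "?m \<succ> d \<and> d \<succ> es ! ?e'" using e(2) better_trans[of d "es ! ?e"] by metis
      qed
      have "reg s3 ''ok'' = (if reg s ''ok'' = 1 \<and> (\<forall>d. ?m \<succ> d \<longrightarrow> d \<succ> es ! ?e' \<longrightarrow> d \<notin> grow Y d) then 1 else 0)"
      proof -
        have "(\<forall>d. ?m \<succ> d \<longrightarrow> d \<succ> es ! ?e' \<longrightarrow> d \<notin> grow Y d) \<longleftrightarrow>
            es ! ?e \<notin> grow Y (es ! ?e) \<and> (\<forall>d. ?m \<succ> d \<longrightarrow> d \<succ> es ! ?e \<longrightarrow> d \<notin> grow Y d)" (is "?A = ?B")
        proof
          assume A: ?A
          then have "d \<notin> grow Y d" if "d = es ! ?e \<or> ?m \<succ> d \<and> d \<succ> es ! ?e" for d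
            using split[of d] that by simp
          then show ?B by simp
        next
          assume ?B
          then have "d \<notin> grow Y d" if "?m \<succ> d" "d \<succ> es ! ?e'" for d
            using split[of d] that by metis
          then show ?A by simp
        qed
        then show ?thesis unfolding s3_def using ans ok1 e2 by simp
      qed
      moreover have "Suc (rk ?m) \<le> rk (es ! ?e)" using rk_less[OF e(2)] by simp
      moreover have "frame {''e'', ''ok''} {''ans''} s s3" using fr2 by (simp add: s3_def)
      ultimately have "I (set_reg ''e'' ?e' s3) (t1 + 7)"
        unfolding I_def using x better_trans[OF e(2)] t1 by simp
      then have I3: "I (set_reg ''e'' ?e' s3) (t1 + 7)" .
      show ?case
      proof (cases "arr s2 ''ans'' ?e = 0")
        case True
        then have "s3 = s2" by (simp add: s3_def)
        then show ?thesis using True I3 e2 unfolding wp_simps by (simp add: eval_nat_numeral)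
      next
        case False
        then have "s3 = set_reg ''ok'' 0 s2" by (simp add: s3_def)
        then show ?thesis using False I3 e2 unfolding wp_simps by (simp add: eval_nat_numeral)
      qed
    qed
  next
    case (4 s1 t1)
    let ?e = "reg s1 ''e''"
    have fr1: "frame {''e'', ''ok''} {''ans''} s s1" and e: "?e < n" "?m \<succ> es ! ?e"
      and ok1: "reg s1 ''ok'' = (if reg s ''ok'' = 1 \<and> (\<forall>d. ?m \<succ> d \<longrightarrow> d \<succ> es ! ?e \<longrightarrow> d \<notin> grow Y d) then 1 else 0)"
      and t1: "t1 + 7 \<le> t + 1 + 7 * (rk (es ! ?e) - rk ?m)" using 4(1) unfolding I_def by blast+
    have same: "arr s1 ''plus'' = arr s ''plus''" "reg s1 ''p'' = p" "arr s1 ''cur'' = arr s ''cur''"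
      "arr s1 ''tdm'' = arr s ''tdm''" using fr1 by (simp_all add: frame_def p_def)
    have ea: "es ! ?e = ?a" "?e = arr s ''plus'' p" using 4(2) same by simp_all
    have st1: "static s1" by (rule static_frame[OF st fr1]) simp_all
    show ?case unfolding wp_Seq
    proof (rule wp_probe[OF st1 e(1)], goal_cases)
      case 1 show ?case using notY[OF e] same by simp
    next
      case (2 s2)
      have fr2: "frame {''e'', ''ok''} {''ans''} s s2" by (rule frame_trans[OF fr1 2(1)]) simp_all
      have e2: "reg s2 ''e'' = ?e" "arr s2 ''tdm'' = arr s ''tdm''" "reg s2 ''ok'' = reg s1 ''ok''" "reg s2 ''p'' = p"
        using 2(1) same by (simp_all add: frame_def)
      have ans: "arr s2 ''ans'' ?e = 0 \<longleftrightarrow> ?a \<notin> grow Y ?a"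
        "arr s2 ''ans'' (arr s ''tdm'' p) = 0 \<longleftrightarrow> edge_at s ''tdm'' p \<notin> grow Y ?a"
        using 2(2)[OF e(1) refl] 2(2)[OF b] sb same ea by (auto simp: Y_def)
      define s3 where "s3 = (if arr s2 ''ans'' ?e \<noteq> 0 \<and> arr s2 ''ans'' (arr s ''tdm'' p) = 0 then s2 else set_reg ''ok'' 0 s2)"
      have "reg s3 ''ok'' = (if reg s ''ok'' = 1 \<and> passes s Y p then 1 else 0)"
        unfolding s3_def passes_def ea(1)[symmetric] using ans mY ok1 e2 ea by auto
      moreover have "frame {''e'', ''ok''} {''ans''} s s3" using fr2 by (simp add: s3_def)
      moreover have "Suc t1 + 3 + 2 \<le> t + 7 + 7 * gap s p" using t1 ea by (simp add: gap_def)
      ultimately have P3: "P s3 (Suc t1 + 3 + 2)" by (intro P)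
      show ?case
      proof (cases "arr s2 ''ans'' ?e \<noteq> 0 \<and> arr s2 ''ans'' (arr s ''tdm'' p) = 0")
        case True
        then have "s3 = s2" by (simp add: s3_def)
        then show ?thesis using True P3 e2 unfolding wp_simps by simp
      next
        case False
        then have "s3 = set_reg ''ok'' 0 s2" unfolding s3_def by (rule if_not_P)
        then have "P (set_reg ''ok'' 0 s2) (Suc t1 + 3 + 2)" using P3 by simp
        then show ?thesis using False e2 unfolding wp_simps by auto
      qed
    qed
  qed
qed


lemma wp_test_rotation:
  fixes s :: store
  defines "j \<equiv> reg s ''j''" and "Y \<equiv> matched (arr s ''cur'')"
  assumes least: "least_stable G X0" and st: "static s" and li: "linked s" and Y: "stable G Y"
    and R: "listed s j R"
    and P: "\<And>s' t'. frame {''e'', ''ok'', ''p''} {''ans''} s s' \<Longrightarrow>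
      t' \<le> t + 3 + 17 * (\<Sum>p \<in> entries s j. gap s p) \<Longrightarrow>
      reg s' ''ok'' = (if R \<in> rotations_at G Y then 1 else 0) \<Longrightarrow> P s' t'"
  shows "wp D Q test_rotation P s t"
proof -
  let ?p0 = "arr s ''plusStart'' j" and ?p1 = "arr s ''plusStart'' (Suc j)"
  note l = R[unfolded listed_def]
  have p01: "?p0 \<le> ?p1" using l by blast
  obtain Z where Z: "stable G Z" "\<And>p. p \<in> entries s j \<Longrightarrow> tandem G Z (edge_at s ''plus'' p) (edge_at s ''tdm'' p)"
    using l by blast
  define I where "I = (\<lambda>s' t'. frame {''e'', ''ok'', ''p''} {''ans''} s s' \<and> ?p0 \<le> reg s' ''p'' \<and> reg s' ''p'' \<le> ?p1 \<and>
     reg s' ''ok'' = (if \<forall>p \<in> {?p0..<reg s' ''p''}. passes s Y p then 1 else 0) \<and>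
     t' \<le> t + 2 + 17 * (\<Sum>p \<in> {?p0..<reg s' ''p''}. gap s p))"
  show ?thesis unfolding test_rotation_def wp_Seq wp_Assign
  proof (rule wp_Loop[where I = I and T = "t + 2 + 17 * (\<Sum>p \<in> entries s j. gap s p)"], goal_cases)
    case 1 show ?case using p01 by (simp add: I_def j_def[symmetric])
  next
    case (2 s' t')
    have "(\<Sum>p \<in> {?p0..<reg s' ''p''}. gap s p) \<le> (\<Sum>p \<in> entries s j. gap s p)"
      by (rule sum_mono2) (use 2 in \<open>auto simp: I_def\<close>)
    then show ?case using 2 unfolding I_def by linarith
  next
    case (3 s1 t1)
    define p where "p = reg s1 ''p''"
    have fr1: "frame {''e'', ''ok'', ''p''} {''ans''} s s1" and p0: "?p0 \<le> p"
      and ok1: "reg s1 ''ok'' = (if \<forall>p \<in> {?p0..<p}. passes s Y p then 1 else 0)"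
      and t1: "t1 \<le> t + 2 + 17 * (\<Sum>p \<in> {?p0..<p}. gap s p)" using 3(1) unfolding I_def p_def by blast+
    have same: "arr s1 x = arr s x" if "x \<noteq> ''ans''" for x using fr1 that by (simp add: frame_def)
    have regj: "reg s1 ''j'' = j" using fr1 by (simp add: frame_def j_def)
    have p: "p < ?p1" using 3(2) regj same by (simp add: p_def)
    have pe: "p \<in> entries s j" using p0 p by simp
    have st1: "static s1" by (rule static_frame[OF st fr1]) simp_all
    have li1: "linked s1" by (rule linked_frame[OF li fr1]) simp
    have bounds: "arr s ''plus'' p < n" "arr s ''minus'' p < n" "arr s ''tdm'' p < n"
      "edge_at s ''minus'' p \<succ> edge_at s ''plus'' p" using l pe by blast+
    have gap1: "1 \<le> gap s p" using rk_less[OF bounds(4)] by (simp add: gap_def)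
    have split: "{?p0..<Suc p} = insert p {?p0..<p}" using p0 by auto
    have next_I: "I (set_reg ''p'' (Suc p) s2) (Suc t2)"
      if fr2: "frame {''e'', ''ok''} {''ans''} s1 s2" and t2: "t2 \<le> t1 + 9 + 7 * gap s p"
        and ok2: "reg s2 ''ok'' = (if reg s1 ''ok'' = 1 \<and> passes s Y p then 1 else 0)" for s2 t2
    proof -
      have "frame {''e'', ''ok'', ''p''} {''ans''} s (set_reg ''p'' (Suc p) s2)"
        using frame_trans[OF fr1 fr2] by simp
      moreover have "Suc t2 \<le> t + 2 + 17 * (\<Sum>p \<in> {?p0..<Suc p}. gap s p)"
        unfolding split using t1 t2 gap1 by simp
      ultimately show ?thesis unfolding I_def using p0 p ok1 ok2 by (simp add: split)
    qed
    show ?case unfolding wp_Seq wp_Cond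
    proof (simp split: if_split, intro conjI impI)
      assume no: "arr s1 ''cur'' (arr s1 ''minus'' (reg s1 ''p'')) = 0"
      then have "arr s ''cur'' (arr s ''minus'' p) = 0" using same by (simp add: p_def)
      then have "\<not> passes s Y p" unfolding passes_def Y_def using bounds by simp
      then have "I (set_reg ''p'' (Suc p) (set_reg ''ok'' 0 s1)) (Suc (Suc (Suc (Suc t1))))"
        by (intro next_I) (simp_all)
      then show "wp D Q (Assign ''ok'' (Num 0)) (\<lambda>s' t'. wp D Q (Assign ''p'' (Inc (Reg ''p''))) I s' t') s1 (Suc (Suc t1))"
        unfolding wp_simps by (simp add: p_def)
    next
      assume yes: "0 < arr s1 ''cur'' (arr s1 ''minus'' (reg s1 ''p''))"
      have mY: "edge_at s ''minus'' p \<in> Y" using yes bounds same by (simp add: p_def Y_def)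
      have passes1: "passes s1 Y p = passes s Y p" "gap s1 p = gap s p"
        using same by (simp_all add: passes_def gap_def)
      show "wp D Q test_entry (\<lambda>s' t'. wp D Q (Assign ''p'' (Inc (Reg ''p''))) I s' t') s1 (Suc (Suc t1))"
      proof (rule wp_test_entry[OF st1 li1], goal_cases)
        case 1 show ?case using Y same by (simp add: Y_def)
      next
        case 2 show ?case using bounds same by (simp add: p_def)
      next
        case 3 show ?case using bounds same by (simp add: p_def)
      next
        case 4 show ?case using bounds same by (simp add: p_def)
      next
        case 5 show ?case using bounds same by (simp add: p_def)
      next
        case 6 show ?case using mY same by (simp add: p_def Y_def)
      next
        case 7 show ?case using tandemD(5)[OF Z(1) Z(2)[OF pe]] same by (simp add: p_def)
      next
        case 8 show ?case using ok1 by simp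
      next
        case (9 s2 t2)
        have "reg s2 ''p'' = p" using 9(1) by (simp add: frame_def p_def)
        moreover have "I (set_reg ''p'' (Suc p) s2) (Suc t2)"
          by (rule next_I[OF 9(1)]) (use 9(2,3) passes1 same in \<open>simp_all add: p_def Y_def\<close>)
        ultimately show ?case unfolding wp_Assign by simp
      qed
    qed
  next
    case (4 s1 t1)
    have fr1: "frame {''e'', ''ok'', ''p''} {''ans''} s s1" using 4(1) by (simp add: I_def)
    have "reg s1 ''j'' = j" "arr s1 ''plusStart'' = arr s ''plusStart''" using fr1 by (simp_all add: frame_def j_def)
    then have "reg s1 ''p'' = ?p1" using 4 by (simp add: I_def)
    then show ?case
      using 4(1) P[OF fr1] available_iff_passes[OF least Y R] by (simp add: I_def)
  qed
qed

lemma wp_apply_listed: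
  fixes s :: store
  defines "j \<equiv> reg s ''j''" and "Y \<equiv> matched (arr s ''cur'')"
  assumes Y: "stable G Y" and R: "listed s j R" and RY: "R \<in> rotations_at G Y"
    and P: "\<And>s' t'. frame {''p''} {''cur''} s s' \<Longrightarrow>
      t' \<le> t + 2 + 4 * (\<Sum>p \<in> entries s j. gap s p) \<Longrightarrow>
      matched (arr s' ''cur'') = apply_rotation R Y \<Longrightarrow> P s' t'"
  shows "wp D Q apply_listed P s t"
proof -
  let ?p0 = "arr s ''plusStart'' j" and ?p1 = "arr s ''plusStart'' (Suc j)"
  note l = R[unfolded listed_def]
  note r = rotationD[OF Y RY]
  have p01: "?p0 \<le> ?p1" using l by blast
  define I where "I = (\<lambda>s' t'. frame {''p''} {''cur''} s s' \<and> ?p0 \<le> reg s' ''p'' \<and> reg s' ''p'' \<le> ?p1 \<and>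
     matched (arr s' ''cur'') = (Y - edge_at s ''minus'' ` {?p0..<reg s' ''p''}) \<union> edge_at s ''plus'' ` {?p0..<reg s' ''p''} \<and>
     t' \<le> t + 1 + 4 * (\<Sum>p \<in> {?p0..<reg s' ''p''}. gap s p))"
  show ?thesis unfolding apply_listed_def wp_Seq wp_Assign
  proof (rule wp_Loop[where I = I and T = "t + 1 + 4 * (\<Sum>p \<in> entries s j. gap s p)"], goal_cases)
    case 1 show ?case using p01 by (simp add: I_def j_def[symmetric] Y_def)
  next
    case (2 s' t')
    have "(\<Sum>p \<in> {?p0..<reg s' ''p''}. gap s p) \<le> (\<Sum>p \<in> entries s j. gap s p)"
      by (rule sum_mono2) (use 2 in \<open>auto simp: I_def\<close>)
    then show ?case using 2 unfolding I_def by linarith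
  next
    case (3 s1 t1)
    define p where "p = reg s1 ''p''"
    let ?A = "edge_at s ''plus'' ` {?p0..<p}" and ?B = "edge_at s ''minus'' ` {?p0..<p}"
    let ?a = "edge_at s ''plus'' p" and ?b = "edge_at s ''minus'' p"
    have fr1: "frame {''p''} {''cur''} s s1" and p0: "?p0 \<le> p"
      and m1: "matched (arr s1 ''cur'') = (Y - ?B) \<union> ?A"
      and t1: "t1 \<le> t + 1 + 4 * (\<Sum>p \<in> {?p0..<p}. gap s p)" using 3(1) unfolding I_def p_def by blast+
    have same: "arr s1 x = arr s x" if "x \<noteq> ''cur''" for x using fr1 that by (simp add: frame_def)
    have regj: "reg s1 ''j'' = j" using fr1 by (simp add: frame_def j_def)
    have p: "p < ?p1" using 3(2) regj same by (simp add: p_def)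
    have pe: "p \<in> entries s j" using p0 p by simp
    have bounds: "arr s ''plus'' p < n" "arr s ''minus'' p < n" "?b \<succ> ?a" using l pe by blast+
    have gap1: "1 \<le> gap s p" using rk_less[OF bounds(3)] by (simp add: gap_def)
    have split: "{?p0..<Suc p} = insert p {?p0..<p}" using p0 by auto
    have "?b \<in> snd R" using l pe by blast
    moreover have "?A \<subseteq> fst R"
    proof -
      have "{?p0..<p} \<subseteq> entries s j" using p by auto
      moreover have "fst R = edge_at s ''plus'' ` entries s j" using l by blast
      ultimately show ?thesis by blast
    qed
    ultimately have "?b \<notin> ?A" using r(1,4) by blast
    then have "insert ?a ((Y - ?B) \<union> ?A - {?b}) =
        (Y - edge_at s ''minus'' ` {?p0..<Suc p}) \<union> edge_at s ''plus'' ` {?p0..<Suc p}"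
      unfolding split by blast
    then have "matched ((arr s1 ''cur'')(arr s ''minus'' p := 0, arr s ''plus'' p := 1)) =
        (Y - edge_at s ''minus'' ` {?p0..<Suc p}) \<union> edge_at s ''plus'' ` {?p0..<Suc p}"
      using matched_insert[OF bounds(1)] matched_remove[OF bounds(2)] m1 by simp
    moreover have "Suc (Suc (Suc (Suc t1))) \<le> t + 1 + 4 * (\<Sum>p \<in> {?p0..<Suc p}. gap s p)"
      unfolding split using t1 gap1 by simp
    ultimately show ?case unfolding wp_simps using fr1 p p0 same
      by (simp add: I_def p_def)
  next
    case (4 s1 t1)
    have fr1: "frame {''p''} {''cur''} s s1" using 4(1) by (simp add: I_def)
    have "reg s1 ''j'' = j" "arr s1 ''plusStart'' = arr s ''plusStart''" using fr1 by (simp_all add: frame_def j_def)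
    then have p: "reg s1 ''p'' = ?p1" using 4 by (simp add: I_def)
    have "matched (arr s1 ''cur'') = apply_rotation R Y"
      using 4(1) l p unfolding I_def apply_rotation_def by metis
    then show ?case using 4(1) P[OF fr1] p by (simp add: I_def)
  qed
qed


lemma wp_copy_flags:
  assumes "x \<noteq> y" and nE: "reg s ''nE'' = n"
    and P: "\<And>s' t'. frame {''k''} {y} s s' \<Longrightarrow> t' \<le> t + 2 + 3 * n \<Longrightarrow>
      (\<And>k. k < n \<Longrightarrow> arr s' y k = arr s x k) \<Longrightarrow> P s' t'"
  shows "wp D Q (copy_flags x y) P s t"
proof -
  define I where "I = (\<lambda>s' t'. frame {''k''} {y} s s' \<and> reg s' ''k'' \<le> n \<and>
    (\<forall>k < reg s' ''k''. arr s' y k = arr s x k) \<and> t' \<le> t + 1 + 3 * reg s' ''k'')"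
  show ?thesis unfolding copy_flags_def wp_Seq wp_Assign
  proof (rule wp_Loop[where I = I and T = "t + 1 + 3 * n"], goal_cases)
    case 1 show ?case by (simp add: I_def)
  next
    case (2 s' t') then show ?case by (simp add: I_def)
  next
    case (3 s1 t1)
    then have "reg s1 ''nE'' = n" "arr s1 x = arr s x" using assms(1) nE by (simp_all add: I_def frame_def)
    then show ?case using 3 unfolding wp_simps by (auto simp: I_def less_Suc_eq)
  next
    case (4 s1 t1)
    then have fr: "frame {''k''} {y} s s1" by (simp add: I_def)
    then have "reg s1 ''nE'' = n" using nE by (simp add: frame_def)
    then have "reg s1 ''k'' = n" using 4 by (simp add: I_def)
    then show ?case using 4(1) P[OF fr] by (simp add: I_def)
  qed
qed

lemma listed_frame:
  assumes "listed s j R" "frame U V s s'"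
    "''plus'' \<notin> V" "''minus'' \<notin> V" "''tdm'' \<notin> V" "''plusStart'' \<notin> V"
  shows "listed s' j R"
  using assms unfolding listed_def by (simp add: frame_def)

lemma gap_frame: "frame U V s s' \<Longrightarrow> ''plus'' \<notin> V \<Longrightarrow> ''minus'' \<notin> V \<Longrightarrow> gap s' p = gap s p"
  by (simp add: gap_def frame_def)

lemma entries_frame: "frame U V s s' \<Longrightarrow> ''plusStart'' \<notin> V \<Longrightarrow> entries s' j = entries s j"
  by (simp add: frame_def)

text \<open>Along a route a worker moves down its list and never returns, so the segments between old and new
edges are disjoint. Formally, each rotation increases the depth by the sum of its gaps.\<close>

lemma total_gap:
  assumes rl: "route_listed s X0 Ls X" and X: "stable G X"
  shows "(\<Sum>j < length Ls. \<Sum>p \<in> entries s j. gap s p) \<le> n"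
proof -
  note r = rl[unfolded route_listed_def]
  let ?N = "length Ls" and ?P = "\<lambda>j. arr s ''plusStart'' j"
  have li: "listed s j (Ls ! j)" if "j < ?N" for j using r that by blast
  have "(\<Sum>i < j. \<Sum>p \<in> entries s i. gap s p) + (\<Sum>p < ?P j. Suc (rk (edge_at s ''minus'' p))) =
      (\<Sum>p < ?P j. Suc (rk (edge_at s ''plus'' p)))" if "j \<le> ?N" for j
    using that
  proof (induction j)
    case 0 then show ?case using r by simp
  next
    case (Suc j)
    note l = li[of j, unfolded listed_def]
    have P: "?P j \<le> ?P (Suc j)" using l Suc.prems by simp
    have split: "(\<Sum>p < ?P (Suc j). g p) = (\<Sum>p < ?P j. g p) + (\<Sum>p \<in> entries s j. g p)" for g :: "nat \<Rightarrow> nat"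
    proof -
      have "{..<?P (Suc j)} = {..<?P j} \<union> entries s j" using P by auto
      then show ?thesis by (simp add: sum.union_disjoint ivl_disj_int)
    qed
    have "(\<Sum>p \<in> entries s j. gap s p) + (\<Sum>p \<in> entries s j. Suc (rk (edge_at s ''minus'' p))) =
       (\<Sum>p \<in> entries s j. Suc (rk (edge_at s ''plus'' p)))"
      unfolding sum.distrib[symmetric]
    proof (rule sum.cong[OF refl])
      fix p assume p: "p \<in> entries s j"
      have "j < ?N" using Suc.prems by simp
      then have "edge_at s ''minus'' p \<succ> edge_at s ''plus'' p" using l p by blast
      from rk_less[OF this] show "gap s p + Suc (rk (edge_at s ''minus'' p)) = Suc (rk (edge_at s ''plus'' p))"
        by (simp add: gap_def)
    qed
    then show ?case using Suc unfolding split by simp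
  qed
  from this[of ?N] have "(\<Sum>j < ?N. \<Sum>p \<in> entries s j. gap s p) + depth X0 = depth X" using r by simp
  moreover have "depth X \<le> n" using depth_le stableD(1,2)[OF X] card_E by metis
  ultimately show ?thesis by simp
qed

text \<open>What the last phase takes over from the search; \<open>w j\<close> measures the work for testing the rotation number \<open>j\<close>.\<close>

definition ready :: "(nat, nat) rotation list \<Rightarrow> (nat \<Rightarrow> nat) \<Rightarrow> store \<Rightarrow> bool" where
  "ready Ls w s \<longleftrightarrow> static s \<and> linked s \<and> reg s ''nR'' = length Ls \<and>
     (\<forall>j < length Ls. listed s j (Ls ! j) \<and> (\<Sum>p \<in> entries s j. gap s p) = w j)"

abbreviation "hasse_regs \<equiv> {''i'', ''j'', ''k'', ''ok'', ''p'', ''e'', ''nH''}"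
abbreviation "hasse_arrs \<equiv> {''cur'', ''ans'', ''tail'', ''head''}"

lemma ready_frame:
  assumes "ready Ls w s" "frame hasse_regs hasse_arrs s s'"
  shows "ready Ls w s'"
proof -
  have "static s'" by (rule static_frame[OF _ assms(2)]) (use assms(1) in \<open>simp_all add: ready_def\<close>)
  moreover have "linked s'" by (rule linked_frame[OF _ assms(2)]) (use assms(1) in \<open>simp_all add: ready_def\<close>)
  moreover have "reg s' ''nR'' = length Ls" using assms by (simp add: ready_def frame_def)
  moreover have "listed s' j (Ls ! j)" if "j < length Ls" for j
    by (rule listed_frame[OF _ assms(2)]) (use assms(1) that in \<open>simp_all add: ready_def\<close>)
  moreover have "(\<Sum>p \<in> entries s' j. gap s' p) = w j" if "j < length Ls" for j
  proof -
    have "gap s' p = gap s p" for p by (rule gap_frame[OF assms(2)]) simp_all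
    moreover have "entries s' j = entries s j" by (rule entries_frame[OF assms(2)]) simp
    ultimately show ?thesis using assms(1) that by (simp add: ready_def)
  qed
  ultimately show ?thesis by (simp add: ready_def)
qed

lemma sum_prefix_le:
  fixes w :: "nat \<Rightarrow> nat"
  shows "j \<le> N \<Longrightarrow> (\<Sum>l < j. w l) \<le> (\<Sum>l < N. w l)"
  by (rule sum_mono2) auto

lemma wp_skip_pass:
  assumes least: "least_stable G X0" and full: "full_route G Ls" and rd: "ready Ls w s"
    and i: "reg s ''i'' < length Ls" and X0: "matched (arr s ''cur'') = X0"
    and P: "\<And>s' t'. frame {''j'', ''ok'', ''p'', ''e''} {''cur'', ''ans''} s s' \<Longrightarrow>
      t' \<le> t + 2 + 9 * length Ls + 21 * (\<Sum>l < length Ls. w l) \<Longrightarrow> stable G (matched (arr s' ''cur'')) \<Longrightarrow>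
      passed (matched (arr s' ''cur'')) =
        {Ls ! l | l. l < length Ls \<and> l \<noteq> reg s ''i'' \<and> \<not> rot_less G (Ls ! reg s ''i'') (Ls ! l)} \<Longrightarrow> P s' t'"
  shows "wp D Q skip_pass P s t"
proof -
  let ?i = "reg s ''i''" and ?N = "length Ls"
  let ?S = "\<lambda>j. {Ls ! l | l. l < j \<and> l \<noteq> ?i \<and> \<not> rot_less G (Ls ! ?i) (Ls ! l)}"
  define I where "I = (\<lambda>s' t'. frame {''j'', ''ok'', ''p'', ''e''} {''cur'', ''ans''} s s' \<and> reg s' ''j'' \<le> ?N \<and>
    stable G (matched (arr s' ''cur'')) \<and> passed (matched (arr s' ''cur'')) = ?S (reg s' ''j'') \<and>
    t' \<le> t + 1 + 9 * reg s' ''j'' + 21 * (\<Sum>l < reg s' ''j''. w l))"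
  show ?thesis unfolding skip_pass_def wp_Seq wp_Assign
  proof (rule wp_Loop[where I = I and T = "t + 1 + 9 * ?N + 21 * (\<Sum>l < ?N. w l)"], goal_cases)
    case 1
    have "passed X0 = {}" by (rule passed_least[OF least])
    then show ?case using X0 least by (simp add: I_def least_stable_def)
  next
    case (2 s' t')
    have j: "reg s' ''j'' \<le> ?N" using 2 by (simp add: I_def)
    then show ?case using 2 sum_prefix_le[OF j, of w] unfolding I_def by linarith
  next
    case (3 s1 t1)
    define j where "j = reg s1 ''j''"
    let ?Y = "matched (arr s1 ''cur'')"
    have fr1: "frame {''j'', ''ok'', ''p'', ''e''} {''cur'', ''ans''} s s1" and Y: "stable G ?Y"
      and pY: "passed ?Y = ?S j"
      and t1: "t1 \<le> t + 1 + 9 * j + 21 * (\<Sum>l < j. w l)" using 3(1) unfolding I_def j_def by blast+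
    have rd1: "ready Ls w s1" by (rule ready_frame[OF rd frame_trans[OF frame_refl fr1]]) auto
    have reg1: "reg s1 ''nR'' = ?N" "reg s1 ''i'' = ?i" using rd1 fr1 by (simp_all add: ready_def frame_def)
    have j: "j < ?N" using 3(2) reg1 by (simp add: j_def)
    have keep: "I (set_reg ''j'' (Suc j) s2) (Suc t2)"
      if "frame {''j'', ''ok'', ''p'', ''e''} {''cur'', ''ans''} s1 s2" "t2 \<le> t1 + 8 + 21 * w j"
        "stable G (matched (arr s2 ''cur''))" "passed (matched (arr s2 ''cur'')) = ?S (Suc j)" for s2 t2
      using frame_trans[OF fr1 that(1)] that(2-4) j t1 by (simp add: I_def)
    have done_step: "?S (Suc j) = (if j \<noteq> ?i \<and> \<not> rot_less G (Ls ! ?i) (Ls ! j) then insert (Ls ! j) (?S j) else ?S j)"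
      unfolding less_Suc_eq by auto
    show ?case
    proof (cases "reg s1 ''j'' = ?i")
      case True
      then have ji: "j = ?i" by (simp add: j_def)
      have "I (set_reg ''j'' (Suc j) s1) (Suc (Suc (Suc (Suc t1))))"
        by (rule keep) (use pY Y done_step ji in simp_all)
      then show ?thesis using True reg1 unfolding wp_simps by (simp add: j_def)
    next
      case neq: False
      then have ji: "j \<noteq> ?i" by (simp add: j_def)
      have step: "Ls ! j \<in> rotations_at G ?Y \<longleftrightarrow> \<not> rot_less G (Ls ! ?i) (Ls ! j)"
        by (rule skip_step[OF least full i j Y pY ji])
      have W: "wp D Q (test_rotation ;; Cond (Equal (Reg ''ok'') (Num 1)) apply_listed Nop)
          (\<lambda>s' t'. wp D Q (Assign ''j'' (Inc (Reg ''j''))) I s' t') s1 (Suc (Suc t1))"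
        unfolding wp_Seq
      proof (rule wp_test_rotation[OF least, where R = "Ls ! j"], goal_cases)
        case 1 then show ?case using rd1 by (simp add: ready_def)
      next
        case 2 then show ?case using rd1 by (simp add: ready_def)
      next
        case 3 then show ?case by (rule Y)
      next
        case 4 then show ?case using rd1 j by (simp add: ready_def j_def)
      next
        case (5 s2 t2)
        have fr2: "frame {''j'', ''ok'', ''p'', ''e''} {''cur'', ''ans''} s1 s2"
          by (rule frame_trans[OF frame_refl 5(1)]) auto
        have rd2: "ready Ls w s2" by (rule ready_frame[OF rd1 frame_trans[OF frame_refl fr2]]) auto
        have s2: "reg s2 ''j'' = j" "arr s2 ''cur'' = arr s1 ''cur''" using 5(1) by (simp_all add: frame_def j_def)
        have wj: "(\<Sum>p \<in> entries s1 (reg s1 ''j''). gap s1 p) = w j" "(\<Sum>p \<in> entries s2 (reg s2 ''j''). gap s2 p) = w j"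
          using rd1 rd2 j s2 by (simp_all add: ready_def j_def)
        have t2: "t2 \<le> t1 + 5 + 17 * w j" using 5(2) wj by simp
        show ?case
        proof (cases "Ls ! j \<in> rotations_at G ?Y")
          case True
          have "wp D Q apply_listed (\<lambda>s' t'. wp D Q (Assign ''j'' (Inc (Reg ''j''))) I s' t') s2 (Suc t2)"
          proof (rule wp_apply_listed[where R = "Ls ! j"], goal_cases)
            case 1 show ?case using Y s2 by simp
          next
            case 2 show ?case using rd2 j s2 by (simp add: ready_def)
          next
            case 3 show ?case using True s2 by simp
          next
            case (4 s3 t3)
            have "reg s3 ''j'' = j" using 4(1) s2 by (simp add: frame_def)
            moreover have "I (set_reg ''j'' (Suc j) s3) (Suc t3)"
            proof (rule keep)
              show "frame {''j'', ''ok'', ''p'', ''e''} {''cur'', ''ans''} s1 s3"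
                by (rule frame_trans[OF fr2 4(1)]) auto
              show "t3 \<le> t1 + 8 + 21 * w j" using 4(2) t2 wj by simp
              have m3: "matched (arr s3 ''cur'') = apply_rotation (Ls ! j) ?Y" using 4(3) s2 by simp
              show "stable G (matched (arr s3 ''cur''))" unfolding m3 by (rule stable_apply_rotation[OF Y True])
              show "passed (matched (arr s3 ''cur'')) = ?S (Suc j)"
                unfolding m3 passed_apply[OF least Y True] pY done_step using True step ji by simp
            qed
            ultimately show ?case unfolding wp_Assign by simp
          qed
          then show ?thesis unfolding wp_Cond using 5(3) True by simp
        next
          case False
          have "I (set_reg ''j'' (Suc j) s2) (Suc (Suc (Suc t2)))"
            by (rule keep[OF fr2]) (use t2 s2 Y pY done_step step False in simp_all)
          then show ?thesis unfolding wp_simps using 5(3) False s2 by simp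
        qed
      qed
      show ?thesis using W neq reg1 unfolding wp_Seq wp_Cond by simp
    qed
  next
    case (4 s1 t1)
    have fr1: "frame {''j'', ''ok'', ''p'', ''e''} {''cur'', ''ans''} s s1" using 4(1) by (simp add: I_def)
    have "reg s1 ''nR'' = ?N" using fr1 rd by (simp add: ready_def frame_def)
    then have "reg s1 ''j'' = ?N" using 4 by (simp add: I_def)
    then show ?case using 4(1) P[OF fr1] by (simp add: I_def)
  qed
qed

lemma output_arcs_add:
  "output_arcs (set_reg ''nH'' (Suc (reg s ''nH'')) (set_arr ''head'' ((arr s ''head'')(reg s ''nH'' := b))
     (set_arr ''tail'' ((arr s ''tail'')(reg s ''nH'' := a)) s))) = insert (a, b) (output_arcs s)"
proof -
  have img: "output_arcs s = (\<lambda>k. (arr s ''tail'' k, arr s ''head'' k)) ` {..<reg s ''nH''}" for s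
    by (auto simp: output_arcs_def)
  show ?thesis unfolding img by (simp add: lessThan_Suc)
qed

lemma output_arcs_cong:
  "reg s' ''nH'' = reg s ''nH'' \<Longrightarrow> arr s' ''tail'' = arr s ''tail'' \<Longrightarrow> arr s' ''head'' = arr s ''head'' \<Longrightarrow>
   output_arcs s' = output_arcs s"
  unfolding output_arcs_def by simp

lemma wp_cover_pass:
  fixes s :: store
  defines "Y \<equiv> matched (arr s ''cur'')"
  assumes least: "least_stable G X0" and rd: "ready Ls w s" and Y: "stable G Y"
    and P: "\<And>s' t'. frame {''j'', ''ok'', ''p'', ''e'', ''nH''} {''ans'', ''tail'', ''head''} s s' \<Longrightarrow>
      t' \<le> t + 2 + 9 * length Ls + 17 * (\<Sum>l < length Ls. w l) \<Longrightarrow>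
      output_arcs s' = output_arcs s \<union> {(reg s ''i'', j) | j. j < length Ls \<and> Ls ! j \<in> rotations_at G Y} \<Longrightarrow> P s' t'"
  shows "wp D Q cover_pass P s t"
proof -
  let ?N = "length Ls" and ?i = "reg s ''i''"
  let ?A = "\<lambda>m. {(?i, j) | j. j < m \<and> Ls ! j \<in> rotations_at G Y}"
  define I where "I = (\<lambda>s' t'. frame {''j'', ''ok'', ''p'', ''e'', ''nH''} {''ans'', ''tail'', ''head''} s s' \<and>
    reg s' ''j'' \<le> ?N \<and> output_arcs s' = output_arcs s \<union> ?A (reg s' ''j'') \<and>
    t' \<le> t + 1 + 9 * reg s' ''j'' + 17 * (\<Sum>l < reg s' ''j''. w l))"
  show ?thesis unfolding cover_pass_def wp_Seq wp_Assign
  proof (rule wp_Loop[where I = I and T = "t + 1 + 9 * ?N + 17 * (\<Sum>l < ?N. w l)"], goal_cases)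
    case 1
    have "output_arcs (set_reg ''j'' 0 s) = output_arcs s" by (rule output_arcs_cong) simp_all
    then show ?case by (simp add: I_def)
  next
    case (2 s' t')
    have j: "reg s' ''j'' \<le> ?N" using 2 by (simp add: I_def)
    then show ?case using 2 sum_prefix_le[OF j, of w] unfolding I_def by linarith
  next
    case (3 s1 t1)
    define j where "j = reg s1 ''j''"
    have fr1: "frame {''j'', ''ok'', ''p'', ''e'', ''nH''} {''ans'', ''tail'', ''head''} s s1"
      and arcs1: "output_arcs s1 = output_arcs s \<union> ?A j"
      and t1: "t1 \<le> t + 1 + 9 * j + 17 * (\<Sum>l < j. w l)" using 3(1) unfolding I_def j_def by blast+
    have rd1: "ready Ls w s1" by (rule ready_frame[OF rd frame_trans[OF frame_refl fr1]]) auto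
    have reg1: "reg s1 ''nR'' = ?N" "reg s1 ''i'' = ?i" "arr s1 ''cur'' = arr s ''cur''"
      using rd1 fr1 by (simp_all add: ready_def frame_def)
    have j: "j < ?N" using 3(2) reg1 by (simp add: j_def)
    have A: "?A (Suc j) = (if Ls ! j \<in> rotations_at G Y then insert (?i, j) (?A j) else ?A j)"
      unfolding less_Suc_eq by auto
    show ?case unfolding wp_Seq
    proof (rule wp_test_rotation[OF least, where R = "Ls ! j"], goal_cases)
      case 1 then show ?case using rd1 by (simp add: ready_def)
    next
      case 2 then show ?case using rd1 by (simp add: ready_def)
    next
      case 3 then show ?case using Y reg1 by (simp add: Y_def)
    next
      case 4 then show ?case using rd1 j by (simp add: ready_def j_def)
    next
      case (5 s2 t2)
      have fr2: "frame {''j'', ''ok'', ''p'', ''e'', ''nH''} {''ans'', ''tail'', ''head''} s s2"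
        by (rule frame_trans[OF fr1 5(1)]) auto
      have s2: "reg s2 ''j'' = j" "reg s2 ''i'' = ?i" using 5(1) reg1 by (simp_all add: frame_def j_def)
      have arcs2: "output_arcs s2 = output_arcs s \<union> ?A j"
        unfolding arcs1[symmetric] by (rule output_arcs_cong) (use 5(1) in \<open>simp_all add: frame_def\<close>)
      have "(\<Sum>p \<in> entries s1 (reg s1 ''j''). gap s1 p) = w j" using rd1 j by (simp add: ready_def j_def)
      then have t2: "t2 \<le> t1 + 4 + 17 * w j" using 5(2) by simp
      have ok: "reg s2 ''ok'' = (if Ls ! j \<in> rotations_at G Y then 1 else 0)" using 5(3) reg1 by (simp add: Y_def)
      let ?s3 = "set_reg ''nH'' (Suc (reg s2 ''nH'')) (set_arr ''head'' ((arr s2 ''head'')(reg s2 ''nH'' := j))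
         (set_arr ''tail'' ((arr s2 ''tail'')(reg s2 ''nH'' := ?i)) s2))"
      define s3 where "s3 = (if Ls ! j \<in> rotations_at G Y then ?s3 else s2)"
      have arcs3: "output_arcs (set_reg ''j'' (Suc j) s3) = output_arcs s \<union> ?A (Suc j)"
      proof -
        have "output_arcs (set_reg ''j'' (Suc j) s3) = output_arcs s3" by (rule output_arcs_cong) simp_all
        then show ?thesis unfolding A s3_def using output_arcs_add[of s2 j ?i] arcs2 by simp
      qed
      have "frame {''j'', ''ok'', ''p'', ''e'', ''nH''} {''ans'', ''tail'', ''head''} s (set_reg ''j'' (Suc j) s3)"
        using fr2 by (simp add: s3_def)
      then have fin: "I (set_reg ''j'' (Suc j) s3) t'" if "t' \<le> t2 + 5" for t'
        unfolding I_def using arcs3 that t2 t1 j by simp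
      show ?case
      proof (cases "Ls ! j \<in> rotations_at G Y")
        case True
        then have "s3 = ?s3" by (simp add: s3_def)
        then show ?thesis using True fin[of "Suc (Suc (Suc (Suc (Suc t2))))"] ok s2 unfolding wp_simps by simp
      next
        case False
        then have "s3 = s2" by (simp add: s3_def)
        then show ?thesis using False fin[of "Suc (Suc (Suc t2))"] ok s2 unfolding wp_simps by simp
      qed
    qed
  next
    case (4 s1 t1)
    have fr1: "frame {''j'', ''ok'', ''p'', ''e'', ''nH''} {''ans'', ''tail'', ''head''} s s1" using 4(1) by (simp add: I_def)
    have "reg s1 ''nR'' = ?N" using fr1 rd by (simp add: ready_def frame_def)
    then have "reg s1 ''j'' = ?N" using 4 by (simp add: I_def)
    then show ?case using 4(1) P[OF fr1] by (simp add: I_def)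
  qed
qed

text \<open>Every round consists of two passes through the list and takes time linear in the number of edges.\<close>

lemma wp_build_hasse:
  assumes least: "least_stable G X0" and full: "full_route G Ls" and rd: "ready Ls w s"
    and base: "matched (arr s ''base'') = X0" and nH: "reg s ''nH'' = 0"
    and N: "length Ls \<le> n" and w: "(\<Sum>l < length Ls. w l) \<le> n"
    and P: "\<And>s' t'. frame hasse_regs hasse_arrs s s' \<Longrightarrow> t' \<le> t + 2 + n * (63 * n + 11) \<Longrightarrow>
      output_arcs s' = {(i, j). i < length Ls \<and> j < length Ls \<and> rot_covers G (Ls ! i) (Ls ! j)} \<Longrightarrow> P s' t'"
  shows "wp D Q build_hasse P s t"
proof -
  let ?N = "length Ls"
  have set: "set Ls = rotations G" using full_route_split(1)[OF least full] .
  let ?A = "\<lambda>m. {(i, j). i < m \<and> j < ?N \<and> rot_covers G (Ls ! i) (Ls ! j)}"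
  define I where "I = (\<lambda>s' t'. frame hasse_regs hasse_arrs s s' \<and> reg s' ''i'' \<le> ?N \<and>
    output_arcs s' = ?A (reg s' ''i'') \<and> t' \<le> t + 1 + reg s' ''i'' * (63 * n + 11))"
  have mono: "m * (63 * n + 11) \<le> n * (63 * n + 11)" if "m \<le> ?N" for m
    using that N by (intro mult_le_mono1) simp
  show ?thesis unfolding build_hasse_def wp_Seq wp_Assign
  proof (rule wp_Loop[where I = I and T = "t + 1 + n * (63 * n + 11)"], goal_cases)
    case 1
    have "output_arcs (set_reg ''i'' 0 s) = {}" using nH by (simp add: output_arcs_def)
    then show ?case by (simp add: I_def)
  next
    case (2 s' t')
    then show ?case using mono[of "reg s' ''i''"] unfolding I_def by linarith
  next
    case (3 s1 t1)
    define i where "i = reg s1 ''i''"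
    have fr1: "frame hasse_regs hasse_arrs s s1" and arcs1: "output_arcs s1 = ?A i"
      and t1: "t1 \<le> t + 1 + i * (63 * n + 11)" using 3(1) unfolding I_def i_def by blast+
    have rd1: "ready Ls w s1" by (rule ready_frame[OF rd fr1])
    have reg1: "reg s1 ''nR'' = ?N" "reg s1 ''nE'' = n" "arr s1 ''base'' = arr s ''base''"
      using rd1 fr1 by (simp_all add: ready_def frame_def static_def)
    have i: "i < ?N" using 3(2) reg1 by (simp add: i_def)
    show ?case unfolding wp_Seq
    proof (rule wp_copy_flags, goal_cases)
      case 1 show ?case by simp
    next
      case 2 show ?case by (rule reg1(2))
    next
      case (3 s2 t2)
      have fr2: "frame hasse_regs hasse_arrs s1 s2" by (rule frame_trans[OF frame_refl 3(1)]) auto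
      have rd2: "ready Ls w s2" by (rule ready_frame[OF rd1 fr2])
      have i2: "reg s2 ''i'' = i" using 3(1) by (simp add: frame_def i_def)
      have "{k. k < n \<and> arr s2 ''cur'' k \<noteq> 0} = {k. k < n \<and> arr s ''base'' k \<noteq> 0}" using 3(3) reg1 by auto
      then have m2: "matched (arr s2 ''cur'') = X0" using base by (simp add: matched_def)
      show ?case
      proof (rule wp_skip_pass[OF least full rd2 _ m2], goal_cases)
        case 1 show ?case using i i2 by simp
      next
        case (2 s3 t3)
        have fr3: "frame hasse_regs hasse_arrs s2 s3" by (rule frame_trans[OF frame_refl 2(1)]) auto
        let ?Y = "matched (arr s3 ''cur'')"
        have i3: "reg s3 ''i'' = i" using 2(1) i2 by (simp add: frame_def)
        define s4 where "s4 = set_reg ''j'' i s3"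
        have fr4: "frame hasse_regs hasse_arrs s2 s4" using fr3 by (simp add: s4_def)
        have rd4: "ready Ls w s4" by (rule ready_frame[OF rd2 fr4])
        have s4: "reg s4 ''j'' = i" "arr s4 = arr s3" "reg s4 ''i'' = i" using i3 by (simp_all add: s4_def)
        have Y: "stable G ?Y" by (rule 2(3))
        have pY: "passed ?Y = {Ls ! l | l. l < ?N \<and> l \<noteq> i \<and> \<not> rot_less G (Ls ! i) (Ls ! l)}"
          using 2(4) i2 by simp
        note av = skip_end[OF least full i Y pY]
        have "wp D Q apply_listed (\<lambda>s' t'. wp D Q cover_pass (\<lambda>s' t'. wp D Q (Assign ''i'' (Inc (Reg ''i''))) I s' t') s' t')
          s4 (Suc t3)"
        proof (rule wp_apply_listed[where R = "Ls ! i"], goal_cases)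
          case 1 show ?case using Y s4 by simp
        next
          case 2 show ?case using rd4 i s4 by (simp add: ready_def)
        next
          case 3 show ?case using av(1) s4 by simp
        next
          case (4 s5 t5)
          have fr5: "frame hasse_regs hasse_arrs s4 s5" by (rule frame_trans[OF frame_refl 4(1)]) auto
          have rd5: "ready Ls w s5" by (rule ready_frame[OF rd4 fr5])
          have m5: "matched (arr s5 ''cur'') = apply_rotation (Ls ! i) ?Y" using 4(3) s4 by simp
          have Y5: "stable G (matched (arr s5 ''cur''))" unfolding m5 by (rule stable_apply_rotation[OF Y av(1)])
          have i5: "reg s5 ''i'' = i" using 4(1) s4 by (simp add: frame_def)
          have "w i \<le> (\<Sum>l < ?N. w l)" using i by (intro member_le_sum) auto
          moreover have "(\<Sum>p \<in> entries s4 (reg s4 ''j''). gap s4 p) = w i" using rd4 i s4 by (simp add: ready_def)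
          ultimately have t5: "t5 \<le> t3 + 3 + 4 * n" using 4(2) w by simp
          show ?case
          proof (rule wp_cover_pass[OF least rd5 Y5], goal_cases)
            case (1 s6 t6)
            have "frame hasse_regs hasse_arrs s5 s6" by (rule frame_trans[OF frame_refl 1(1)]) auto
            then have fr6: "frame hasse_regs hasse_arrs s s6"
              using frame_trans[OF frame_trans[OF frame_trans[OF frame_trans[OF fr1 fr2] fr4] fr5]] by simp
            have i6: "reg s6 ''i'' = i" using 1(1) i5 by (simp add: frame_def)
            have arcs5: "output_arcs s5 = ?A i" unfolding arcs1[symmetric]
              by (rule output_arcs_cong)
                (use 3(1) 2(1) 4(1) in \<open>simp_all add: frame_def s4_def\<close>)
            have cov: "Ls ! j \<in> rotations_at G (matched (arr s5 ''cur'')) \<longleftrightarrow> rot_covers G (Ls ! i) (Ls ! j)"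
              if "j < ?N" for j
            proof (rule available_iff_covers[OF least Y5])
              show "Ls ! i \<in> rotations G" "Ls ! j \<in> rotations G" using set i that nth_mem by blast+
              show "passed (matched (arr s5 ''cur'')) = {Q \<in> rotations G. \<not> rot_less G (Ls ! i) Q}"
                unfolding m5 by (rule av(2))
            qed
            have "output_arcs s6 = ?A (Suc i)"
              unfolding 1(3) arcs5 i5 using cov by (auto simp: less_Suc_eq)
            then have arcs6: "output_arcs (set_reg ''i'' (Suc i) s6) = ?A (Suc i)" by (simp add: output_arcs_def)
            have "t6 \<le> t1 + 10 + 18 * ?N + 45 * n"
              using 1(2) t5 2(2) 3(2) w by simp
            then have "Suc t6 \<le> t + 1 + Suc i * (63 * n + 11)" using t1 N by simp
            then have "I (set_reg ''i'' (Suc i) s6) (Suc t6)" using fr6 arcs6 i by (simp add: I_def)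
            then show ?case unfolding wp_Assign using i6 by simp
          qed
        qed
        then show ?case unfolding wp_Assign using i3 by (simp add: s4_def)
      qed
    qed
  next
    case (4 s1 t1)
    have fr1: "frame hasse_regs hasse_arrs s s1" using 4(1) by (simp add: I_def)
    have "reg s1 ''nR'' = ?N" using fr1 rd by (simp add: ready_def frame_def)
    then have i: "reg s1 ''i'' = ?N" using 4 by (simp add: I_def)
    have t1: "t1 \<le> t + 1 + ?N * (63 * n + 11)" and arcs: "output_arcs s1 = ?A ?N"
      using 4(1) i by (simp_all add: I_def)
    have "Suc t1 \<le> t + 2 + n * (63 * n + 11)" using t1 mono[OF order_refl] by linarith
    then show ?case using arcs by (rule P[OF fr1])
  qed
qed

lemma wp_hasse_output:
  assumes least: "least_stable G X0" and great: "greatest_stable G T" and st: "static s" and li: "linked s"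
    and rl: "route_listed s X0 Ls T" and base: "matched (arr s ''base'') = X0" and nH: "reg s ''nH'' = 0"
    and P: "\<And>s' t'. t' \<le> t + 2 + n * (63 * n + 11) \<Longrightarrow> outputs_rotation_poset G es s' \<Longrightarrow> P s' t'"
  shows "wp D Q build_hasse P s t"
proof -
  let ?N = "length Ls"
  note r = rl[unfolded route_listed_def]
  have s0: "stable G X0" and sT: "stable G T" using least great by (simp_all add: least_stable_def greatest_stable_def)
  have full: "full_route G Ls" using r full_route_iff[OF least great] by blast
  have set: "set Ls = rotations G" and dist: "distinct Ls" using full_route_split[OF least full] by blast+
  have "depth T \<le> n" using depth_le stableD(1,2)[OF sT] card_E by metis
  then have N: "?N \<le> n" using route_stable[OF s0] r by fastforce
  define w where "w = (\<lambda>j. \<Sum>p \<in> entries s j. gap s p)"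
  have rd: "ready Ls w s" unfolding ready_def w_def using st li r by simp
  have w: "(\<Sum>l < ?N. w l) \<le> n" unfolding w_def by (rule total_gap[OF rl sT])
  show ?thesis
  proof (rule wp_build_hasse[OF least full rd base nH N w], rule P, assumption)
    fix s' t' assume fr: "frame hasse_regs hasse_arrs s s'"
      and arcs: "output_arcs s' = {(i, j). i < ?N \<and> j < ?N \<and> rot_covers G (Ls ! i) (Ls ! j)}"
    have rl': "route_listed s' X0 Ls T" by (rule route_listed_frame[OF rl fr]) simp_all
    note r' = rl'[unfolded route_listed_def]
    have nR: "reg s' ''nR'' = ?N" using r' by blast
    have li': "listed s' j (Ls ! j)" if "j < ?N" for j using r' that by blast
    have bl: "block s' ''plus'' ''plusStart'' j = arr s' ''plus'' ` entries s' j"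
      "block s' ''minus'' ''minusStart'' j = arr s' ''minus'' ` entries s' j" if "j < ?N" for j
      using r' that by (simp_all add: block_def)
    have out: "output_rotation es s' j = Ls ! j" if "j < ?N" for j
    proof -
      have "fst (Ls ! j) = edge_at s' ''plus'' ` entries s' j" "snd (Ls ! j) = edge_at s' ''minus'' ` entries s' j"
        using li'[OF that] unfolding listed_def by blast+
      then show ?thesis unfolding output_rotation_def bl[OF that] image_image by (metis prod.collapse)
    qed
    have blocks: "block s' ''plus'' ''plusStart'' j \<subseteq> {..<n} \<and> block s' ''minus'' ''minusStart'' j \<subseteq> {..<n}"
      if "j < ?N" for j
      using li'[OF that] unfolding bl[OF that] listed_def by (simp add: image_subset_iff)
    have bij: "bij_betw (output_rotation es s') {..<?N} (rotations G)"
    proof -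
      have "bij_betw (\<lambda>j. Ls ! j) {..<?N} (rotations G)" using dist set by (intro bij_betw_nth) auto
      then show ?thesis using out by (subst bij_betw_cong[of _ _ "\<lambda>j. Ls ! j"]) simp_all
    qed
    let ?H = "{(P, Q). rot_covers G P Q}"
    have tr: "(i, j) \<in> (output_arcs s')\<^sup>+ \<longleftrightarrow> rot_less G (Ls ! i) (Ls ! j)" if ij: "i < ?N" "j < ?N" for i j
      unfolding rot_less_iff_covers_trancl[OF least]
    proof
      assume "(i, j) \<in> (output_arcs s')\<^sup>+"
      then show "(Ls ! i, Ls ! j) \<in> ?H\<^sup>+"
      proof (induction rule: trancl_induct)
        case (base y) then show ?case using arcs by (simp add: r_into_trancl)
      next
        case (step y z)
        then have "(Ls ! y, Ls ! z) \<in> ?H" using arcs by simp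
        with step.IH show ?case by (rule trancl_into_trancl)
      qed
    next
      assume "(Ls ! i, Ls ! j) \<in> ?H\<^sup>+"
      then have "\<forall>m < ?N. Ls ! m = Ls ! j \<longrightarrow> (i, m) \<in> (output_arcs s')\<^sup>+"
      proof (induction "Ls ! j" arbitrary: j rule: trancl_induct)
        case base
        then show ?case using arcs ij(1) by (auto intro!: r_into_trancl)
      next
        case (step y)
        have "y \<in> set Ls" using step(2) set unfolding rot_covers_def rot_less_def by blast
        then obtain l where l: "l < ?N" "y = Ls ! l" by (metis in_set_conv_nth)
        then have "(i, l) \<in> (output_arcs s')\<^sup>+" using step(3)[of l] by blast
        moreover have "(l, m) \<in> output_arcs s'" if "m < ?N" "Ls ! m = Ls ! j" for m
          using step(2) l that arcs by simp
        ultimately show ?case by (meson trancl_into_trancl)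
      qed
      then show "(i, j) \<in> (output_arcs s')\<^sup>+" using ij(2) by blast
    qed
    have sub: "output_arcs s' \<subseteq> {..<?N} \<times> {..<?N}" unfolding arcs by auto
    have mem: "(i, j) \<in> output_arcs s' \<longleftrightarrow> rot_covers G (Ls ! i) (Ls ! j)" if "i < ?N" "j < ?N" for i j
      unfolding arcs using that by simp
    show "outputs_rotation_poset G es s'"
      unfolding outputs_rotation_poset_def nR using blocks bij sub mem tr out by simp
  qed
qed


section \<open>Correctness and running time of the whole program\<close>

lemma poset_program_correct:
  "wp D Q poset_program (\<lambda>s t. outputs_rotation_poset G es s \<and> t \<le> 400 * (n\<^sup>2 + 1)) (input_store G es) 0"
proof -
  let ?s0 = "input_store G es"
  have z: "arr ?s0 x = (\<lambda>_. 0)" if "x \<notin> {''endW'', ''endF'', ''rank''}" for x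
    using that by (simp add: input_store_def)
  have zr: "reg ?s0 x = 0" if "x \<notin> {''nW'', ''nF'', ''nE''}" for x
    using that by (simp add: input_store_def)
  show ?thesis unfolding poset_program_def wp_Seq
  proof (rule wp_link_edges[OF static_input], goal_cases)
    case (1 s1 t1)
    have st1: "static s1" by (rule static_frame[OF static_input 1(1)]) simp_all
    have "arr s1 ''cur'' = (\<lambda>_. 0)" using 1(1) z by (simp add: frame_def)
    then have m1: "matched (arr s1 ''cur'') = {}" by (simp add: matched_def)
    show ?case
    proof (rule wp_run_proposals[OF st1 1(2) m1], goal_cases)
      case (1 s2 t2)
      have st2: "static s2" by (rule static_frame[OF st1 1(1)]) simp_all
      have li2: "linked s2" by (rule linked_frame[OF \<open>linked s1\<close> 1(1)]) simp
      let ?X0 = "matched (arr s2 ''cur'')"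
      have least: "least_stable G ?X0" by (rule 1(2))
      show ?case
      proof (rule wp_copy_flags, goal_cases)
        case 1 show ?case by simp
      next
        case 2 show ?case using st2 by (simp add: static_def)
      next
        case (3 s3 t3)
        have st3: "static s3" by (rule static_frame[OF st2 3(1)]) simp_all
        have li3: "linked s3" by (rule linked_frame[OF li2 3(1)]) simp
        have "{k. k < n \<and> arr s3 ''base'' k \<noteq> 0} = {k. k < n \<and> arr s2 ''cur'' k \<noteq> 0}" using 3(3) by auto
        then have base3: "matched (arr s3 ''base'') = ?X0" by (simp add: matched_def)
        have cur3: "arr s3 ''cur'' = arr s2 ''cur''" using 3(1) by (simp add: frame_def)
        have zero3: "arr s3 ''fin'' = (\<lambda>_. 0)" "arr s3 ''ons'' = (\<lambda>_. 0)" "arr s3 ''plusStart'' = (\<lambda>_. 0)"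
          "arr s3 ''minusStart'' = (\<lambda>_. 0)" "reg s3 ''ht'' = 0" "reg s3 ''nR'' = 0" "reg s3 ''nH'' = 0"
          using 3(1) \<open>frame {''i'', ''e'', ''r'', ''k''} {''cur'', ''ans''} s1 s2\<close>
            \<open>frame {''i'', ''r'', ''k''} {''nxt''} ?s0 s1\<close> z zr by (simp_all add: frame_def)
        have "stable G ?X0" using least by (simp add: least_stable_def)
        then have "search_inv ?X0 0 (arr s3 ''stk'') (arr s3 ''alt'') (arr s3 ''ons'') (arr s3 ''fin'')"
          using zero3 by (simp add: search_inv_def)
        moreover have "route_listed s3 ?X0 [] ?X0" using zero3 by (simp add: route_listed_def)
        ultimately have ss: "search_state ?X0 s3" unfolding search_state_def using cur3 zero3 by auto
        show ?case
        proof (rule wp_search_rotations[OF st3 li3 ss least], goal_cases)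
          case (1 s4 t4 Ls)
          have st4: "static s4" by (rule static_frame[OF st3 1(1)]) simp_all
          have li4: "linked s4" by (rule linked_frame[OF li3 1(1)]) simp
          have base4: "matched (arr s4 ''base'') = ?X0" using base3 1(1) by (simp add: frame_def)
          have nH4: "reg s4 ''nH'' = 0" using zero3 1(1) by (simp add: frame_def)
          show ?case
          proof (rule wp_hasse_output[OF least 1(4) st4 li4 1(3) base4 nH4], intro conjI, assumption)
            fix s5 t5 assume t5: "t5 \<le> t4 + 2 + n * (63 * n + 11)"
            have "t5 \<le> 163 * (n * n) + 185 * n + 42"
              using t5 1(2) 3(2) \<open>t2 \<le> _\<close> \<open>t1 \<le> _\<close> by (simp add: algebra_simps)
            \<comment> \<open>the sum of the linear bounds of all phases is absorbed by the quadratic ones\<close>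
            moreover have "n \<le> n * n" by (cases n) simp_all
            ultimately have "t5 \<le> 400 * (n * n) + 400" by linarith
            then show "t5 \<le> 400 * (n\<^sup>2 + 1)" by (simp add: power2_eq_square)
          qed
        qed
      qed
    qed
  qed
qed

end


theorem theorem5p4:
  shows "\<exists>(prog :: com) (c :: nat). \<forall>(G :: (nat, nat) market) (es :: (nat \<times> nat) list).
           market G \<and> numbering G es \<longrightarrow>
           (\<exists>t s. exec (edge_numbers es) (choice_oracle G es) prog (input_store G es) t s \<and>
                  t \<le> c * ((card (edges G))\<^sup>2 + 1) \<and>
                  outputs_rotation_poset G es s)"
proof (rule exI[of _ poset_program], rule exI[of _ 400], intro allI impI)
  fix G :: "(nat, nat) market" and es :: "(nat \<times> nat) list"
  assume "market G \<and> numbering G es"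
  then interpret market_input G es
    by unfold_locales simp_all
  obtain t s where "exec D Q poset_program (input_store G es) t s" "outputs_rotation_poset G es s"
      "t \<le> 400 * (n\<^sup>2 + 1)"
    using poset_program_correct unfolding wp_def by auto
  then show "\<exists>t s. exec D Q poset_program (input_store G es) t s \<and>
      t \<le> 400 * ((card E)\<^sup>2 + 1) \<and> outputs_rotation_poset G es s"
    unfolding card_E by blast
qed

end
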